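(* The maps $s_i$, $i=1,\dots,n-1$, defined on the generators of $\mathrm{Diff}_{\mathbf h}(n,N)$ (for all $\alpha=1,\dots,N$) by $$s_i(x^{i,\alpha})=-x^{i+1,\alpha}\,\tilde h_{i,i+1},\quad s_i(x^{i+1,\alpha})=x^{i,\alpha}\frac{1}{\tilde h_{i,i+1}},\quad s_i(x^{j,\alpha})=x^{j,\alpha}\ \text{for } j\ne i,i+1,$$ $$s_i(\bar\partial_{i,\alpha})=-\frac{1}{\tilde h_{i,i+1}}\bar\partial_{i+1,\alpha},\quad s_i(\bar\partial_{i+1,\alpha})=\tilde h_{i,i+1}\,\bar\partial_{i,\alpha},\quad s_i(\bar\partial_{j,\alpha})=\bar\partial_{j,\alpha}\ \text{for } j\ne i,i+1,$$ $$s_i(\tilde h_j)=\tilde h_{s_i(j)}\quad (j=1,\dots,n),$$ extend to automorphisms of the ring $\mathrm{Diff}_{\mathbf h}(n,N)$. Moreover, these automorphisms satisfy the Artin relations and therefore give an action of the symmetric group $\mathrm S_n$ by automorphisms (with $s_i$ being the action of the transposition $(i,i+1)$).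
   Context: $n,N\ge 1$ are integers; $\mathfrak{k}$ is a commutative ground ring of characteristic zero. In $s_i(j)$, $s_i$ denotes the transposition $(i,i+1)$. $\mathrm{U}(\mathbf h)=\mathfrak{k}[\tilde h_1,\dots,\tilde h_n]$ is the polynomial ring; $\tilde h_{ij}:=\tilde h_i-\tilde h_j$; $\bar{\mathrm U}(\mathbf h)$ is the localization of $\mathrm{U}(\mathbf h)$ at the multiplicative set generated by all $\tilde h_{ij}+k$, $i\ne j$, $k\in\mathbb{Z}$. For $p\in\bar{\mathrm U}(\mathbf h)$, $p[\varepsilon_k]$ is obtained from $p$ by the shift $\tilde h_k\mapsto\tilde h_k+1$, $\tilde h_l\mapsto\tilde h_l$ ($l\ne k$). Let $\hat{\mathrm R}=\{\hat{\mathrm R}_{ij}^{kl}\}$ have the nonzero entries $\hat{\mathrm R}_{ij}^{ij}=\frac{1}{\tilde h_{ij}}$ for $i\neq j$; $\hat{\mathrm R}_{ji}^{ij}=\frac{\tilde h_{ij}^2-1}{\tilde h_{ij}^2}$ for $i<j$; $\hat{\mathrm R}_{ji}^{ij}=1$ for $i\ge j$. The ring $\mathrm{Diff}_{\mathbf h}(n,N)$ is the $\mathfrak k$-algebra generated by $\bar{\mathrm U}(\mathbf h)$ and elements $x^{j,\alpha},\bar\partial_{j,\alpha}$, $j=1,\dots,n$, $\alpha=1,\dots,N$, with defining relations (besides those of $\bar{\mathrm U}(\mathbf h)$; relations for $\tilde h_i$ extend to all of $\bar{\mathrm U}(\mathbf h)$) $$\tilde h_ix^{j,\alpha}=x^{j,\alpha}(\tilde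 h_i+\delta_i^j),\qquad \tilde h_i\bar\partial_{j,\alpha}=\bar\partial_{j,\alpha}(\tilde h_i-\delta_i^j),$$ $$x^{i,\alpha}x^{j,\beta}=\sum_{k,l}\hat{\mathrm R}_{kl}^{ij}x^{k,\beta}x^{l,\alpha},\qquad \bar\partial_{i,\alpha}\bar\partial_{j,\beta}=\sum_{k,l}\hat{\mathrm R}_{ji}^{lk}\bar\partial_{k,\beta}\bar\partial_{l,\alpha},\qquad x^{i,\alpha}\bar\partial_{j,\beta}=\sum_{k,l}\hat{\mathrm R}_{lj}^{ki}[\varepsilon_k]\,\bar\partial_{k,\beta}x^{l,\alpha}-\delta^\alpha_\beta\delta^i_j.$$ It is free as a one-sided $\bar{\mathrm U}(\mathbf h)$-module. *)

theory Defs
  imports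
    "HOL-Library.Poly_Mapping"
    "HOL-Algebra.Sym_Groups"
    "HOL-Algebra.Group_Action"
    "HOL-Algebra.QuotRing"
begin

section \<open>Localization of a commutative ring at a multiplicative set\<close>

text \<open>The ring \<open>A\<close> is given as a subring of a commutative ring type, which need not be a domain;
  \<open>S \<subseteq> A\<close> is a multiplicative set.\<close>

inductive_set mult_closure :: "'a::comm_monoid_mult set \<Rightarrow> 'a set" for G where
  one: "1 \<in> mult_closure G"
| mult: "g \<in> G \<Longrightarrow> s \<in> mult_closure G \<Longrightarrow> g * s \<in> mult_closure G"

definition loc_rel :: "'a::comm_ring_1 set \<Rightarrow> 'a set \<Rightarrow> (('a \<times> 'a) \<times> ('a \<times> 'a)) set" where
  "loc_rel A S = {((p, s), (q, t)). p \<in> A \<and> q \<in> A \<and> s \<in> S \<and> t \<in> S \<and>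
     (\<exists>u\<in>S. u * (p * t - q * s) = 0)}"

definition loc_frac :: "'a::comm_ring_1 set \<Rightarrow> 'a set \<Rightarrow> 'a \<Rightarrow> 'a \<Rightarrow> ('a \<times> 'a) set" where
  "loc_frac A S p s = loc_rel A S `` {(p, s)}"

definition localization :: "'a::comm_ring_1 set \<Rightarrow> 'a set \<Rightarrow> ('a \<times> 'a) set ring" where
  "localization A S = \<lparr>
     carrier = (A \<times> S) // loc_rel A S,
     mult = (\<lambda>a b. \<Union>(p, s)\<in>a. \<Union>(q, t)\<in>b. loc_frac A S (p * q) (s * t)),
     one = loc_frac A S 1 1,
     zero = loc_frac A S 0 1,
     add = (\<lambda>a b. \<Union>(p, s)\<in>a. \<Union>(q, t)\<in>b. loc_frac A S (p * t + q * s) (s * t))\<rparr>"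


section \<open>The ring \<open>U(h)\<close>, its localization, and shifts\<close>

type_synonym 'k mpoly = "(nat \<Rightarrow>\<^sub>0 nat) \<Rightarrow>\<^sub>0 'k"
type_synonym 'k loc_elem = "('k mpoly \<times> 'k mpoly) set"

definition polyvar :: "nat \<Rightarrow> 'k::comm_ring_1 mpoly" where
  "polyvar i = Poly_Mapping.single (Poly_Mapping.single i 1) 1"

definition polyconst :: "'k \<Rightarrow> 'k::comm_ring_1 mpoly" where
  "polyconst c = Poly_Mapping.single 0 c"

definition U_h :: "nat \<Rightarrow> 'k::comm_ring_1 mpoly set" where
  "U_h n = {p. \<forall>m\<in>Poly_Mapping.keys p. Poly_Mapping.keys m \<subseteq> {1..n}}"

definition denoms :: "nat \<Rightarrow> 'k::comm_ring_1 mpoly set" where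
  "denoms n = mult_closure
     {polyvar i - polyvar j + of_int k | i j k. i \<in> {1..n} \<and> j \<in> {1..n} \<and> i \<noteq> j}"

definition U_loc :: "nat \<Rightarrow> 'k::comm_ring_1 loc_elem ring" where
  "U_loc n = localization (U_h n) (denoms n)"

abbreviation U_frac :: "nat \<Rightarrow> 'k::comm_ring_1 mpoly \<Rightarrow> 'k mpoly \<Rightarrow> 'k loc_elem" where
  "U_frac n \<equiv> loc_frac (U_h n) (denoms n)"

definition poly_subst :: "(nat \<Rightarrow> 'k mpoly) \<Rightarrow> 'k::comm_ring_1 mpoly \<Rightarrow> 'k mpoly" where
  "poly_subst f p =
     (\<Sum>m\<in>Poly_Mapping.keys p.
        polyconst (Poly_Mapping.lookup p m) * (\<Prod>i\<in>Poly_Mapping.keys m. f i ^ Poly_Mapping.lookup m i))"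

definition poly_shift :: "nat \<Rightarrow> 'k::comm_ring_1 mpoly \<Rightarrow> 'k mpoly" where
  "poly_shift k = poly_subst (\<lambda>l. if l = k then polyvar l + 1 else polyvar l)"

definition U_shift :: "nat \<Rightarrow> nat \<Rightarrow> 'k::comm_ring_1 loc_elem \<Rightarrow> 'k loc_elem" where
  "U_shift n k a = (\<Union>(p, s)\<in>a. U_frac n (poly_shift k p) (poly_shift k s))"


section \<open>The entries of the R-matrix\<close>

abbreviation hdiff :: "nat \<Rightarrow> nat \<Rightarrow> 'k::comm_ring_1 mpoly" where
  "hdiff i j \<equiv> polyvar i - polyvar j"

text \<open>\<open>Rhat n i j k l\<close> has upper indices \<open>i, j\<close> and lower indices \<open>k, l\<close>.\<close>

definition Rhat :: "nat \<Rightarrow> nat \<Rightarrow> nat \<Rightarrow> nat \<Rightarrow> nat \<Rightarrow> 'k::comm_ring_1 loc_elem" where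
  "Rhat n i j k l =
    (if k = i \<and> l = j \<and> i \<noteq> j then U_frac n 1 (hdiff i j)
     else if k = j \<and> l = i then
       (if i < j then U_frac n ((hdiff i j)\<^sup>2 - 1) ((hdiff i j)\<^sup>2) else U_frac n 1 1)
     else U_frac n 0 1)"


section \<open>The algebra \<open>Diff\<^sub>h(n,N)\<close>\<close>

text \<open>Free algebras are monoid algebras of free monoids; words form a monoid, written
  additively as required by \<open>Poly_Mapping\<close>, under concatenation.\<close>

datatype 'g word = Word (letters: "'g list")

instantiation word :: (type) monoid_add
begin

definition zero_word :: "'a word" where
  "0 = Word []"

definition plus_word :: "'a word \<Rightarrow> 'a word \<Rightarrow> 'a word" where
  "v + w = Word (letters v @ letters w)"

instance
  by standard (simp_all add: zero_word_def plus_word_def)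

end

type_synonym ('g, 'k) free_elem = "'g word \<Rightarrow>\<^sub>0 'k"

definition free_gen :: "'g \<Rightarrow> ('g, 'k::comm_ring_1) free_elem" where
  "free_gen g = Poly_Mapping.single (Word [g]) 1"

definition free_const :: "'k \<Rightarrow> ('g, 'k::comm_ring_1) free_elem" where
  "free_const c = Poly_Mapping.single 0 c"

definition free_algebra :: "'g set \<Rightarrow> ('g, 'k::comm_ring_1) free_elem ring" where
  "free_algebra G = \<lparr>
     carrier = {f. \<forall>w\<in>Poly_Mapping.keys f. set (letters w) \<subseteq> G},
     mult = (*), one = 1, zero = 0, add = (+)\<rparr>"

text \<open>The generators: all elements of the localized ring, \<open>x\<^sup>j\<^sup>,\<^sup>\<alpha>\<close>, and \<open>\<partial>\<^sub>j\<^sub>,\<^sub>\<alpha>\<close>.\<close>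

datatype 'u gen = GenU 'u | GenX nat nat | GenD nat nat

type_synonym 'k diff_pre = "('k loc_elem gen, 'k) free_elem"
type_synonym 'k diff_elem = "'k diff_pre set"

definition diff_gens :: "nat \<Rightarrow> nat \<Rightarrow> 'k::comm_ring_1 loc_elem gen set" where
  "diff_gens n N = GenU ` carrier (U_loc n)
     \<union> {GenX j a | j a. j \<in> {1..n} \<and> a \<in> {1..N}}
     \<union> {GenD j a | j a. j \<in> {1..n} \<and> a \<in> {1..N}}"

abbreviation fu :: "'k::comm_ring_1 loc_elem \<Rightarrow> 'k diff_pre" where
  "fu p \<equiv> free_gen (GenU p)"
abbreviation fh :: "nat \<Rightarrow> nat \<Rightarrow> 'k::comm_ring_1 diff_pre" where
  "fh n i \<equiv> fu (U_frac n (polyvar i) 1)"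
abbreviation fx :: "nat \<Rightarrow> nat \<Rightarrow> 'k::comm_ring_1 diff_pre" where
  "fx j a \<equiv> free_gen (GenX j a)"
abbreviation fd :: "nat \<Rightarrow> nat \<Rightarrow> 'k::comm_ring_1 diff_pre" where
  "fd j a \<equiv> free_gen (GenD j a)"

text \<open>A relation \<open>l = r\<close> is recorded as the element \<open>l - r\<close>. The first three families say that
  the localized ring maps to the quotient by a homomorphism of algebras. Commuting an arbitrary element of it past
  \<open>x\<^sup>j\<^sup>,\<^sup>\<alpha>\<close> or \<open>\<partial>\<^sub>j\<^sub>,\<^sub>\<alpha>\<close> is a consequence of the relations for the variables.\<close>

definition diff_rels :: "nat \<Rightarrow> nat \<Rightarrow> 'k::comm_ring_1 diff_pre set" where
  "diff_rels n N =
     {fu (p \<oplus>\<^bsub>U_loc n\<^esub> q) - (fu p + fu q) | p q. p \<in> carrier (U_loc n) \<and> q \<in> carrier (U_loc n)}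
   \<union> {fu (p \<otimes>\<^bsub>U_loc n\<^esub> q) - fu p * fu q | p q. p \<in> carrier (U_loc n) \<and> q \<in> carrier (U_loc n)}
   \<union> {fu (U_frac n (polyconst c) 1) - free_const c | c. True}
   \<union> {fh n i * fx j a - fx j a * (fh n i + (if i = j then 1 else 0)) | i j a.
        i \<in> {1..n} \<and> j \<in> {1..n} \<and> a \<in> {1..N}}
   \<union> {fh n i * fd j a - fd j a * (fh n i - (if i = j then 1 else 0)) | i j a.
        i \<in> {1..n} \<and> j \<in> {1..n} \<and> a \<in> {1..N}}
   \<union> {fx i a * fx j b - (\<Sum>k\<in>{1..n}. \<Sum>l\<in>{1..n}. fu (Rhat n i j k l) * fx k b * fx l a) | i j a b.
        i \<in> {1..n} \<and> j \<in> {1..n} \<and> a \<in> {1..N} \<and> b \<in> {1..N}}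
   \<union> {fd i a * fd j b - (\<Sum>k\<in>{1..n}. \<Sum>l\<in>{1..n}. fu (Rhat n l k j i) * fd k b * fd l a) | i j a b.
        i \<in> {1..n} \<and> j \<in> {1..n} \<and> a \<in> {1..N} \<and> b \<in> {1..N}}
   \<union> {fx i a * fd j b
        - ((\<Sum>k\<in>{1..n}. \<Sum>l\<in>{1..n}. fu (U_shift n k (Rhat n k i l j)) * fd k b * fx l a)
           - (if a = b \<and> i = j then 1 else 0)) | i j a b.
        i \<in> {1..n} \<and> j \<in> {1..n} \<and> a \<in> {1..N} \<and> b \<in> {1..N}}"

definition diff_ideal :: "nat \<Rightarrow> nat \<Rightarrow> 'k::comm_ring_1 diff_pre set" where
  "diff_ideal n N = Idl\<^bsub>free_algebra (diff_gens n N)\<^esub> (diff_rels n N)"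

definition Diff :: "nat \<Rightarrow> nat \<Rightarrow> 'k::comm_ring_1 diff_elem ring" where
  "Diff n N = free_algebra (diff_gens n N) Quot diff_ideal n N"

definition diff_class :: "nat \<Rightarrow> nat \<Rightarrow> 'k::comm_ring_1 diff_pre \<Rightarrow> 'k diff_elem" where
  "diff_class n N f = diff_ideal n N +>\<^bsub>free_algebra (diff_gens n N)\<^esub> f"

definition diff_const :: "nat \<Rightarrow> nat \<Rightarrow> 'k \<Rightarrow> 'k::comm_ring_1 diff_elem" where
  "diff_const n N c = diff_class n N (free_const c)"

definition diff_u :: "nat \<Rightarrow> nat \<Rightarrow> 'k::comm_ring_1 loc_elem \<Rightarrow> 'k diff_elem" where
  "diff_u n N p = diff_class n N (fu p)"

definition diff_x :: "nat \<Rightarrow> nat \<Rightarrow> nat \<Rightarrow> nat \<Rightarrow> 'k::comm_ring_1 diff_elem" where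
  "diff_x n N j a = diff_class n N (fx j a)"

definition diff_d :: "nat \<Rightarrow> nat \<Rightarrow> nat \<Rightarrow> nat \<Rightarrow> 'k::comm_ring_1 diff_elem" where
  "diff_d n N j a = diff_class n N (fd j a)"

text \<open>Automorphisms are linear over the ground ring, i.e. they fix its image.\<close>

definition Diff_aut :: "nat \<Rightarrow> nat \<Rightarrow> ('k::comm_ring_1 diff_elem \<Rightarrow> 'k diff_elem) set" where
  "Diff_aut n N = {f \<in> ring_iso (Diff n N) (Diff n N). \<forall>c. f (diff_const n N c) = diff_const n N c}"

end

theory Submission
  imports Defs
begin

text \<open>
  Let \<open>\<psi>\<^sub>j = (\<Prod>l<j. h\<^sub>j - h\<^sub>l)\<close>, which is invertible in the localized ring, and put \<open>y\<^sup>j = x\<^sup>j \<psi>\<^sub>j\<close> and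
  \<open>z\<^sub>j = \<psi>\<^sub>j\<^sup>-\<^sup>1 \<partial>\<^sub>j\<close>. The formulas for \<open>s\<^sub>i\<close> say precisely that \<open>s\<^sub>i\<close> exchanges the indices \<open>i\<close> and \<open>i + 1\<close>
  of the generators \<open>h\<^sub>j\<close>, \<open>y\<^sup>j\<close>, \<open>z\<^sub>j\<close>: passing from \<open>\<psi>\<^sub>i\<close> to \<open>\<psi>\<^bsub>i+1\<^esub>\<close> adds exactly one factor (\<open>gauge_suc\<close>),
  and the other \<open>\<psi>\<^sub>j\<close> are invariant (\<open>gauge_transpose_other\<close>). So the symmetric group should act by
  permuting the indices of \<open>h\<close>, \<open>y\<close>, \<open>z\<close>. In the original generators a permutation \<open>\<sigma>\<close> then sends \<open>x\<^sup>j\<close> to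
  \<open>x\<^bsup>\<sigma>j\<^esup> \<psi>\<^bsub>\<sigma>j\<^esub> \<sigma>(\<psi>\<^sub>j)\<^sup>-\<^sup>1\<close> and \<open>\<partial>\<^sub>j\<close> to \<open>\<sigma>(\<psi>\<^sub>j) \<psi>\<^bsub>\<sigma>j\<^esub>\<^sup>-\<^sup>1 \<partial>\<^bsub>\<sigma>j\<^esub>\<close>. This is multiplicative in \<open>\<sigma>\<close> because
  the coefficients form a coboundary, so that neither the Artin relations nor bijectivity need any
  computation with words in the \<open>s\<^sub>i\<close>.

  The content of the theorem is that these maps respect the defining relations, that is, that the
  relations become symmetric under permutations of the indices when they are written in \<open>h\<close>, \<open>y\<close>, \<open>z\<close>.
  They are not symmetric in \<open>x\<close>, \<open>\<partial>\<close>, since the coefficient of the swapped term of the R-matrix is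
  \<open>(h\<^sub>i\<^sub>j\<^sup>2 - 1) / h\<^sub>i\<^sub>j\<^sup>2\<close> for \<open>i < j\<close> but \<open>1\<close> for \<open>i > j\<close>. But \<open>y\<^sup>i y\<^sup>j = x\<^sup>i x\<^sup>j \<cdot> \<psi>\<^sub>i[\<epsilon>\<^sub>j] \<psi>\<^sub>j\<close>, and the shift in
  \<open>\<psi>\<^sub>i[\<epsilon>\<^sub>j]\<close> changes \<open>\<psi>\<^sub>i\<close> by the factor \<open>(h\<^sub>i\<^sub>j - 1) / h\<^sub>i\<^sub>j\<close> if \<open>j < i\<close> and not at all if \<open>j > i\<close>. The two
  asymmetries cancel: in both cases the swapped term acquires the coefficient \<open>(h\<^sub>i\<^sub>j - 1) / h\<^sub>i\<^sub>j\<close>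
  (\<open>swap_gauge\<close>). The same identity governs the relations among the \<open>\<partial>\<close> and those between \<open>x\<^sup>i\<close> and
  \<open>\<partial>\<^sub>j\<close> for \<open>i \<noteq> j\<close>. For \<open>i = j\<close> the latter are symmetric because \<open>\<partial>\<^sub>k x\<^sup>k\<close> has weight zero and equals
  \<open>z\<^sub>k y\<^sup>k\<close>.

  All computations take place in the free algebra modulo the two-sided ideal of the relations. The map
  \<open>twist \<sigma>\<close> is defined on the free algebra, \<open>twist_relation\<close> shows that it preserves the ideal,
  \<open>twist_comp\<close> that it is multiplicative in \<open>\<sigma>\<close> modulo the ideal, and \<open>act \<sigma>\<close> is the induced map.
\<close>

section \<open>Homomorphisms out of monoid algebras\<close>

locale unital_ring_hom =
  fixes f :: "'a::ring_1 \<Rightarrow> 'b::ring_1"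
  assumes hom_one: "f 1 = 1"
    and hom_add: "f (x + y) = f x + f y"
    and hom_mult: "f (x * y) = f x * f y"
begin

lemma hom_zero: "f 0 = 0"
  using hom_add[of 0 0] by simp

lemma hom_uminus: "f (- x) = - f x"
  using hom_add[of x "- x"] by (simp add: hom_zero eq_neg_iff_add_eq_0 add.commute)

lemma hom_diff: "f (x - y) = f x - f y"
  using hom_add[of x "- y"] by (simp add: hom_uminus)

lemma hom_power: "f (x ^ k) = f x ^ k"
  by (induction k) (simp_all add: hom_one hom_mult)

lemma hom_sum: "f (\<Sum>i\<in>A. g i) = (\<Sum>i\<in>A. f (g i))"
  by (induction A rule: infinite_finite_induct) (simp_all add: hom_zero hom_add)

lemma hom_of_nat: "f (of_nat k) = of_nat k"
  by (induction k) (simp_all add: hom_zero hom_one hom_add)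

lemma hom_of_int: "f (of_int k) = of_int k"
  by (cases k rule: int_cases2) (simp_all add: hom_of_nat hom_uminus)

lemmas hom_simps = hom_one hom_zero hom_add hom_mult hom_uminus hom_diff hom_power hom_of_int

end

lemma hom_prod:
  fixes f :: "'a::comm_ring_1 \<Rightarrow> 'b::comm_ring_1"
  assumes "unital_ring_hom f"
  shows "f (\<Prod>i\<in>A. g i) = (\<Prod>i\<in>A. f (g i))"
proof -
  interpret unital_ring_hom f by fact
  show ?thesis
    by (induction A rule: infinite_finite_induct) (simp_all add: hom_one hom_mult)
qed

lemma unital_ring_hom_comp:
  assumes "unital_ring_hom f" "unital_ring_hom g"
  shows "unital_ring_hom (\<lambda>x. f (g x))"
proof -
  interpret f: unital_ring_hom f by fact
  interpret g: unital_ring_hom g by fact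
  show ?thesis by standard (simp_all add: f.hom_simps g.hom_simps)
qed

lemma unital_ring_hom_id: "unital_ring_hom (\<lambda>x. x)"
  by standard simp_all

text \<open>The linear extension of \<open>\<phi>\<close> from monomials to a monoid algebra, with coefficients transported by \<open>c\<close>.
  Substitutions in polynomials and homomorphisms out of free algebras are both of this form.\<close>

definition linear_ext :: "('k::zero \<Rightarrow> 'b::ring_1) \<Rightarrow> ('m \<Rightarrow> 'b) \<Rightarrow> ('m \<Rightarrow>\<^sub>0 'k) \<Rightarrow> 'b" where
  "linear_ext c \<phi> p = (\<Sum>m\<in>Poly_Mapping.keys p. c (Poly_Mapping.lookup p m) * \<phi> m)"

lemma sum_of_monomials:
  "(\<Sum>m\<in>Poly_Mapping.keys p. Poly_Mapping.single m (Poly_Mapping.lookup p m)) = p"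
  by (rule poly_mapping_eqI) (simp add: lookup_sum lookup_single when_def in_keys_iff)

lemma linear_ext_superset:
  assumes "finite S" "Poly_Mapping.keys p \<subseteq> S" "c 0 = 0"
  shows "linear_ext c \<phi> p = (\<Sum>m\<in>S. c (Poly_Mapping.lookup p m) * \<phi> m)"
  unfolding linear_ext_def
  by (rule sum.mono_neutral_left) (use assms in \<open>auto simp: in_keys_iff\<close>)

lemma linear_ext_single:
  assumes "c 0 = 0"
  shows "linear_ext c \<phi> (Poly_Mapping.single m a) = c a * \<phi> m"
  by (subst linear_ext_superset[of "{m}"]) (use assms in auto)

lemma unital_ring_hom_linear_ext:
  fixes c :: "'k::ring_1 \<Rightarrow> 'b::ring_1" and \<phi> :: "'m::monoid_add \<Rightarrow> 'b"
  assumes c: "unital_ring_hom c"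
    and zero: "\<phi> 0 = 1"
    and plus: "\<And>m m'. \<phi> (m + m') = \<phi> m * \<phi> m'"
    and comm: "\<And>a m. c a * \<phi> m = \<phi> m * c a"
  shows "unital_ring_hom (linear_ext c \<phi>)"
proof -
  interpret c: unital_ring_hom c by fact
  have c0: "c 0 = 0" by (rule c.hom_zero)
  have add: "linear_ext c \<phi> (p + q) = linear_ext c \<phi> p + linear_ext c \<phi> q" for p q
  proof -
    let ?S = "Poly_Mapping.keys p \<union> Poly_Mapping.keys q"
    have "Poly_Mapping.keys (p + q) \<subseteq> ?S" by (rule keys_add)
    then show ?thesis
      by (simp add: linear_ext_superset[of ?S] c0 lookup_add c.hom_add distrib_right sum.distrib)
  qed
  have zero': "linear_ext c \<phi> 0 = 0" by (simp add: linear_ext_def)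
  have sum: "linear_ext c \<phi> (\<Sum>i\<in>A. g i) = (\<Sum>i\<in>A. linear_ext c \<phi> (g i))" for A :: "'z set" and g
    by (induction A rule: infinite_finite_induct) (simp_all add: zero' add)
  have sum': "linear_ext c \<phi> (\<Sum>i\<in>A. g i) = (\<Sum>i\<in>A. linear_ext c \<phi> (g i))" for A :: "'m set" and g
    by (induction A rule: infinite_finite_induct) (simp_all add: zero' add)
  show ?thesis
  proof
    have "linear_ext c \<phi> (Poly_Mapping.single 0 1) = c 1 * \<phi> 0"
      by (rule linear_ext_single) (rule c0)
    then show "linear_ext c \<phi> 1 = 1" by (simp add: c.hom_one zero)
  next
    fix p q
    show "linear_ext c \<phi> (p + q) = linear_ext c \<phi> p + linear_ext c \<phi> q" by (rule add)
    let ?p = "\<Sum>m\<in>Poly_Mapping.keys p. Poly_Mapping.single m (Poly_Mapping.lookup p m)"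
    let ?q = "\<Sum>m\<in>Poly_Mapping.keys q. Poly_Mapping.single m (Poly_Mapping.lookup q m)"
    have comm': "c a * c b * (\<phi> m * \<phi> m') = (c a * \<phi> m) * (c b * \<phi> m')" for a b m m'
      using comm[of b m] by (metis mult.assoc)
    have "p * q = ?p * ?q" by (simp only: sum_of_monomials)
    also have "\<dots> = (\<Sum>m\<in>Poly_Mapping.keys p. \<Sum>m'\<in>Poly_Mapping.keys q.
        Poly_Mapping.single (m + m') (Poly_Mapping.lookup p m * Poly_Mapping.lookup q m'))"
      by (simp add: sum_product mult_single)
    finally have "linear_ext c \<phi> (p * q) = (\<Sum>m\<in>Poly_Mapping.keys p. \<Sum>m'\<in>Poly_Mapping.keys q.
        (c (Poly_Mapping.lookup p m) * \<phi> m) * (c (Poly_Mapping.lookup q m') * \<phi> m'))"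
      by (simp add: sum' linear_ext_single c0 c.hom_mult plus comm')
    also have "\<dots> = linear_ext c \<phi> p * linear_ext c \<phi> q"
      by (simp add: linear_ext_def sum_product)
    finally show "linear_ext c \<phi> (p * q) = linear_ext c \<phi> p * linear_ext c \<phi> q" .
  qed
qed


section \<open>Substitutions in polynomials\<close>

lemma unital_ring_hom_polyconst: "unital_ring_hom (polyconst :: 'k \<Rightarrow> 'k::comm_ring_1 mpoly)"
  by standard (simp_all add: polyconst_def single_add mult_single)

lemma unital_ring_hom_poly_subst: "unital_ring_hom (poly_subst f :: 'k mpoly \<Rightarrow> 'k::comm_ring_1 mpoly)"
proof -
  let ?\<phi> = "\<lambda>m. \<Prod>i\<in>Poly_Mapping.keys m. f i ^ Poly_Mapping.lookup m i"
  have superset: "?\<phi> m = (\<Prod>i\<in>S. f i ^ Poly_Mapping.lookup m i)"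
    if "finite S" "Poly_Mapping.keys m \<subseteq> S" for S m
    by (rule prod.mono_neutral_left) (use that in \<open>auto simp: in_keys_iff\<close>)
  have "?\<phi> (m + m') = ?\<phi> m * ?\<phi> m'" for m m'
  proof -
    let ?S = "Poly_Mapping.keys m \<union> Poly_Mapping.keys m'"
    have "Poly_Mapping.keys (m + m') \<subseteq> ?S" by (rule keys_add)
    then have "?\<phi> (m + m') = (\<Prod>i\<in>?S. f i ^ Poly_Mapping.lookup (m + m') i)"
      by (intro superset) simp_all
    also have "\<dots> = (\<Prod>i\<in>?S. f i ^ Poly_Mapping.lookup m i) * (\<Prod>i\<in>?S. f i ^ Poly_Mapping.lookup m' i)"
      by (simp add: lookup_add power_add prod.distrib)
    also have "\<dots> = ?\<phi> m * ?\<phi> m'"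
      using superset[of ?S m] superset[of ?S m'] by simp
    finally show ?thesis .
  qed
  then have "unital_ring_hom (linear_ext polyconst ?\<phi>)"
    by (intro unital_ring_hom_linear_ext unital_ring_hom_polyconst) (simp_all add: mult.commute)
  moreover have "poly_subst f = linear_ext polyconst ?\<phi>"
    by (simp add: fun_eq_iff poly_subst_def linear_ext_def)
  ultimately show ?thesis by simp
qed

lemma poly_subst_polyconst: "poly_subst f (polyconst a) = polyconst a"
  by (cases "a = 0") (simp_all add: poly_subst_def polyconst_def)

lemma poly_subst_polyvar: "poly_subst f (polyvar i) = (f i :: 'k::comm_ring_1 mpoly)"
proof (cases "(1::'k) = 0")
  case True
  then have "p = 0" for p :: "'k mpoly"
    by (metis (mono_tags, opaque_lifting) lookup_zero mult_1 mult_zero_left poly_mapping_eqI)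
  then show ?thesis by metis
qed (simp add: poly_subst_def polyvar_def polyconst_def)

text \<open>Every polynomial in the variables with indices in \<open>V\<close> is built from constants and these
  variables; the induction is used to compare ring homomorphisms and to propagate the
  commutation relations from the variables to all polynomials.\<close>

lemma mpoly_induct:
  fixes p :: "'k::comm_ring_1 mpoly"
  assumes vars: "\<And>m. m \<in> Poly_Mapping.keys p \<Longrightarrow> Poly_Mapping.keys m \<subseteq> V"
    and const: "\<And>c. P (polyconst c)"
    and var: "\<And>i. i \<in> V \<Longrightarrow> P (polyvar i)"
    and add: "\<And>p q. P p \<Longrightarrow> P q \<Longrightarrow> P (p + q)"
    and mult: "\<And>p q. P p \<Longrightarrow> P q \<Longrightarrow> P (p * q)"
  shows "P p"
proof -
  have P0: "P 0" and P1: "P 1"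
    using const[of 0] const[of 1] by (simp_all add: polyconst_def)
  have sum: "P (\<Sum>i\<in>A. g i)" if "\<And>i. i \<in> A \<Longrightarrow> P (g i)" for A :: "(nat \<Rightarrow>\<^sub>0 nat) set" and g
    using that by (induction A rule: infinite_finite_induct) (simp_all add: P0 add)
  have pow: "P (Poly_Mapping.single (Poly_Mapping.single i k) 1)" if "i \<in> V" for i k
  proof (induction k)
    case (Suc k)
    have "Poly_Mapping.single (Poly_Mapping.single i (Suc k)) 1
        = polyvar i * Poly_Mapping.single (Poly_Mapping.single i k) (1::'k)"
      by (simp add: polyvar_def mult_single flip: single_add)
    then show ?case using mult[OF var[OF that] Suc] by simp
  qed (simp add: P1)
  have mon: "P (Poly_Mapping.single (\<Sum>i\<in>A. Poly_Mapping.single i (g i)) 1)"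
    if "A \<subseteq> V" for A and g :: "nat \<Rightarrow> nat"
    using that
  proof (induction A rule: infinite_finite_induct)
    case (insert i A)
    have "Poly_Mapping.single (\<Sum>i\<in>insert i A. Poly_Mapping.single i (g i)) 1
        = Poly_Mapping.single (Poly_Mapping.single i (g i)) 1
          * Poly_Mapping.single (\<Sum>i\<in>A. Poly_Mapping.single i (g i)) (1::'k)"
      using insert by (simp add: mult_single)
    then show ?case using mult[OF pow[of i "g i"]] insert by simp
  qed (simp_all add: P1)
  have "P (Poly_Mapping.single m a)" if "m \<in> Poly_Mapping.keys p" for m a
  proof -
    have "Poly_Mapping.single m a = polyconst a
        * Poly_Mapping.single (\<Sum>i\<in>Poly_Mapping.keys m. Poly_Mapping.single i (Poly_Mapping.lookup m i)) 1"
      by (simp add: polyconst_def mult_single sum_of_monomials)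
    then show ?thesis using mult[OF const mon[OF vars[OF that]]] by simp
  qed
  then have "P (\<Sum>m\<in>Poly_Mapping.keys p. Poly_Mapping.single m (Poly_Mapping.lookup p m))"
    by (intro sum)
  then show ?thesis by (simp add: sum_of_monomials)
qed

lemma mpoly_hom_eqI:
  fixes f g :: "'k::comm_ring_1 mpoly \<Rightarrow> 'k mpoly"
  assumes "unital_ring_hom f" "unital_ring_hom g"
    and "\<And>c. f (polyconst c) = g (polyconst c)" "\<And>i. f (polyvar i) = g (polyvar i)"
  shows "f p = g p"
proof -
  interpret f: unital_ring_hom f by fact
  interpret g: unital_ring_hom g by fact
  show ?thesis
    by (rule mpoly_induct[where V = UNIV]) (simp_all add: assms f.hom_simps g.hom_simps)
qed

lemma U_h_induct [consumes 1, case_names const var add mult]: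
  assumes "p \<in> U_h n"
    and "\<And>c. P (polyconst c)"
    and "\<And>i. i \<in> {1..n} \<Longrightarrow> P (polyvar i)"
    and "\<And>p q. P p \<Longrightarrow> P q \<Longrightarrow> P (p + q)"
    and "\<And>p q. P p \<Longrightarrow> P q \<Longrightarrow> P (p * q)"
  shows "P p"
  by (rule mpoly_induct[where V = "{1..n}"]) (use assms in \<open>auto simp: U_h_def\<close>)

lemma U_h_polyconst [simp]: "polyconst c \<in> U_h n"
  by (cases "c = 0") (auto simp: U_h_def polyconst_def)

lemma U_h_polyvar [simp]: "1 \<le> i \<Longrightarrow> i \<le> n \<Longrightarrow> (polyvar i :: 'k::comm_ring_1 mpoly) \<in> U_h n"
  by (cases "(1::'k) = 0") (auto simp: U_h_def polyvar_def split: if_splits)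

lemma U_h_zero [simp]: "0 \<in> U_h n" and U_h_one [simp]: "1 \<in> U_h n"
  using U_h_polyconst[of 0 n] U_h_polyconst[of 1 n] by (simp_all add: polyconst_def)

lemma U_h_add [simp]: "p \<in> U_h n \<Longrightarrow> q \<in> U_h n \<Longrightarrow> p + q \<in> U_h n"
  using keys_add[of p q] by (auto simp: U_h_def)

lemma U_h_mult [simp]:
  assumes "p \<in> U_h n" "q \<in> U_h n"
  shows "p * q \<in> U_h n"
  unfolding U_h_def
proof (intro CollectI ballI)
  fix m assume "m \<in> Poly_Mapping.keys (p * q)"
  then obtain a b where ab: "a \<in> Poly_Mapping.keys p" "b \<in> Poly_Mapping.keys q" "m = a + b"
    using keys_mult[of p q] by auto
  then show "Poly_Mapping.keys m \<subseteq> {1..n}"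
    using keys_add[of a b] assms by (auto simp: U_h_def)
qed

lemma U_h_uminus [simp]: "p \<in> U_h n \<Longrightarrow> - p \<in> U_h n"
  by (auto simp: U_h_def in_keys_iff)

lemma U_h_diff [simp]: "p \<in> U_h n \<Longrightarrow> q \<in> U_h n \<Longrightarrow> p - q \<in> U_h n"
  using U_h_add[of p n "- q"] by simp

lemma U_h_power [simp]: "p \<in> U_h n \<Longrightarrow> p ^ k \<in> U_h n"
  by (induction k) simp_all

lemma of_int_eq_polyconst: "of_int k = polyconst (of_int k)"
  by (metis unital_ring_hom.hom_of_int unital_ring_hom_polyconst)

lemma U_h_of_int [simp]: "of_int k \<in> U_h n"
  by (simp add: of_int_eq_polyconst)

lemma U_h_poly_subst:
  assumes "p \<in> U_h n" and "\<And>i. i \<in> {1..n} \<Longrightarrow> f i \<in> U_h n"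
  shows "poly_subst f p \<in> U_h n"
proof -
  interpret unital_ring_hom "poly_subst f" by (rule unital_ring_hom_poly_subst)
  from assms(1) show ?thesis
    by (induction p rule: U_h_induct)
      (simp_all add: assms(2) poly_subst_polyconst poly_subst_polyvar hom_simps)
qed

lemma denoms_one [simp]: "1 \<in> denoms n"
  by (simp add: denoms_def mult_closure.one)

lemma denoms_mult [simp]:
  assumes "s \<in> denoms n" "t \<in> denoms n"
  shows "s * t \<in> denoms n"
  using assms unfolding denoms_def
  by (induction s) (auto simp: mult.assoc intro: mult_closure.mult)

lemma denoms_power [simp]: "s \<in> denoms n \<Longrightarrow> s ^ k \<in> denoms n"
  by (induction k) simp_all

lemma denoms_prod [simp]: "(\<And>i. i \<in> A \<Longrightarrow> f i \<in> denoms n) \<Longrightarrow> (\<Prod>i\<in>A. f i) \<in> denoms n"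
  by (induction A rule: infinite_finite_induct) simp_all

lemma denoms_hdiff:
  assumes "i \<in> {1..n}" "j \<in> {1..n}" "i \<noteq> j"
  shows "hdiff i j + of_int k \<in> denoms n"
proof -
  have "(hdiff i j + of_int k) * 1 \<in> denoms n"
    unfolding denoms_def
    by (rule mult_closure.mult[OF _ mult_closure.one]) (use assms in blast)
  then show ?thesis by simp
qed

lemma denoms_hdiff_simps [simp]:
  assumes "1 \<le> i" "i \<le> n" "1 \<le> j" "j \<le> n" "i \<noteq> j"
  shows "hdiff i j \<in> denoms n" "hdiff i j + 1 \<in> denoms n" "hdiff i j - 1 \<in> denoms n"
  using denoms_hdiff[of i n j 0] denoms_hdiff[of i n j 1] denoms_hdiff[of i n j "-1"] assms
  by simp_all

lemma denoms_subset_U_h: "s \<in> denoms n \<Longrightarrow> s \<in> U_h n"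
  unfolding denoms_def by (induction s rule: mult_closure.induct) (auto simp: U_h_def[symmetric])

text \<open>A substitution that sends each generating denominator to another one preserves denominators.\<close>

lemma denoms_poly_subst:
  assumes "s \<in> denoms n"
    and "\<And>i j k. i \<in> {1..n} \<Longrightarrow> j \<in> {1..n} \<Longrightarrow> i \<noteq> j \<Longrightarrow> f i - f j + of_int k \<in> denoms n"
  shows "poly_subst f s \<in> denoms n"
proof -
  interpret unital_ring_hom "poly_subst f" by (rule unital_ring_hom_poly_subst)
  from assms(1)[unfolded denoms_def] show ?thesis
  proof (induction s rule: mult_closure.induct)
    case one
    then show ?case by (simp add: hom_one)
  next
    case (mult g s)
    then obtain i j k where g: "g = hdiff i j + of_int k" "i \<in> {1..n}" "j \<in> {1..n}" "i \<noteq> j" by blast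
    have "poly_subst f g = f i - f j + of_int k"
      by (simp add: g hom_simps poly_subst_polyvar)
    then have "poly_subst f g \<in> denoms n" using assms(2) g by simp
    then show ?case using mult by (simp add: hom_mult)
  qed
qed

subsection \<open>Permutations and shifts of the variables\<close>

definition poly_perm :: "(nat \<Rightarrow> nat) \<Rightarrow> 'k::comm_ring_1 mpoly \<Rightarrow> 'k mpoly" where
  "poly_perm \<sigma> = poly_subst (\<lambda>i. polyvar (\<sigma> i))"

text \<open>Shifts by arbitrary integers: moving coefficients to the left of \<open>x\<^sup>j\<^sup>,\<^sup>\<alpha>\<close> or to the right of
  \<open>\<partial>\<^sub>j\<^sub>,\<^sub>\<alpha>\<close> needs the inverse of \<open>poly_shift\<close>.\<close>

definition poly_shift_by :: "nat \<Rightarrow> int \<Rightarrow> 'k::comm_ring_1 mpoly \<Rightarrow> 'k mpoly" where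
  "poly_shift_by k z = poly_subst (\<lambda>l. if l = k then polyvar l + of_int z else polyvar l)"

lemma poly_shift_eq: "poly_shift k = poly_shift_by k 1"
  by (simp add: poly_shift_def poly_shift_by_def cong: if_cong)

interpretation perm: unital_ring_hom "poly_perm \<sigma> :: 'k::comm_ring_1 mpoly \<Rightarrow> 'k mpoly"
  by (simp add: poly_perm_def unital_ring_hom_poly_subst)

interpretation shift: unital_ring_hom "poly_shift_by k z :: 'k::comm_ring_1 mpoly \<Rightarrow> 'k mpoly"
  by (simp add: poly_shift_by_def unital_ring_hom_poly_subst)

lemmas perm_hom = perm.unital_ring_hom_axioms
lemmas shift_hom = shift.unital_ring_hom_axioms

lemma poly_perm_polyvar [simp]: "poly_perm \<sigma> (polyvar i) = polyvar (\<sigma> i)"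
  by (simp add: poly_perm_def poly_subst_polyvar)

lemma poly_perm_polyconst [simp]: "poly_perm \<sigma> (polyconst c) = polyconst c"
  by (simp add: poly_perm_def poly_subst_polyconst)

lemma poly_shift_by_polyvar [simp]:
  "poly_shift_by k z (polyvar i) = (if i = k then polyvar i + of_int z else polyvar i)"
  by (simp add: poly_shift_by_def poly_subst_polyvar)

lemma poly_shift_by_polyconst [simp]: "poly_shift_by k z (polyconst c) = polyconst c"
  by (simp add: poly_shift_by_def poly_subst_polyconst)

lemma poly_perm_comp: "poly_perm \<sigma> (poly_perm \<tau> p) = poly_perm (\<sigma> \<circ> \<tau>) p"
  by (rule mpoly_hom_eqI[OF unital_ring_hom_comp[OF perm_hom perm_hom] perm_hom]) simp_all

lemma poly_perm_id: "poly_perm id p = p"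
  by (rule mpoly_hom_eqI[OF perm_hom unital_ring_hom_id]) simp_all

lemma poly_perm_shift:
  assumes "inj \<sigma>"
  shows "poly_perm \<sigma> (poly_shift_by k z p) = poly_shift_by (\<sigma> k) z (poly_perm \<sigma> p)"
  by (rule mpoly_hom_eqI[OF unital_ring_hom_comp[OF perm_hom shift_hom] unital_ring_hom_comp[OF shift_hom perm_hom]])
    (simp_all add: inj_eq[OF assms] perm.hom_simps)

lemma poly_shift_by_inverse:
  "z + w = 0 \<Longrightarrow> poly_shift_by k z (poly_shift_by k w p) = p"
  by (rule mpoly_hom_eqI[OF unital_ring_hom_comp[OF shift_hom shift_hom] unital_ring_hom_id])
    (auto simp: shift.hom_simps simp flip: of_int_add)

lemma poly_shift_by_commute:
  "poly_shift_by k z (poly_shift_by l w p) = poly_shift_by l w (poly_shift_by k z p)"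
  by (rule mpoly_hom_eqI[OF unital_ring_hom_comp[OF shift_hom shift_hom] unital_ring_hom_comp[OF shift_hom shift_hom]])
    (auto simp: shift.hom_simps)

lemma U_h_shift [simp]: "p \<in> U_h n \<Longrightarrow> poly_shift_by k z p \<in> U_h n"
  unfolding poly_shift_by_def by (rule U_h_poly_subst) auto

lemma denoms_shift [simp]:
  assumes "s \<in> denoms n"
  shows "poly_shift_by k z s \<in> denoms n"
  unfolding poly_shift_by_def
proof (rule denoms_poly_subst[OF assms])
  fix i j k' assume ij: "i \<in> {1..n}" "j \<in> {1..n}" "i \<noteq> j"
  have "(if i = k then polyvar i + of_int z else polyvar i)
      - (if j = k then polyvar j + of_int z else polyvar j) + of_int k'
      = (hdiff i j :: 'a mpoly)
        + of_int (k' + (if i = k then z else 0) - (if j = k then z else 0))"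
    by simp
  then show "(if i = k then polyvar i + of_int z else polyvar i)
      - (if j = k then polyvar j + of_int z else polyvar j) + of_int k' \<in> (denoms n :: 'a mpoly set)"
    using denoms_hdiff[OF ij] by metis
qed

lemma permutes_inject: "\<sigma> permutes {1..n} \<Longrightarrow> \<sigma> i = \<sigma> j \<longleftrightarrow> i = j"
  by (metis permutes_inverses(2))

lemma permutes_bounds:
  assumes "\<sigma> permutes {1..n}" "1 \<le> i" "i \<le> n"
  shows "1 \<le> \<sigma> i" "\<sigma> i \<le> n"
  using permutes_in_image[OF assms(1), of i] assms(2,3) by auto

lemma U_h_perm [simp]:
  assumes "\<sigma> permutes {1..n}" "p \<in> U_h n"
  shows "poly_perm \<sigma> p \<in> U_h n"
  unfolding poly_perm_def using permutes_bounds[OF assms(1)]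
  by (intro U_h_poly_subst assms(2)) simp_all

lemma denoms_perm [simp]:
  assumes "\<sigma> permutes {1..n}" "s \<in> denoms n"
  shows "poly_perm \<sigma> s \<in> denoms n"
  unfolding poly_perm_def
  by (rule denoms_poly_subst[OF assms(2)], rule denoms_hdiff)
    (use permutes_in_image[OF assms(1)] permutes_inject[OF assms(1)] in auto)


section \<open>Fractions\<close>

locale fractions =
  fixes A S :: "'a::comm_ring_1 set"
  assumes A_add: "p \<in> A \<Longrightarrow> q \<in> A \<Longrightarrow> p + q \<in> A"
    and A_mult: "p \<in> A \<Longrightarrow> q \<in> A \<Longrightarrow> p * q \<in> A"
    and S_sub: "s \<in> S \<Longrightarrow> s \<in> A"
    and S_one: "1 \<in> S"
    and S_mult: "s \<in> S \<Longrightarrow> t \<in> S \<Longrightarrow> s * t \<in> S"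
begin

lemma equiv_loc_rel: "equiv (A \<times> S) (loc_rel A S)"
proof (rule equivI)
  show "loc_rel A S \<subseteq> (A \<times> S) \<times> A \<times> S" by (auto simp: loc_rel_def)
  show "refl_on (A \<times> S) (loc_rel A S)"
    by (auto simp: refl_on_def loc_rel_def intro: S_one)
  show "sym (loc_rel A S)"
  proof (rule symI)
    fix a b assume "(a, b) \<in> loc_rel A S"
    then obtain p s q t u where *: "a = (p, s)" "b = (q, t)" "p \<in> A" "q \<in> A" "s \<in> S" "t \<in> S"
      "u \<in> S" "u * (p * t - q * s) = 0" by (auto simp: loc_rel_def)
    then have "u * (q * s - p * t) = 0" by (simp add: algebra_simps)
    with * show "(b, a) \<in> loc_rel A S" by (auto simp: loc_rel_def)
  qed
  show "trans (loc_rel A S)"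
  proof (rule transI)
    fix a b c assume "(a, b) \<in> loc_rel A S" "(b, c) \<in> loc_rel A S"
    then obtain p s q t r w u v where *: "a = (p, s)" "b = (q, t)" "c = (r, w)"
      "p \<in> A" "q \<in> A" "r \<in> A" "s \<in> S" "t \<in> S" "w \<in> S" "u \<in> S" "v \<in> S"
      and u: "u * (p * t - q * s) = 0" and v: "v * (q * w - r * t) = 0"
      by (auto simp: loc_rel_def)
    have "(u * v * t) * (p * w - r * s) = v * w * (u * (p * t - q * s)) + u * s * (v * (q * w - r * t))"
      by (simp add: algebra_simps)
    also have "\<dots> = 0" by (simp add: u v)
    finally show "(a, c) \<in> loc_rel A S"
      using * by (auto simp: loc_rel_def intro!: bexI[of _ "u * v * t"] S_mult)
  qed
qed

lemma loc_frac_eqI: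
  assumes "p \<in> A" "q \<in> A" "s \<in> S" "t \<in> S" "u \<in> S" "u * (p * t) = u * (q * s)"
  shows "loc_frac A S p s = loc_frac A S q t"
  unfolding loc_frac_def
  by (rule equiv_class_eq[OF equiv_loc_rel]) (use assms in \<open>auto simp: loc_rel_def right_diff_distrib\<close>)

lemma carrier_localization:
  "carrier (localization A S) = {loc_frac A S p s | p s. p \<in> A \<and> s \<in> S}"
  by (auto simp: localization_def loc_frac_def quotient_def)

text \<open>A ring homomorphism that preserves numerators and denominators acts on fractions. This covers the
  shifts as well as the permutations of the variables.\<close>

lemma loc_map_frac:
  assumes hom: "unital_ring_hom \<theta>" and A: "\<And>p. p \<in> A \<Longrightarrow> \<theta> p \<in> A" and S: "\<And>s. s \<in> S \<Longrightarrow> \<theta> s \<in> S"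
    and "p \<in> A" "s \<in> S"
  shows "(\<Union>(p, s)\<in>loc_frac A S p s. loc_frac A S (\<theta> p) (\<theta> s)) = loc_frac A S (\<theta> p) (\<theta> s)"
proof -
  interpret unital_ring_hom \<theta> by fact
  have "(\<lambda>(p, s). loc_frac A S (\<theta> p) (\<theta> s)) respects loc_rel A S"
  proof (rule congruentI)
    fix a b assume "(a, b) \<in> loc_rel A S"
    then obtain p s q t u where *: "a = (p, s)" "b = (q, t)" "p \<in> A" "q \<in> A" "s \<in> S" "t \<in> S" "u \<in> S"
      and u: "u * (p * t - q * s) = 0" by (auto simp: loc_rel_def)
    have "\<theta> u * (\<theta> p * \<theta> t - \<theta> q * \<theta> s) = 0"
      using arg_cong[OF u, of \<theta>] by (simp add: hom_simps)
    then have "\<theta> u * (\<theta> p * \<theta> t) = \<theta> u * (\<theta> q * \<theta> s)"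
      by (simp add: right_diff_distrib)
    then have "loc_frac A S (\<theta> p) (\<theta> s) = loc_frac A S (\<theta> q) (\<theta> t)"
      using * by (intro loc_frac_eqI[where u = "\<theta> u"]) (simp_all add: A S)
    then show "(case a of (p, s) \<Rightarrow> loc_frac A S (\<theta> p) (\<theta> s)) = (case b of (p, s) \<Rightarrow> loc_frac A S (\<theta> p) (\<theta> s))"
      using * by simp
  qed
  from UN_equiv_class[OF equiv_loc_rel this, of "(p, s)"] show ?thesis
    using assms(4,5) by (simp add: loc_frac_def)
qed

text \<open>The sum and the product of fractions are unions over all pairs of representatives; such a union
  collapses to the value at one pair as soon as that value does not depend on the pair.\<close>

lemma loc_frac_binary:
  assumes cong: "\<And>p s p' s' q t q' t' u v. \<lbrakk>p \<in> A; p' \<in> A; q \<in> A; q' \<in> A; s \<in> S; s' \<in> S; t \<in> S; t' \<in> S; u \<in> S; v \<in> S;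
      u * (p * s') = u * (p' * s); v * (q * t') = v * (q' * t)\<rbrakk> \<Longrightarrow> F (p, s) (q, t) = F (p', s') (q', t')"
    and "p \<in> A" "s \<in> S" "q \<in> A" "t \<in> S"
  shows "(\<Union>a\<in>loc_frac A S p s. \<Union>b\<in>loc_frac A S q t. F a b) = F (p, s) (q, t)"
proof -
  have "congruent2 (loc_rel A S) (loc_rel A S) F"
  proof (rule congruent2I')
    fix a b c d assume "(a, b) \<in> loc_rel A S" "(c, d) \<in> loc_rel A S"
    then obtain p s p' s' u q t q' t' v where
      "a = (p, s)" "b = (p', s')" "c = (q, t)" "d = (q', t')"
      "p \<in> A" "p' \<in> A" "q \<in> A" "q' \<in> A" "s \<in> S" "s' \<in> S" "t \<in> S" "t' \<in> S" "u \<in> S" "v \<in> S"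
      "u * (p * s') = u * (p' * s)" "v * (q * t') = v * (q' * t)"
      by (auto simp: loc_rel_def right_diff_distrib)
    then show "F a c = F b d" using cong[of p p' q q' s s' t t' u v] by simp
  qed
  from UN_equiv_class2[OF equiv_loc_rel equiv_loc_rel this, of "(p, s)" "(q, t)"] show ?thesis
    using assms(2-) by (simp add: loc_frac_def)
qed

lemma loc_frac_mult:
  assumes "p \<in> A" "s \<in> S" "q \<in> A" "t \<in> S"
  shows "loc_frac A S p s \<otimes>\<^bsub>localization A S\<^esub> loc_frac A S q t = loc_frac A S (p * q) (s * t)"
proof -
  let ?F = "\<lambda>a b. case a of (p, s) \<Rightarrow> case b of (q, t) \<Rightarrow> loc_frac A S (p * q) (s * t)"
  have "(\<Union>a\<in>loc_frac A S p s. \<Union>b\<in>loc_frac A S q t. ?F a b) = ?F (p, s) (q, t)"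
  proof (rule loc_frac_binary[OF _ assms], unfold prod.case)
    fix p s p' s' q t q' t' u v
    assume *: "p \<in> A" "p' \<in> A" "q \<in> A" "q' \<in> A" "s \<in> S" "s' \<in> S" "t \<in> S" "t' \<in> S" "u \<in> S" "v \<in> S"
      and eqs: "u * (p * s') = u * (p' * s)" "v * (q * t') = v * (q' * t)"
    have "(u * v) * (p * q * (s' * t')) = (u * (p * s')) * (v * (q * t'))" by (simp add: mult_ac)
    also have "\<dots> = (u * v) * (p' * q' * (s * t))" unfolding eqs by (simp add: mult_ac)
    finally show "loc_frac A S (p * q) (s * t) = loc_frac A S (p' * q') (s' * t')"
      using * by (intro loc_frac_eqI[where u = "u * v"]) (simp_all add: A_mult S_mult)
  qed
  then show ?thesis by (simp add: localization_def case_prod_beta)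
qed

lemma loc_frac_add:
  assumes "p \<in> A" "s \<in> S" "q \<in> A" "t \<in> S"
  shows "loc_frac A S p s \<oplus>\<^bsub>localization A S\<^esub> loc_frac A S q t = loc_frac A S (p * t + q * s) (s * t)"
proof -
  let ?F = "\<lambda>a b. case a of (p, s) \<Rightarrow> case b of (q, t) \<Rightarrow> loc_frac A S (p * t + q * s) (s * t)"
  have "(\<Union>a\<in>loc_frac A S p s. \<Union>b\<in>loc_frac A S q t. ?F a b) = ?F (p, s) (q, t)"
  proof (rule loc_frac_binary[OF _ assms], unfold prod.case)
    fix p s p' s' q t q' t' u v
    assume *: "p \<in> A" "p' \<in> A" "q \<in> A" "q' \<in> A" "s \<in> S" "s' \<in> S" "t \<in> S" "t' \<in> S" "u \<in> S" "v \<in> S"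
      and eqs: "u * (p * s') = u * (p' * s)" "v * (q * t') = v * (q' * t)"
    have "(u * v) * ((p * t + q * s) * (s' * t'))
        = (u * (p * s')) * (v * t * t') + (v * (q * t')) * (u * s * s')" by (simp add: algebra_simps)
    also have "\<dots> = (u * v) * ((p' * t' + q' * s') * (s * t))"
      unfolding eqs by (simp add: algebra_simps)
    finally show "loc_frac A S (p * t + q * s) (s * t) = loc_frac A S (p' * t' + q' * s') (s' * t')"
      using * by (intro loc_frac_eqI[where u = "u * v"]) (simp_all add: A_mult A_add S_mult S_sub)
  qed
  then show ?thesis by (simp add: localization_def case_prod_beta)
qed

end

interpretation U: fractions "U_h n :: 'k::comm_ring_1 mpoly set" "denoms n"
  by standard (simp_all add: denoms_subset_U_h)

lemma U_frac_eqI':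
  assumes "p \<in> U_h n" "q \<in> U_h n" "s \<in> denoms n" "t \<in> denoms n" "p * t = q * s"
  shows "U_frac n p s = U_frac n q t"
  using assms by (intro U.loc_frac_eqI[where u = 1]) simp_all

lemma carrier_U_loc: "carrier (U_loc n) = {U_frac n p s | p s. p \<in> U_h n \<and> s \<in> denoms n}"
  by (simp add: U_loc_def U.carrier_localization)

lemma U_frac_in_carrier [simp]: "p \<in> U_h n \<Longrightarrow> s \<in> denoms n \<Longrightarrow> U_frac n p s \<in> carrier (U_loc n)"
  by (auto simp: carrier_U_loc)

lemma U_frac_mult:
  "p \<in> U_h n \<Longrightarrow> s \<in> denoms n \<Longrightarrow> q \<in> U_h n \<Longrightarrow> t \<in> denoms n \<Longrightarrow>
    U_frac n p s \<otimes>\<^bsub>U_loc n\<^esub> U_frac n q t = U_frac n (p * q) (s * t)"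
  by (simp add: U_loc_def U.loc_frac_mult)

lemma U_frac_add:
  "p \<in> U_h n \<Longrightarrow> s \<in> denoms n \<Longrightarrow> q \<in> U_h n \<Longrightarrow> t \<in> denoms n \<Longrightarrow>
    U_frac n p s \<oplus>\<^bsub>U_loc n\<^esub> U_frac n q t = U_frac n (p * t + q * s) (s * t)"
  by (simp add: U_loc_def U.loc_frac_add)

definition U_map :: "nat \<Rightarrow> ('k mpoly \<Rightarrow> 'k mpoly) \<Rightarrow> 'k::comm_ring_1 loc_elem \<Rightarrow> 'k loc_elem" where
  "U_map n \<theta> a = (\<Union>(p, s)\<in>a. U_frac n (\<theta> p) (\<theta> s))"

lemma U_shift_eq: "U_shift n k = U_map n (poly_shift_by k 1)"
  by (simp add: fun_eq_iff U_shift_def U_map_def poly_shift_eq)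

lemma U_map_shift_frac:
  "p \<in> U_h n \<Longrightarrow> s \<in> denoms n \<Longrightarrow>
    U_map n (poly_shift_by k z) (U_frac n p s) = U_frac n (poly_shift_by k z p) (poly_shift_by k z s)"
  unfolding U_map_def by (rule U.loc_map_frac[OF shift_hom]) simp_all

lemma U_map_perm_frac:
  "\<sigma> permutes {1..n} \<Longrightarrow> p \<in> U_h n \<Longrightarrow> s \<in> denoms n \<Longrightarrow>
    U_map n (poly_perm \<sigma>) (U_frac n p s) = U_frac n (poly_perm \<sigma> p) (poly_perm \<sigma> s)"
  unfolding U_map_def by (rule U.loc_map_frac[OF perm_hom]) simp_all


section \<open>The gauge factors\<close>

text \<open>This is \<open>\<psi>\<^sub>j\<close>. Taking the factors with \<open>l < j\<close> only is what makes it react to a shift of another variable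
  on one side of \<open>j\<close> and not on the other, like the R-matrix.\<close>

definition gauge :: "nat \<Rightarrow> 'k::comm_ring_1 mpoly" where
  "gauge j = (\<Prod>l\<in>{1..<j}. hdiff j l)"

lemma gauge_in_denoms [simp]: "1 \<le> j \<Longrightarrow> j \<le> n \<Longrightarrow> gauge j \<in> denoms n"
  unfolding gauge_def by (rule denoms_prod) simp

lemma gauge_in_U_h [simp]: "1 \<le> j \<Longrightarrow> j \<le> n \<Longrightarrow> gauge j \<in> U_h n"
  by (simp add: denoms_subset_U_h)

lemma shift_gauge_less:
  assumes "1 \<le> b" "b < a"
  shows "poly_shift_by b 1 (gauge a) * hdiff a b = gauge a * (hdiff a b - 1)"
proof -
  have b: "b \<in> {1..<a}" using assms by simp
  have "poly_shift_by b 1 (gauge a :: 'a mpoly) = (\<Prod>l\<in>{1..<a}. poly_shift_by b 1 (hdiff a l))"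
    unfolding gauge_def by (rule hom_prod[OF shift_hom])
  also have "\<dots> = (hdiff a b - 1) * (\<Prod>l\<in>{1..<a}-{b}. hdiff a l)"
    using assms by (subst prod.remove[OF _ b]) (auto simp: shift.hom_simps diff_diff_eq2 algebra_simps intro!: arg_cong2[where f = "(*)"] prod.cong)
  finally show ?thesis
    unfolding gauge_def by (subst (2) prod.remove[OF _ b]) (simp_all add: mult_ac)
qed

lemma shift_gauge_greater:
  assumes "a < b"
  shows "poly_shift_by b z (gauge a) = gauge a"
proof -
  have "poly_shift_by b z (gauge a) = (\<Prod>l\<in>{1..<a}. poly_shift_by b z (hdiff a l))"
    unfolding gauge_def by (rule hom_prod[OF shift_hom])
  also have "\<dots> = gauge a"
    using assms unfolding gauge_def by (intro prod.cong) (simp_all add: shift.hom_simps)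
  finally show ?thesis .
qed

text \<open>The weight that compares \<open>y\<^sup>i y\<^sup>j\<close> with \<open>x\<^sup>i x\<^sup>j\<close>: moving \<open>\<psi>\<^sub>i\<close> to the right past \<open>x\<^sup>j\<close> shifts it.\<close>

definition gauge2 :: "nat \<Rightarrow> nat \<Rightarrow> 'k::comm_ring_1 mpoly" where
  "gauge2 i j = poly_shift_by j 1 (gauge i) * gauge j"

text \<open>Numerator and denominator of the entry of the R-matrix with upper indices \<open>i, j\<close> and lower indices
  \<open>j, i\<close>, for \<open>i \<noteq> j\<close>.\<close>

definition swap_num :: "nat \<Rightarrow> nat \<Rightarrow> 'k::comm_ring_1 mpoly" where
  "swap_num i j = (if i < j then (hdiff i j)\<^sup>2 - 1 else 1)"

definition swap_den :: "nat \<Rightarrow> nat \<Rightarrow> 'k::comm_ring_1 mpoly" where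
  "swap_den i j = (if i < j then (hdiff i j)\<^sup>2 else 1)"

lemma swap_in_U_h [simp]:
  assumes "1 \<le> i" "i \<le> n" "1 \<le> j" "j \<le> n"
  shows "swap_num i j \<in> U_h n" "swap_den i j \<in> denoms n"
  using assms by (simp_all add: swap_num_def swap_den_def)

lemma gauge2_in_denoms [simp]:
  assumes "1 \<le> i" "i \<le> n" "1 \<le> j" "j \<le> n"
  shows "gauge2 i j \<in> denoms n"
  using assms by (simp add: gauge2_def)

lemma gauge2_in_U_h [simp]:
  assumes "1 \<le> i" "i \<le> n" "1 \<le> j" "j \<le> n"
  shows "gauge2 i j \<in> U_h n"
  using assms by (simp add: denoms_subset_U_h)

text \<open>The key identity. Divided by \<open>swap_den i j * gauge2 j i * hdiff i j\<close> it says that the coefficient of the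
  swapped term, corrected by the weights of both sides, is \<open>(h\<^sub>i\<^sub>j - 1) / h\<^sub>i\<^sub>j\<close> whatever the order of \<open>i\<close> and
  \<open>j\<close>. Hence a permutation maps the corrected coefficient for \<open>i, j\<close> to the one for \<open>\<sigma> i, \<sigma> j\<close>, which fails
  for the coefficient itself.\<close>

lemma swap_gauge:
  assumes "1 \<le> i" "1 \<le> j" "i \<noteq> j"
  shows "swap_num i j * gauge2 i j * hdiff i j = swap_den i j * gauge2 j i * (hdiff i j - 1)"
proof (cases "i < j")
  case True
  define h :: "'a mpoly" where "h = hdiff i j"
  have "poly_shift_by i 1 (gauge j) * (- h) = gauge j * (- h - 1)"
    using shift_gauge_less[of i j] assms True by (simp add: h_def)
  then have *: "poly_shift_by i 1 (gauge j) * h = gauge j * (h + 1)"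
    by (simp add: algebra_simps)
  have "swap_num i j * gauge2 i j * h = (h - 1) * h * gauge i * (gauge j * (h + 1))"
    using True by (simp add: swap_num_def gauge2_def shift_gauge_greater h_def[symmetric]
        power2_eq_square algebra_simps)
  also have "\<dots> = swap_den i j * gauge2 j i * (h - 1)"
    unfolding *[symmetric] using True
    by (simp add: swap_den_def gauge2_def h_def[symmetric] power2_eq_square algebra_simps)
  finally show ?thesis by (simp add: h_def)
next
  case False
  then have ji: "j < i" using assms by simp
  have "swap_num i j * gauge2 i j * hdiff i j = gauge j * (poly_shift_by j 1 (gauge i) * (hdiff i j :: 'a mpoly))"
    using ji by (simp add: swap_num_def gauge2_def mult_ac)
  also have "\<dots> = swap_den i j * gauge2 j i * (hdiff i j - 1)"
    unfolding shift_gauge_less[OF assms(2) ji] using ji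
    by (simp add: swap_den_def gauge2_def shift_gauge_greater mult_ac)
  finally show ?thesis .
qed

text \<open>Eliminating the factors \<open>h\<^sub>i\<^sub>j\<close> and \<open>h\<^sub>i\<^sub>j - 1\<close> between the identity for \<open>\<sigma> i, \<sigma> j\<close> and the image under \<open>\<sigma>\<close> of
  that for \<open>i, j\<close>. They are not cancelled, since the polynomial ring may have zero divisors, but kept as
  a denominator \<open>u\<close>: equality of fractions asks for no more.\<close>

lemma swap_gauge_perm:
  assumes \<sigma>: "\<sigma> permutes {1..n}" and ij: "i \<in> {1..n}" "j \<in> {1..n}" "i \<noteq> j"
  defines "a \<equiv> \<sigma> i" and "b \<equiv> \<sigma> j"
  obtains u :: "'k::comm_ring_1 mpoly" where "u \<in> denoms n"
    "u * (swap_num a b * gauge2 a b * poly_perm \<sigma> (swap_den i j) * poly_perm \<sigma> (gauge2 j i))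
      = u * (poly_perm \<sigma> (swap_num i j) * poly_perm \<sigma> (gauge2 i j) * swap_den a b * gauge2 b a)"
proof
  define h :: "'k mpoly" where "h = hdiff a b"
  have ab: "a \<in> {1..n}" "b \<in> {1..n}" "a \<noteq> b"
    using ij permutes_in_image[OF \<sigma>] permutes_inject[OF \<sigma>] by (simp_all add: a_def b_def)
  show "h * (h - 1) \<in> denoms n" using ab by (simp add: h_def)
  have 1: "swap_num a b * gauge2 a b * h = swap_den a b * gauge2 b a * (h - 1)"
    using swap_gauge[of a b, where ?'a = 'k] ab by (simp add: h_def)
  have "poly_perm \<sigma> (swap_num i j * gauge2 i j * hdiff i j :: 'k mpoly)
      = poly_perm \<sigma> (swap_den i j * gauge2 j i * (hdiff i j - 1))"
    using swap_gauge[of i j, where ?'a = 'k] ij by simp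
  then have 2: "poly_perm \<sigma> (swap_num i j) * poly_perm \<sigma> (gauge2 i j) * h
      = poly_perm \<sigma> (swap_den i j) * poly_perm \<sigma> (gauge2 j i) * (h - 1)"
    by (simp add: perm.hom_simps h_def a_def b_def)
  have "h * (h - 1) * (swap_num a b * gauge2 a b * poly_perm \<sigma> (swap_den i j) * poly_perm \<sigma> (gauge2 j i))
    = (swap_num a b * gauge2 a b * h) * (poly_perm \<sigma> (swap_den i j) * poly_perm \<sigma> (gauge2 j i) * (h - 1))"
    by (simp add: mult_ac)
  also have "\<dots> = h * (h - 1) * (poly_perm \<sigma> (swap_num i j) * poly_perm \<sigma> (gauge2 i j) * swap_den a b * gauge2 b a)"
    unfolding 1 2[symmetric] by (simp add: mult_ac)
  finally show "h * (h - 1) * (swap_num a b * gauge2 a b * poly_perm \<sigma> (swap_den i j) * poly_perm \<sigma> (gauge2 j i))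
      = h * (h - 1) * (poly_perm \<sigma> (swap_num i j) * poly_perm \<sigma> (gauge2 i j) * swap_den a b * gauge2 b a)" .
qed

text \<open>The transposition turns the factors \<open>h\<^sub>i - h\<^sub>l\<close> of \<open>\<psi>\<^sub>i\<close> into those of \<open>\<psi>\<^bsub>i+1\<^esub>\<close>, except for the one with
  \<open>l = i\<close>. This is the factor that appears in the formulas for \<open>s\<^sub>i\<close>.\<close>

lemma gauge_suc:
  assumes "1 \<le> i"
  shows "gauge (i + 1) = poly_perm (Transposition.transpose i (i + 1)) (gauge i) * hdiff (i + 1) i"
proof -
  have "poly_perm (Transposition.transpose i (i + 1)) (gauge i :: 'a mpoly) = (\<Prod>l\<in>{1..<i}. hdiff (i + 1) l)"
    unfolding gauge_def by (subst hom_prod[OF perm_hom], intro prod.cong)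
      (auto simp: perm.hom_simps transpose_def)
  moreover have "{1..<i + 1} = insert i {1..<i}" using assms by auto
  ultimately show ?thesis by (simp add: gauge_def mult.commute)
qed

text \<open>The indices \<open>i\<close> and \<open>i + 1\<close> are both smaller or both larger than \<open>j\<close>.\<close>

lemma gauge_transpose_other:
  assumes "j \<noteq> i" "j \<noteq> i + 1" "1 \<le> i"
  shows "poly_perm (Transposition.transpose i (i + 1)) (gauge j) = gauge j"
proof -
  let ?t = "Transposition.transpose i (i + 1)"
  have "poly_perm ?t (gauge j) = (\<Prod>l\<in>{1..<j}. hdiff j (?t l))"
    unfolding gauge_def using assms by (subst hom_prod[OF perm_hom]) (simp add: perm.hom_simps transpose_def)
  also have "\<dots> = gauge j"
    unfolding gauge_def
    by (rule prod.reindex_bij_witness[where i = ?t and j = ?t]) (use assms in \<open>auto simp: transpose_def\<close>)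
  finally show ?thesis .
qed

section \<open>Two-sided ideals and presented algebras\<close>

text \<open>The ideal is generated in the whole type of noncommutative polynomials, where all letters are allowed.
  Congruences modulo it can be multiplied by arbitrary elements.\<close>

inductive_set ideal_span :: "'a::ring_1 set \<Rightarrow> 'a set" for R where
  zero: "0 \<in> ideal_span R"
| add: "f \<in> ideal_span R \<Longrightarrow> g \<in> ideal_span R \<Longrightarrow> f + g \<in> ideal_span R"
| gen: "r \<in> R \<Longrightarrow> p * r * q \<in> ideal_span R"

lemma ideal_span_base: "r \<in> R \<Longrightarrow> r \<in> ideal_span R"
  using ideal_span.gen[of r R 1 1] by simp

lemma ideal_span_mult: "f \<in> ideal_span R \<Longrightarrow> a * f * b \<in> ideal_span R"
proof (induction f rule: ideal_span.induct)
  case (gen r p q)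
  then show ?case using ideal_span.gen[of r R "a * p" "q * b"] by (simp add: mult.assoc)
qed (auto simp: distrib_left distrib_right intro: ideal_span.intros)

lemma ideal_span_uminus: "f \<in> ideal_span R \<Longrightarrow> - f \<in> ideal_span R"
  using ideal_span_mult[of f R "- 1" 1] by simp

lemma ideal_span_hom:
  assumes "unital_ring_hom \<theta>" "\<And>r. r \<in> R \<Longrightarrow> \<theta> r \<in> ideal_span R'" "f \<in> ideal_span R"
  shows "\<theta> f \<in> ideal_span R'"
proof -
  interpret unital_ring_hom \<theta> by fact
  from assms(3) show ?thesis
    by (induction f rule: ideal_span.induct)
      (auto simp: hom_simps intro: ideal_span.zero ideal_span.add ideal_span_mult assms(2))
qed

definition ideal_cong :: "'a::ring_1 set \<Rightarrow> 'a \<Rightarrow> 'a \<Rightarrow> bool" where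
  "ideal_cong R f g \<longleftrightarrow> f - g \<in> ideal_span R"

lemma ideal_cong_refl [simp, intro]: "ideal_cong R f f"
  by (simp add: ideal_cong_def ideal_span.zero)

lemma ideal_cong_sym: "ideal_cong R f g \<Longrightarrow> ideal_cong R g f"
  using ideal_span_uminus[of "f - g" R] by (simp add: ideal_cong_def)

lemma ideal_cong_trans [trans]: "ideal_cong R f g \<Longrightarrow> ideal_cong R g h \<Longrightarrow> ideal_cong R f h"
  using ideal_span.add[of "f - g" R "g - h"] by (simp add: ideal_cong_def)

lemma ideal_cong_add:
  "ideal_cong R f g \<Longrightarrow> ideal_cong R f' g' \<Longrightarrow> ideal_cong R (f + f') (g + g')"
  using ideal_span.add[of "f - g" R "f' - g'"] by (simp add: ideal_cong_def algebra_simps)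

lemma ideal_cong_uminus: "ideal_cong R f g \<Longrightarrow> ideal_cong R (- f) (- g)"
  using ideal_span_uminus[of "f - g" R] by (simp add: ideal_cong_def)

lemma ideal_cong_diff:
  "ideal_cong R f g \<Longrightarrow> ideal_cong R f' g' \<Longrightarrow> ideal_cong R (f - f') (g - g')"
  using ideal_cong_add[OF _ ideal_cong_uminus, of R f g f' g'] by simp

lemma ideal_cong_mult:
  assumes "ideal_cong R f g" "ideal_cong R f' g'"
  shows "ideal_cong R (f * f') (g * g')"
proof -
  have "(f - g) * f' \<in> ideal_span R" "g * (f' - g') \<in> ideal_span R"
    using ideal_span_mult[of "f - g" R 1 f'] ideal_span_mult[of "f' - g'" R g 1] assms
    by (simp_all add: ideal_cong_def)
  then have "(f - g) * f' + g * (f' - g') \<in> ideal_span R" by (rule ideal_span.add)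
  then show ?thesis by (simp add: ideal_cong_def algebra_simps)
qed

lemma ideal_cong_sum:
  "(\<And>i. i \<in> A \<Longrightarrow> ideal_cong R (f i) (g i)) \<Longrightarrow> ideal_cong R (\<Sum>i\<in>A. f i) (\<Sum>i\<in>A. g i)"
  by (induction A rule: infinite_finite_induct) (simp_all add: ideal_cong_add)

lemma ideal_cong_base: "f - g \<in> R \<Longrightarrow> ideal_cong R f g"
  by (simp add: ideal_cong_def ideal_span_base)

lemma ideal_cong_hom:
  assumes "unital_ring_hom \<theta>" "\<And>r. r \<in> R \<Longrightarrow> \<theta> r \<in> ideal_span R" "ideal_cong R f g"
  shows "ideal_cong R (\<theta> f) (\<theta> g)"
  using ideal_span_hom[OF assms(1,2)] assms(3)
  by (simp add: ideal_cong_def flip: unital_ring_hom.hom_diff[OF assms(1)])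

definition free_ext :: "('g \<Rightarrow> ('h, 'k) free_elem) \<Rightarrow> ('g, 'k::comm_ring_1) free_elem \<Rightarrow> ('h, 'k) free_elem" where
  "free_ext f = linear_ext free_const (\<lambda>w. prod_list (map f (letters w)))"

lemma unital_ring_hom_free_const: "unital_ring_hom (free_const :: 'k \<Rightarrow> ('g, 'k::comm_ring_1) free_elem)"
  by standard (simp_all add: free_const_def single_add mult_single)

lemma free_const_commute: "free_const c * p = p * free_const c"
proof -
  have "free_const c * (\<Sum>m\<in>Poly_Mapping.keys p. Poly_Mapping.single m (Poly_Mapping.lookup p m))
      = (\<Sum>m\<in>Poly_Mapping.keys p. Poly_Mapping.single m (Poly_Mapping.lookup p m)) * free_const c"
    by (simp add: sum_distrib_left sum_distrib_right free_const_def mult_single mult.commute)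
  then show ?thesis by (simp add: sum_of_monomials)
qed

lemma letters_zero [simp]: "letters 0 = []" and letters_add [simp]: "letters (v + w) = letters v @ letters w"
  by (simp_all add: zero_word_def plus_word_def)

lemma unital_ring_hom_free_ext: "unital_ring_hom (free_ext f :: ('g, 'k::comm_ring_1) free_elem \<Rightarrow> ('h, 'k) free_elem)"
  unfolding free_ext_def
  by (intro unital_ring_hom_linear_ext unital_ring_hom_free_const) (simp_all add: free_const_commute)

lemma free_ext_gen [simp]: "free_ext f (free_gen g) = f g"
  by (simp add: free_ext_def free_gen_def linear_ext_single unital_ring_hom.hom_zero unital_ring_hom.hom_one
      unital_ring_hom_free_const)

lemma free_ext_const [simp]: "free_ext f (free_const c) = free_const c"
proof -
  have "free_ext f (Poly_Mapping.single 0 c) = free_const c"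
    by (simp add: free_ext_def linear_ext_single unital_ring_hom.hom_zero unital_ring_hom_free_const)
  then show ?thesis by (simp add: free_const_def)
qed

lemma free_algebra_simps [simp]:
  "mult (free_algebra G) = (*)" "one (free_algebra G) = 1"
  "zero (free_algebra G) = 0" "add (free_algebra G) = (+)"
  by (simp_all add: free_algebra_def)

lemma free_zero_closed [simp]: "0 \<in> carrier (free_algebra G)"
  by (simp add: free_algebra_def)

lemma free_const_closed [simp]: "free_const c \<in> carrier (free_algebra G)"
  by (auto simp: free_algebra_def free_const_def split: if_splits)

lemma free_one_closed [simp]: "1 \<in> carrier (free_algebra G)"
  by (simp add: free_algebra_def)

lemma free_gen_closed [simp]: "g \<in> G \<Longrightarrow> free_gen g \<in> carrier (free_algebra G)"
  by (auto simp: free_algebra_def free_gen_def split: if_splits)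

lemma free_add_closed [simp]:
  "f \<in> carrier (free_algebra G) \<Longrightarrow> g \<in> carrier (free_algebra G) \<Longrightarrow> f + g \<in> carrier (free_algebra G)"
  using keys_add[of f g] by (auto simp: free_algebra_def)

lemma free_uminus_closed [simp]:
  "f \<in> carrier (free_algebra G) \<Longrightarrow> - f \<in> carrier (free_algebra G)"
  by (auto simp: free_algebra_def in_keys_iff)

lemma free_diff_closed [simp]:
  "f \<in> carrier (free_algebra G) \<Longrightarrow> g \<in> carrier (free_algebra G) \<Longrightarrow> f - g \<in> carrier (free_algebra G)"
  using free_add_closed[of f G "- g"] by simp

lemma free_mult_closed [simp]:
  assumes "f \<in> carrier (free_algebra G)" "g \<in> carrier (free_algebra G)"
  shows "f * g \<in> carrier (free_algebra G)"
proof -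
  have "set (letters w) \<subseteq> G" if w: "w \<in> Poly_Mapping.keys (f * g)" for w
  proof -
    obtain u v where "w = u + v" "u \<in> Poly_Mapping.keys f" "v \<in> Poly_Mapping.keys g"
      using w keys_mult[of f g] by blast
    then show ?thesis using assms by (auto simp: free_algebra_def)
  qed
  then show ?thesis by (simp add: free_algebra_def)
qed

lemma free_sum_closed [simp]:
  "(\<And>i. i \<in> A \<Longrightarrow> f i \<in> carrier (free_algebra G)) \<Longrightarrow> (\<Sum>i\<in>A. f i) \<in> carrier (free_algebra G)"
  by (induction A rule: infinite_finite_induct) simp_all

lemma free_algebra_induct [consumes 1, case_names const gen add mult]:
  fixes f :: "('g, 'k::comm_ring_1) free_elem"
  assumes f: "f \<in> carrier (free_algebra G)"
    and const: "\<And>c. P (free_const c)"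
    and gen: "\<And>g. g \<in> G \<Longrightarrow> P (free_gen g)"
    and add: "\<And>f g. P f \<Longrightarrow> P g \<Longrightarrow> P (f + g)"
    and mult: "\<And>f g. P f \<Longrightarrow> P g \<Longrightarrow> P (f * g)"
  shows "P f"
proof -
  have P0: "P 0" and P1: "P 1"
    using const[of 0] const[of 1] by (simp_all add: free_const_def)
  have word: "P (Poly_Mapping.single (Word gs) 1)" if "set gs \<subseteq> G" for gs
    using that
  proof (induction gs)
    case Nil
    then show ?case using P1 by (simp flip: zero_word_def)
  next
    case (Cons g gs)
    have "Poly_Mapping.single (Word (g # gs)) 1 = free_gen g * Poly_Mapping.single (Word gs) (1::'k)"
      by (simp add: free_gen_def mult_single plus_word_def)
    then show ?case using mult[OF gen Cons.IH] Cons.prems by simp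
  qed
  have mon: "P (Poly_Mapping.single w a)" if "w \<in> Poly_Mapping.keys f" for w a
  proof -
    have "set (letters w) \<subseteq> G" using that f by (simp add: free_algebra_def)
    then have "P (free_const a * Poly_Mapping.single (Word (letters w)) 1)"
      by (intro mult const word)
    then show ?thesis by (simp add: free_const_def mult_single)
  qed
  have sum: "P (\<Sum>w\<in>A. h w)" if "\<And>w. w \<in> A \<Longrightarrow> P (h w)" for A :: "'g word set" and h
    using that by (induction A rule: infinite_finite_induct) (simp_all add: P0 add)
  have "P (\<Sum>w\<in>Poly_Mapping.keys f. Poly_Mapping.single w (Poly_Mapping.lookup f w))"
    by (intro sum mon)
  then show ?thesis by (simp add: sum_of_monomials)
qed

lemma free_ext_closed:
  assumes "f \<in> carrier (free_algebra G)" "\<And>g. g \<in> G \<Longrightarrow> \<theta> g \<in> carrier (free_algebra H)"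
  shows "free_ext \<theta> f \<in> carrier (free_algebra H)"
proof -
  interpret unital_ring_hom "free_ext \<theta>" by (rule unital_ring_hom_free_ext)
  from assms(1) show ?thesis
    by (induction rule: free_algebra_induct) (simp_all add: hom_simps assms(2))
qed

lemma ring_free_algebra: "ring (free_algebra G :: ('g, 'k::comm_ring_1) free_elem ring)"
proof (intro ringI abelian_groupI monoidI)
  fix f :: "('g, 'k) free_elem"
  assume "f \<in> carrier (free_algebra G)"
  then show "\<exists>g\<in>carrier (free_algebra G). g \<oplus>\<^bsub>free_algebra G\<^esub> f = \<zero>\<^bsub>free_algebra G\<^esub>"
    by (intro bexI[of _ "- f"]) simp_all
qed (simp_all add: algebra_simps)

text \<open>The ideal generated inside a free subalgebra is the trace of the ideal generated in the algebra
  on all letters: the endomorphism that kills the superfluous letters retracts one onto the other.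
  This lets congruences be computed with the operations of the type, without carrier conditions.\<close>

lemma genideal_free_algebra:
  fixes R :: "('g, 'k::comm_ring_1) free_elem set"
  assumes R: "R \<subseteq> carrier (free_algebra G)"
  shows "Idl\<^bsub>free_algebra G\<^esub> R = ideal_span R \<inter> carrier (free_algebra G)"
proof
  let ?F = "free_algebra G :: ('g, 'k) free_elem ring"
  interpret F: ring ?F by (rule ring_free_algebra)
  have neg: "\<ominus>\<^bsub>?F\<^esub> f = - f" if "f \<in> carrier ?F" for f
    using that by (intro F.minus_equality) simp_all
  have "0 \<in> ideal_span R \<inter> carrier ?F" by (simp add: ideal_span.zero)
  then have ne: "ideal_span R \<inter> carrier ?F \<noteq> {}" by blast
  have "subgroup (ideal_span R \<inter> carrier ?F) (add_monoid ?F)"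
    by (rule F.add.subgroupI)
      (use neg ne in \<open>auto simp: ideal_span.zero ideal_span.add ideal_span_uminus a_inv_def\<close>)
  then have "ideal (ideal_span R \<inter> carrier ?F) ?F"
    using ideal_span_mult[of _ R _ 1] ideal_span_mult[of _ R 1]
    by (intro idealI ring_free_algebra) auto
  then show "Idl\<^bsub>?F\<^esub> R \<subseteq> ideal_span R \<inter> carrier ?F"
    using R by (intro F.genideal_minimal) (auto intro: ideal_span_base)
next
  let ?F = "free_algebra G :: ('g, 'k) free_elem ring"
  interpret F: ring ?F by (rule ring_free_algebra)
  interpret I: ideal "Idl\<^bsub>?F\<^esub> R" ?F by (rule F.genideal_ideal[OF R])
  let ?\<rho> = "free_ext (\<lambda>g. if g \<in> G then free_gen g else 0) :: ('g, 'k) free_elem \<Rightarrow> ('g, 'k) free_elem"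
  interpret unital_ring_hom ?\<rho> by (rule unital_ring_hom_free_ext)
  have retract: "?\<rho> f = f" if "f \<in> carrier ?F" for f
    using that by (induction rule: free_algebra_induct) (simp_all add: hom_simps)
  have "f \<in> carrier (free_algebra UNIV)" for f :: "('g, 'k) free_elem"
    by (simp add: free_algebra_def)
  then have closed: "?\<rho> f \<in> carrier ?F" for f
    by (rule free_ext_closed) simp
  have "?\<rho> f \<in> Idl\<^bsub>?F\<^esub> R" if "f \<in> ideal_span R" for f
    using that
  proof (induction f rule: ideal_span.induct)
    case zero
    then show ?case using I.zero_closed by (simp add: hom_zero)
  next
    case (add f g)
    then show ?case using I.a_closed[of "?\<rho> f" "?\<rho> g"] by (simp add: hom_add)
  next
    case (gen r p q)
    have "r \<in> Idl\<^bsub>?F\<^esub> R" using F.genideal_self[OF R] gen by blast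
    then have "?\<rho> p * r * ?\<rho> q \<in> Idl\<^bsub>?F\<^esub> R"
      using I.I_l_closed[of r "?\<rho> p"] I.I_r_closed[of "?\<rho> p * r" "?\<rho> q"] closed by simp
    then show ?case using retract[of r] gen R by (auto simp: hom_mult)
  qed
  then show "ideal_span R \<inter> carrier ?F \<subseteq> Idl\<^bsub>?F\<^esub> R"
    using retract by fastforce
qed

locale presented_algebra =
  fixes G :: "'g set" and R :: "('g, 'k::comm_ring_1) free_elem set"
  assumes relations_closed: "R \<subseteq> carrier (free_algebra G)"
begin

abbreviation F :: "('g, 'k) free_elem ring" where "F \<equiv> free_algebra G"
abbreviation I :: "('g, 'k) free_elem set" where "I \<equiv> Idl\<^bsub>F\<^esub> R"
abbreviation Q :: "('g, 'k) free_elem set ring" where "Q \<equiv> F Quot I"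
abbreviation cls :: "('g, 'k) free_elem \<Rightarrow> ('g, 'k) free_elem set" where "cls f \<equiv> I +>\<^bsub>F\<^esub> f"

sublocale F: ring F by (rule ring_free_algebra)
sublocale I: ideal I F by (rule F.genideal_ideal[OF relations_closed])
sublocale Q: ring Q by (rule I.quotient_is_ring)

lemma I_eq: "I = ideal_span R \<inter> carrier F"
  by (rule genideal_free_algebra[OF relations_closed])

lemma cls_def': "cls f = {g + f | g. g \<in> ideal_span R \<inter> carrier F}"
  by (auto simp: a_r_coset_def' I_eq)

lemma cls_eqI:
  assumes "f \<in> carrier F" "g \<in> carrier F" "ideal_cong R f g"
  shows "cls f = cls g"
proof -
  have sub: "cls f \<subseteq> cls g" if fg: "f \<in> carrier F" "g \<in> carrier F" "ideal_cong R f g" for f g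
  proof
    fix y assume "y \<in> cls f"
    then obtain z where z: "z \<in> ideal_span R" "z \<in> carrier F" "y = z + f" by (auto simp: cls_def')
    then have "y = (z + (f - g)) + g" "z + (f - g) \<in> ideal_span R \<inter> carrier F"
      using fg by (auto simp: ideal_cong_def intro: ideal_span.add)
    then show "y \<in> cls g" unfolding cls_def' by blast
  qed
  show ?thesis using sub assms ideal_cong_sym by blast
qed

lemma carrier_Q: "carrier Q = cls ` carrier F"
  by (auto simp: FactRing_def A_RCOSETS_def')

lemma cls_closed: "f \<in> carrier F \<Longrightarrow> cls f \<in> carrier Q"
  by (simp add: carrier_Q)

lemma cls_mult: "f \<in> carrier F \<Longrightarrow> g \<in> carrier F \<Longrightarrow> cls f \<otimes>\<^bsub>Q\<^esub> cls g = cls (f * g)"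
  using ring_hom_mult[OF I.rcos_ring_hom, of f g] by simp

lemma cls_add: "f \<in> carrier F \<Longrightarrow> g \<in> carrier F \<Longrightarrow> cls f \<oplus>\<^bsub>Q\<^esub> cls g = cls (f + g)"
  using ring_hom_add[OF I.rcos_ring_hom, of f g] by simp

lemma cls_one: "\<one>\<^bsub>Q\<^esub> = cls 1"
  using ring_hom_one[OF I.rcos_ring_hom] by simp

lemma cls_zero: "\<zero>\<^bsub>Q\<^esub> = cls 0"
  using ring_hom_zero[OF I.rcos_ring_hom F.ring_axioms Q.ring_axioms] by simp

lemma cls_uminus: "f \<in> carrier F \<Longrightarrow> \<ominus>\<^bsub>Q\<^esub> cls f = cls (- f)"
  by (rule Q.minus_equality) (simp_all add: cls_add cls_closed cls_zero)

definition descend :: "(('g, 'k) free_elem \<Rightarrow> ('g, 'k) free_elem) \<Rightarrow> ('g, 'k) free_elem set \<Rightarrow> ('g, 'k) free_elem set" where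
  "descend \<theta> X = (\<Union>f\<in>X. cls (\<theta> f))"

definition respects_relations :: "(('g, 'k) free_elem \<Rightarrow> ('g, 'k) free_elem) \<Rightarrow> bool" where
  "respects_relations \<theta> \<longleftrightarrow> unital_ring_hom \<theta> \<and> (\<forall>f\<in>carrier F. \<theta> f \<in> carrier F) \<and>
     (\<forall>r\<in>R. \<theta> r \<in> ideal_span R)"

lemma descend_cls:
  assumes \<theta>: "respects_relations \<theta>" and f: "f \<in> carrier F"
  shows "descend \<theta> (cls f) = cls (\<theta> f)"
proof -
  have eq: "cls (\<theta> g) = cls (\<theta> f)" if g: "g \<in> cls f" for g
  proof (rule cls_eqI)
    obtain z where "z \<in> ideal_span R" "z \<in> carrier F" "g = z + f" using g by (auto simp: cls_def')
    then have gf: "ideal_cong R g f" and g': "g \<in> carrier F" using f by (simp_all add: ideal_cong_def)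
    show "ideal_cong R (\<theta> g) (\<theta> f)"
      by (rule ideal_cong_hom[OF _ _ gf]) (use \<theta> in \<open>simp_all add: respects_relations_def\<close>)
    show "\<theta> g \<in> carrier F" "\<theta> f \<in> carrier F"
      using \<theta> g' f by (simp_all add: respects_relations_def)
  qed
  have "f \<in> cls f" by (rule I.a_rcos_self[OF f])
  then show ?thesis unfolding descend_def using eq by blast
qed

lemma descend_hom:
  assumes \<theta>: "respects_relations \<theta>"
  shows "descend \<theta> \<in> ring_hom Q Q"
proof -
  interpret unital_ring_hom \<theta> using \<theta> by (simp add: respects_relations_def)
  have closed: "\<theta> f \<in> carrier F" if "f \<in> carrier F" for f
    using \<theta> that by (simp add: respects_relations_def)
  note step = descend_cls[OF \<theta>]
  show ?thesis
  proof (rule ring_hom_memI)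
    fix X assume "X \<in> carrier Q"
    then obtain f where f: "f \<in> carrier F" "X = cls f" by (auto simp: carrier_Q)
    show "descend \<theta> X \<in> carrier Q"
      unfolding f(2) step[OF f(1)] by (rule cls_closed[OF closed[OF f(1)]])
    fix Y assume "Y \<in> carrier Q"
    then obtain g where g: "g \<in> carrier F" "Y = cls g" by (auto simp: carrier_Q)
    have fg: "f * g \<in> carrier F" "f + g \<in> carrier F" using f g by simp_all
    show "descend \<theta> (X \<otimes>\<^bsub>Q\<^esub> Y) = descend \<theta> X \<otimes>\<^bsub>Q\<^esub> descend \<theta> Y"
      unfolding f(2) g(2) cls_mult[OF f(1) g(1)] step[OF f(1)] step[OF g(1)] step[OF fg(1)]
        cls_mult[OF closed[OF f(1)] closed[OF g(1)]] hom_mult ..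
    show "descend \<theta> (X \<oplus>\<^bsub>Q\<^esub> Y) = descend \<theta> X \<oplus>\<^bsub>Q\<^esub> descend \<theta> Y"
      unfolding f(2) g(2) cls_add[OF f(1) g(1)] step[OF f(1)] step[OF g(1)] step[OF fg(2)]
        cls_add[OF closed[OF f(1)] closed[OF g(1)]] hom_add ..
  next
    show "descend \<theta> \<one>\<^bsub>Q\<^esub> = \<one>\<^bsub>Q\<^esub>"
      unfolding cls_one step[OF free_one_closed] hom_one ..
  qed
qed

end

section \<open>Computing in \<open>Diff\<^sub>h(n,N)\<close>\<close>

lemma ideal_cong_mult_left: "ideal_cong R f g \<Longrightarrow> ideal_cong R (a * f) (a * g)"
  by (simp add: ideal_cong_mult)

lemma ideal_cong_mult_right: "ideal_cong R f g \<Longrightarrow> ideal_cong R (f * b) (g * b)"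
  by (simp add: ideal_cong_mult)

lemma sum_delta2:
  assumes "finite K" "i \<in> K" "j \<in> K"
  shows "(\<Sum>k\<in>K. \<Sum>l\<in>K. if k = i \<and> l = j then A else (0::'a::comm_monoid_add)) = A"
proof -
  have "(\<Sum>l\<in>K. if k = i \<and> l = j then A else 0) = (if k = i then A else 0)" for k
    using assms by (cases "k = i") simp_all
  then show ?thesis using assms by simp
qed

locale diff_presentation =
  fixes n N :: nat
begin

abbreviation diff_cong :: "'k::comm_ring_1 diff_pre \<Rightarrow> 'k diff_pre \<Rightarrow> bool" (infix \<open>\<doteq>\<close> 50) where
  "f \<doteq> g \<equiv> ideal_cong (diff_rels n N) f g"

abbreviation u :: "'k::comm_ring_1 mpoly \<Rightarrow> 'k mpoly \<Rightarrow> 'k diff_pre" where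
  "u p s \<equiv> fu (U_frac n p s)"

lemmas cong_left = ideal_cong_mult_left[where R = "diff_rels n N"]
lemmas cong_right = ideal_cong_mult_right[where R = "diff_rels n N"]

lemma fu_add:
  "a \<in> carrier (U_loc n) \<Longrightarrow> b \<in> carrier (U_loc n) \<Longrightarrow> fu (a \<oplus>\<^bsub>U_loc n\<^esub> b) \<doteq> fu a + fu b"
  by (rule ideal_cong_base) (unfold diff_rels_def, intro UnI1, rule CollectI, intro exI conjI, rule refl)

lemma fu_mult:
  "a \<in> carrier (U_loc n) \<Longrightarrow> b \<in> carrier (U_loc n) \<Longrightarrow> fu (a \<otimes>\<^bsub>U_loc n\<^esub> b) \<doteq> fu a * fu b"
  by (rule ideal_cong_base) (unfold diff_rels_def, rule UnI1, rule UnI1, rule UnI1, rule UnI1, rule UnI1,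
      rule UnI1, rule UnI2, rule CollectI, intro exI conjI, rule refl)

lemma u_const: "u (polyconst c) 1 \<doteq> free_const c"
  by (rule ideal_cong_base) (unfold diff_rels_def, blast)

lemma h_x:
  "i \<in> {1..n} \<Longrightarrow> j \<in> {1..n} \<Longrightarrow> a \<in> {1..N} \<Longrightarrow>
    fh n i * fx j a \<doteq> fx j a * (fh n i + (if i = j then 1 else 0))"
  by (rule ideal_cong_base) (unfold diff_rels_def, blast)

lemma h_d:
  "i \<in> {1..n} \<Longrightarrow> j \<in> {1..n} \<Longrightarrow> a \<in> {1..N} \<Longrightarrow>
    fh n i * fd j a \<doteq> fd j a * (fh n i - (if i = j then 1 else 0))"
  by (rule ideal_cong_base) (unfold diff_rels_def, blast)

lemma x_x:
  "i \<in> {1..n} \<Longrightarrow> j \<in> {1..n} \<Longrightarrow> a \<in> {1..N} \<Longrightarrow> b \<in> {1..N} \<Longrightarrow>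
    fx i a * fx j b \<doteq> (\<Sum>k\<in>{1..n}. \<Sum>l\<in>{1..n}. fu (Rhat n i j k l) * fx k b * fx l a)"
  by (rule ideal_cong_base) (unfold diff_rels_def, blast)

lemma d_d:
  "i \<in> {1..n} \<Longrightarrow> j \<in> {1..n} \<Longrightarrow> a \<in> {1..N} \<Longrightarrow> b \<in> {1..N} \<Longrightarrow>
    fd i a * fd j b \<doteq> (\<Sum>k\<in>{1..n}. \<Sum>l\<in>{1..n}. fu (Rhat n l k j i) * fd k b * fd l a)"
  by (rule ideal_cong_base) (unfold diff_rels_def, blast)

lemma x_d:
  "i \<in> {1..n} \<Longrightarrow> j \<in> {1..n} \<Longrightarrow> a \<in> {1..N} \<Longrightarrow> b \<in> {1..N} \<Longrightarrow>
    fx i a * fd j b \<doteq> (\<Sum>k\<in>{1..n}. \<Sum>l\<in>{1..n}. fu (U_shift n k (Rhat n k i l j)) * fd k b * fx l a)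
      - (if a = b \<and> i = j then 1 else 0)"
  by (rule ideal_cong_base) (unfold diff_rels_def, blast)

subsection \<open>Coefficients\<close>

lemma u_mult:
  "p \<in> U_h n \<Longrightarrow> s \<in> denoms n \<Longrightarrow> q \<in> U_h n \<Longrightarrow> t \<in> denoms n \<Longrightarrow> u p s * u q t \<doteq> u (p * q) (s * t)"
  by (rule ideal_cong_sym) (use fu_mult[of "U_frac n p s" "U_frac n q t"] in \<open>simp add: U_frac_mult\<close>)

lemma u_add:
  "p \<in> U_h n \<Longrightarrow> s \<in> denoms n \<Longrightarrow> q \<in> U_h n \<Longrightarrow> t \<in> denoms n \<Longrightarrow> u p s + u q t \<doteq> u (p * t + q * s) (s * t)"
  by (rule ideal_cong_sym) (use fu_add[of "U_frac n p s" "U_frac n q t"] in \<open>simp add: U_frac_add\<close>)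

lemma u_one: "u 1 1 \<doteq> 1"
  using u_const[of 1] by (simp add: polyconst_def free_const_def)

lemma u_zero: "u 0 1 \<doteq> 0"
  using u_const[of 0] by (simp add: polyconst_def free_const_def)

lemma u_self: "s \<in> denoms n \<Longrightarrow> u s s \<doteq> 1"
  using u_one U_frac_eqI'[of s n 1 s 1] by (simp add: denoms_subset_U_h)

lemma u_uminus:
  assumes "p \<in> U_h n" "s \<in> denoms n"
  shows "u (- p) s \<doteq> - u p s"
proof -
  have s: "s \<in> U_h n" using assms by (simp add: denoms_subset_U_h)
  have "u (- p) s + u p s \<doteq> u (- p * s + p * s) (s * s)" by (rule u_add) (simp_all add: assms)
  also have "u (- p * s + p * s) (s * s) = u 0 1"
    using assms by (intro arg_cong[of _ _ fu] U_frac_eqI') simp_all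
  also have "\<dots> \<doteq> 0" by (rule u_zero)
  finally show ?thesis by (simp add: ideal_cong_def)
qed

lemma u_commute:
  assumes "p \<in> U_h n" "s \<in> denoms n" "q \<in> U_h n" "t \<in> denoms n"
  shows "u p s * u q t \<doteq> u q t * u p s"
proof -
  have "u p s * u q t \<doteq> u (q * p) (t * s)" using u_mult[OF assms] by (simp add: mult.commute)
  also have "\<dots> \<doteq> u q t * u p s" by (rule ideal_cong_sym[OF u_mult]) (simp_all add: assms)
  finally show ?thesis .
qed

text \<open>An element that shifts the variables shifts every fraction. For polynomials this propagates
  through sums and products; a denominator is moved by multiplying with its shifted inverse.\<close>

lemma u_past:
  assumes gen: "\<And>i. i \<in> {1..n} \<Longrightarrow> fh n i * y \<doteq> y * u (poly_shift_by k z (polyvar i)) 1"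
    and "p \<in> U_h n" and s: "s \<in> denoms n"
  shows "u p s * y \<doteq> y * u (poly_shift_by k z p) (poly_shift_by k z s)"
proof -
  let ?\<theta> = "poly_shift_by k z"
  have poly: "p \<in> U_h n \<and> u p 1 * y \<doteq> y * u (?\<theta> p) 1" if "p \<in> U_h n" for p
    using that
  proof (induction p rule: U_h_induct)
    case (const c)
    have "u (polyconst c) 1 * y \<doteq> free_const c * y" by (rule cong_right[OF u_const])
    also have "\<dots> = y * free_const c" by (rule free_const_commute)
    also have "\<dots> \<doteq> y * u (polyconst c) 1" by (rule cong_left[OF ideal_cong_sym[OF u_const]])
    finally show ?case by simp
  next
    case (var i)
    then show ?case using gen[of i] by simp
  next
    case (add p q)
    have "u (p + q) 1 * y \<doteq> (u p 1 + u q 1) * y"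
      using add ideal_cong_sym[OF u_add[of p 1 q 1]] by (intro cong_right) simp
    also have "\<dots> = u p 1 * y + u q 1 * y" by (rule distrib_right)
    also have "\<dots> \<doteq> y * u (?\<theta> p) 1 + y * u (?\<theta> q) 1" using add by (intro ideal_cong_add) simp_all
    also have "\<dots> = y * (u (?\<theta> p) 1 + u (?\<theta> q) 1)" by (simp add: distrib_left)
    also have "\<dots> \<doteq> y * u (?\<theta> (p + q)) 1"
      using add u_add[of "?\<theta> p" 1 "?\<theta> q" 1] by (intro cong_left) (simp add: shift.hom_add)
    finally show ?case using add by simp
  next
    case (mult p q)
    have "u (p * q) 1 * y \<doteq> (u p 1 * u q 1) * y"
      using mult ideal_cong_sym[OF u_mult[of p 1 q 1]] by (intro cong_right) simp
    also have "\<dots> = u p 1 * (u q 1 * y)" by (rule mult.assoc)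
    also have "\<dots> \<doteq> u p 1 * (y * u (?\<theta> q) 1)" using mult by (intro cong_left) simp
    also have "\<dots> = u p 1 * y * u (?\<theta> q) 1" by (simp add: mult.assoc)
    also have "\<dots> \<doteq> y * u (?\<theta> p) 1 * u (?\<theta> q) 1" using mult by (intro cong_right) simp
    also have "\<dots> = y * (u (?\<theta> p) 1 * u (?\<theta> q) 1)" by (simp add: mult.assoc)
    also have "\<dots> \<doteq> y * u (?\<theta> (p * q)) 1"
      using mult u_mult[of "?\<theta> p" 1 "?\<theta> q" 1] by (intro cong_left) (simp add: shift.hom_mult)
    finally show ?case using mult by simp
  qed
  have sU: "s \<in> U_h n" by (rule denoms_subset_U_h[OF s])
  have \<theta>s: "?\<theta> s \<in> denoms n" "?\<theta> s \<in> U_h n" using s sU by simp_all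
  have "u (?\<theta> s) 1 * u 1 (?\<theta> s) \<doteq> 1"
    using ideal_cong_trans[OF _ u_self[OF \<theta>s(1)]] u_mult[of "?\<theta> s" 1 1 "?\<theta> s"] \<theta>s by simp
  then have inv1: "1 \<doteq> u (?\<theta> s) 1 * u 1 (?\<theta> s)" by (rule ideal_cong_sym)
  have inv2: "u 1 s * u s 1 \<doteq> 1"
    using ideal_cong_trans[OF _ u_self[OF s]] u_mult[of 1 s s 1] s sU by simp
  have denom: "u 1 s * y \<doteq> y * u 1 (?\<theta> s)"
  proof -
    have "u 1 s * y \<doteq> u 1 s * y * (u (?\<theta> s) 1 * u 1 (?\<theta> s))" using cong_left[OF inv1] by simp
    also have "\<dots> = u 1 s * (y * u (?\<theta> s) 1) * u 1 (?\<theta> s)" by (simp add: mult.assoc)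
    also have "\<dots> \<doteq> u 1 s * (u s 1 * y) * u 1 (?\<theta> s)"
      by (intro cong_right cong_left ideal_cong_sym[OF conjunct2[OF poly[OF sU]]])
    also have "\<dots> = (u 1 s * u s 1) * (y * u 1 (?\<theta> s))" by (simp add: mult.assoc)
    also have "\<dots> \<doteq> 1 * (y * u 1 (?\<theta> s))" by (rule cong_right[OF inv2])
    finally show ?thesis by simp
  qed
  have "u p s * y \<doteq> (u p 1 * u 1 s) * y"
    using ideal_cong_sym[OF u_mult[of p 1 1 s]] assms by (intro cong_right) simp
  also have "\<dots> = u p 1 * (u 1 s * y)" by (rule mult.assoc)
  also have "\<dots> \<doteq> u p 1 * (y * u 1 (?\<theta> s))" by (rule cong_left[OF denom])
  also have "\<dots> = u p 1 * y * u 1 (?\<theta> s)" by (simp add: mult.assoc)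
  also have "\<dots> \<doteq> y * u (?\<theta> p) 1 * u 1 (?\<theta> s)" using poly[OF assms(2)] by (intro cong_right) simp
  also have "\<dots> = y * (u (?\<theta> p) 1 * u 1 (?\<theta> s))" by (rule mult.assoc)
  also have "\<dots> \<doteq> y * u (?\<theta> p) (?\<theta> s)"
    using u_mult[of "?\<theta> p" 1 1 "?\<theta> s"] assms by (intro cong_left) simp
  finally show ?thesis .
qed

lemma h_shift:
  assumes "i \<in> {1..n}"
  shows "u (poly_shift_by j z (polyvar i)) 1 \<doteq> fh n i + (if i = j then of_int z else 0)"
proof (cases "i = j")
  case True
  have int: "u (of_int z) 1 \<doteq> (of_int z :: 'a diff_pre)"
    using u_const[of "of_int z"]
    by (simp flip: of_int_eq_polyconst add: unital_ring_hom.hom_of_int[OF unital_ring_hom_free_const])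
  have "u (polyvar i + of_int z) 1 \<doteq> (fh n i + u (of_int z) 1 :: 'a diff_pre)"
    by (rule ideal_cong_sym) (use u_add[of "polyvar i" 1 "of_int z" 1] assms in simp)
  also have "\<dots> \<doteq> fh n i + of_int z" by (rule ideal_cong_add[OF ideal_cong_refl int])
  finally have "u (polyvar i + of_int z) 1 \<doteq> (fh n i + of_int z :: 'a diff_pre)" .
  then show ?thesis using True by simp
qed simp

lemma u_x:
  assumes "j \<in> {1..n}" "a \<in> {1..N}" "p \<in> U_h n" "s \<in> denoms n"
  shows "u p s * fx j a \<doteq> fx j a * u (poly_shift_by j 1 p) (poly_shift_by j 1 s)"
proof (rule u_past[OF _ assms(3,4)])
  fix i assume i: "i \<in> {1..n}"
  show "fh n i * fx j a \<doteq> fx j a * u (poly_shift_by j 1 (polyvar i)) 1"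
    by (rule ideal_cong_trans[OF h_x[OF i assms(1,2)] cong_left[OF ideal_cong_sym]])
      (use h_shift[OF i, of j 1] in \<open>cases "i = j"; simp\<close>)
qed

lemma u_d:
  assumes "j \<in> {1..n}" "a \<in> {1..N}" "p \<in> U_h n" "s \<in> denoms n"
  shows "u p s * fd j a \<doteq> fd j a * u (poly_shift_by j (-1) p) (poly_shift_by j (-1) s)"
proof (rule u_past[OF _ assms(3,4)])
  fix i assume i: "i \<in> {1..n}"
  have "fh n i * fd j a \<doteq> fd j a * (fh n i - (if i = j then 1 else 0))" by (rule h_d[OF i assms(1,2)])
  also have "fh n i - (if i = j then 1 else 0) = fh n i + (if i = j then of_int (-1) else 0)"
    by simp
  also have "fd j a * (fh n i + (if i = j then of_int (-1) else 0)) \<doteq> fd j a * u (poly_shift_by j (-1) (polyvar i)) 1"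
    by (rule cong_left[OF ideal_cong_sym[OF h_shift[OF i]]])
  finally show "fh n i * fd j a \<doteq> fd j a * u (poly_shift_by j (-1) (polyvar i)) 1" .
qed

lemma x_u:
  assumes "j \<in> {1..n}" "a \<in> {1..N}" "p \<in> U_h n" "s \<in> denoms n"
  shows "fx j a * u p s \<doteq> u (poly_shift_by j (-1) p) (poly_shift_by j (-1) s) * fx j a"
  using ideal_cong_sym[OF u_x[OF assms(1,2), of "poly_shift_by j (-1) p" "poly_shift_by j (-1) s"]] assms
  by (simp add: poly_shift_by_inverse)

lemma d_u:
  assumes "j \<in> {1..n}" "a \<in> {1..N}" "p \<in> U_h n" "s \<in> denoms n"
  shows "fd j a * u p s \<doteq> u (poly_shift_by j 1 p) (poly_shift_by j 1 s) * fd j a"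
  using ideal_cong_sym[OF u_d[OF assms(1,2), of "poly_shift_by j 1 p" "poly_shift_by j 1 s"]] assms
  by (simp add: poly_shift_by_inverse)

lemma u_x_x:
  assumes "i \<in> {1..n}" "j \<in> {1..n}" "a \<in> {1..N}" "b \<in> {1..N}" "p \<in> U_h n" "s \<in> denoms n"
  shows "u p s * fx i a * fx j b
    \<doteq> fx i a * fx j b * u (poly_shift_by j 1 (poly_shift_by i 1 p)) (poly_shift_by j 1 (poly_shift_by i 1 s))"
proof -
  have "u p s * fx i a * fx j b \<doteq> fx i a * u (poly_shift_by i 1 p) (poly_shift_by i 1 s) * fx j b"
    by (intro cong_right u_x assms)
  also have "\<dots> = fx i a * (u (poly_shift_by i 1 p) (poly_shift_by i 1 s) * fx j b)" by (rule mult.assoc)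
  also have "\<dots> \<doteq> fx i a * (fx j b * u (poly_shift_by j 1 (poly_shift_by i 1 p)) (poly_shift_by j 1 (poly_shift_by i 1 s)))"
    by (intro cong_left u_x U_h_shift denoms_shift assms)
  finally show ?thesis by (simp add: mult.assoc)
qed

lemma d_x_u:
  assumes "i \<in> {1..n}" "j \<in> {1..n}" "a \<in> {1..N}" "b \<in> {1..N}" "p \<in> U_h n" "s \<in> denoms n"
  shows "fd j b * fx i a * u p s
    \<doteq> u (poly_shift_by j 1 (poly_shift_by i (-1) p)) (poly_shift_by j 1 (poly_shift_by i (-1) s)) * fd j b * fx i a"
proof -
  have "fd j b * fx i a * u p s = fd j b * (fx i a * u p s)" by (rule mult.assoc)
  also have "\<dots> \<doteq> fd j b * (u (poly_shift_by i (-1) p) (poly_shift_by i (-1) s) * fx i a)"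
    by (intro cong_left x_u assms)
  also have "\<dots> = fd j b * u (poly_shift_by i (-1) p) (poly_shift_by i (-1) s) * fx i a"
    by (simp add: mult.assoc)
  also have "\<dots> \<doteq> u (poly_shift_by j 1 (poly_shift_by i (-1) p)) (poly_shift_by j 1 (poly_shift_by i (-1) s)) * fd j b * fx i a"
    by (intro cong_right d_u U_h_shift denoms_shift assms)
  finally show ?thesis .
qed

subsection \<open>The quadratic relations without zero terms\<close>

text \<open>Stated for arbitrary values \<open>c\<close>, \<open>y\<close>, \<open>z\<close> of the generators, so as to apply both to the relations
  and to their images under a permutation.\<close>

lemma Rhat_diag: "i \<noteq> j \<Longrightarrow> Rhat n i j i j = U_frac n 1 (hdiff i j)"
  by (simp add: Rhat_def)

lemma Rhat_swap: "Rhat n i j j i = (if i = j then U_frac n 1 1 else U_frac n (swap_num i j) (swap_den i j))"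
  by (simp add: Rhat_def swap_num_def swap_den_def)

lemma Rhat_zero: "\<not> (k = i \<and> l = j) \<Longrightarrow> \<not> (k = j \<and> l = i) \<Longrightarrow> Rhat n i j k l = U_frac n 0 1"
  by (auto simp: Rhat_def)

lemma zero_coefficient:
  assumes "c (U_frac n 0 1) \<doteq> 0"
  shows "c (U_frac n 0 1) * y * z \<doteq> 0"
  using cong_right[OF cong_right[OF assms], of y z] by simp

lemma two_terms:
  assumes ij: "i \<in> {1..n}" "j \<in> {1..n}" "i \<noteq> j"
    and ends: "f i j = A" "f j i = B"
    and zero: "\<And>k l. \<not> (k = i \<and> l = j) \<Longrightarrow> \<not> (k = j \<and> l = i) \<Longrightarrow> f k l \<doteq> 0"
  shows "(\<Sum>k\<in>{1..n}. \<Sum>l\<in>{1..n}. f k l) \<doteq> A + B"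
proof -
  have "f k l \<doteq> (if k = i \<and> l = j then A else 0) + (if k = j \<and> l = i then B else 0)" for k l
    using ij ends zero[of k l] by (cases "k = i \<and> l = j"; cases "k = j \<and> l = i") auto
  then have "(\<Sum>k\<in>{1..n}. \<Sum>l\<in>{1..n}. f k l) \<doteq> (\<Sum>k\<in>{1..n}. \<Sum>l\<in>{1..n}.
      (if k = i \<and> l = j then A else 0) + (if k = j \<and> l = i then B else 0))"
    by (intro ideal_cong_sum)
  also have "\<dots> = A + B" using ij by (simp add: sum.distrib sum_delta2 del: atLeastAtMost_iff)
  finally show ?thesis .
qed

lemma one_term:
  assumes ij: "i \<in> {1..n}" "j \<in> {1..n}"
    and ends: "f i j = A"
    and zero: "\<And>k l. \<not> (k = i \<and> l = j) \<Longrightarrow> f k l \<doteq> 0"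
  shows "(\<Sum>k\<in>{1..n}. \<Sum>l\<in>{1..n}. f k l) \<doteq> A"
proof -
  have "f k l \<doteq> (if k = i \<and> l = j then A else 0)" for k l
    using ends zero[of k l] by auto
  then have "(\<Sum>k\<in>{1..n}. \<Sum>l\<in>{1..n}. f k l) \<doteq> (\<Sum>k\<in>{1..n}. \<Sum>l\<in>{1..n}.
      (if k = i \<and> l = j then A else 0))"
    by (intro ideal_cong_sum)
  also have "\<dots> = A" using ij by (simp add: sum_delta2 del: atLeastAtMost_iff)
  finally show ?thesis .
qed

lemma sum_xx:
  assumes "c (U_frac n 0 1) \<doteq> 0" "i \<in> {1..n}" "j \<in> {1..n}"
  shows "(\<Sum>k\<in>{1..n}. \<Sum>l\<in>{1..n}. c (Rhat n i j k l) * y k b * y l a)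
    \<doteq> (if i = j then c (U_frac n 1 1) * y i b * y i a
       else c (U_frac n 1 (hdiff i j)) * y i b * y j a
         + c (U_frac n (swap_num i j) (swap_den i j)) * y j b * y i a)"
proof (cases "i = j")
  case True
  have "(\<Sum>k\<in>{1..n}. \<Sum>l\<in>{1..n}. c (Rhat n i i k l) * y k b * y l a) \<doteq> c (U_frac n 1 1) * y i b * y i a"
    by (rule one_term[OF assms(2,2)]) (simp_all add: Rhat_swap[of i i, simplified] Rhat_zero zero_coefficient assms(1))
  then show ?thesis using True by simp
next
  case False
  have "(\<Sum>k\<in>{1..n}. \<Sum>l\<in>{1..n}. c (Rhat n i j k l) * y k b * y l a)
      \<doteq> c (U_frac n 1 (hdiff i j)) * y i b * y j a
        + c (U_frac n (swap_num i j) (swap_den i j)) * y j b * y i a"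
    by (rule two_terms[OF assms(2,3) False])
      (simp_all add: False Rhat_swap Rhat_diag Rhat_zero zero_coefficient assms(1))
  then show ?thesis using False by simp
qed

lemma sum_dd:
  assumes "c (U_frac n 0 1) \<doteq> 0" "i \<in> {1..n}" "j \<in> {1..n}"
  shows "(\<Sum>k\<in>{1..n}. \<Sum>l\<in>{1..n}. c (Rhat n l k j i) * y k b * y l a)
    \<doteq> (if i = j then c (U_frac n 1 1) * y i b * y i a
       else c (U_frac n 1 (hdiff j i)) * y i b * y j a
         + c (U_frac n (swap_num i j) (swap_den i j)) * y j b * y i a)"
proof -
  have zero: "Rhat n l k j i = U_frac n 0 1" if "\<not> (k = i \<and> l = j)" "\<not> (k = j \<and> l = i)" for k l
    using that by (auto simp: Rhat_def)
  show ?thesis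
  proof (cases "i = j")
    case True
    have "(\<Sum>k\<in>{1..n}. \<Sum>l\<in>{1..n}. c (Rhat n l k i i) * y k b * y l a) \<doteq> c (U_frac n 1 1) * y i b * y i a"
      by (rule one_term[OF assms(2,2)])
        (simp_all add: Rhat_swap[of i i, simplified] zero[unfolded True[symmetric]] zero_coefficient assms(1))
    then show ?thesis using True by simp
  next
    case False
    have "(\<Sum>k\<in>{1..n}. \<Sum>l\<in>{1..n}. c (Rhat n l k j i) * y k b * y l a)
        \<doteq> c (U_frac n 1 (hdiff j i)) * y i b * y j a
          + c (U_frac n (swap_num i j) (swap_den i j)) * y j b * y i a"
      by (rule two_terms[OF assms(2,3) False])
        (use False in \<open>simp_all add: Rhat_swap Rhat_diag zero zero_coefficient assms(1)\<close>)
    then show ?thesis using False by simp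
  qed
qed

text \<open>For \<open>i = j\<close> the terms with \<open>k \<noteq> i\<close> have the coefficient \<open>(1 / h\<^sub>k\<^sub>i)[\<epsilon>\<^sub>k] = 1 / (h\<^sub>k\<^sub>i + 1)\<close>. At \<open>k = i\<close> this
  formula gives \<open>1\<close>, which is the entry of the R-matrix there, so that the sum is uniform in \<open>k\<close>.\<close>

lemma sum_dx:
  fixes c :: "'k::comm_ring_1 loc_elem \<Rightarrow> 'k diff_pre"
  assumes c: "c (U_frac n 0 1) \<doteq> 0" and ij: "i \<in> {1..n}" "j \<in> {1..n}"
  shows "(\<Sum>k\<in>{1..n}. \<Sum>l\<in>{1..n}. c (U_shift n k (Rhat n k i l j)) * z k b * y l a)
    \<doteq> (if i = j then \<Sum>k\<in>{1..n}. c (U_frac n 1 (hdiff k i + 1)) * z k b * y k a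
       else c (U_frac n (poly_shift_by j 1 (swap_num j i)) (poly_shift_by j 1 (swap_den j i))) * z j b * y i a)"
proof -
  have zero: "U_shift n k (U_frac n 0 1) = (U_frac n 0 1 :: 'k loc_elem)" for k
    by (simp add: U_shift_eq U_map_shift_frac shift.hom_simps)
  show ?thesis
  proof (cases "i = j")
    case True
    have diag: "U_shift n k (Rhat n k i k i) = (U_frac n 1 (hdiff k i + 1) :: 'k loc_elem)"
      if "k \<in> {1..n}" for k
    proof (cases "k = i")
      case True
      then show ?thesis by (simp add: Rhat_swap U_shift_eq U_map_shift_frac shift.hom_simps)
    next
      case False
      then show ?thesis
        using that ij by (simp add: Rhat_diag U_shift_eq U_map_shift_frac shift.hom_simps diff_add_eq)
    qed
    have "(\<Sum>l\<in>{1..n}. c (U_shift n k (Rhat n k i l i)) * z k b * y l a)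
        \<doteq> c (U_frac n 1 (hdiff k i + 1)) * z k b * y k a" if k: "k \<in> {1..n}" for k
    proof -
      have "(\<Sum>l\<in>{1..n}. c (U_shift n k (Rhat n k i l i)) * z k b * y l a)
          \<doteq> (\<Sum>l\<in>{1..n}. if l = k then c (U_frac n 1 (hdiff k i + 1)) * z k b * y k a else 0)"
      proof (rule ideal_cong_sum)
        fix l
        show "c (U_shift n k (Rhat n k i l i)) * z k b * y l a
            \<doteq> (if l = k then c (U_frac n 1 (hdiff k i + 1)) * z k b * y k a else 0)"
        proof (cases "l = k")
          case True
          then show ?thesis by (simp add: diag[OF k])
        next
          case False
          then have "Rhat n k i l i = (U_frac n 0 1 :: 'k loc_elem)" by (intro Rhat_zero) auto
          then show ?thesis using False zero_coefficient[of c, OF c] by (simp add: zero)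
        qed
      qed
      then show ?thesis using k by simp
    qed
    then show ?thesis using True by (auto intro!: ideal_cong_sum)
  next
    case False
    have "(\<Sum>k\<in>{1..n}. \<Sum>l\<in>{1..n}. c (U_shift n k (Rhat n k i l j)) * z k b * y l a)
        \<doteq> c (U_shift n j (Rhat n j i i j)) * z j b * y i a"
    proof (rule one_term[OF ij(2,1) refl])
      fix k l assume kl: "\<not> (k = j \<and> l = i)"
      have "Rhat n k i l j = (U_frac n 0 1 :: 'k loc_elem)" by (rule Rhat_zero) (use False kl in auto)
      then show "c (U_shift n k (Rhat n k i l j)) * z k b * y l a \<doteq> 0"
        using zero_coefficient[of c, OF c] by (simp add: zero)
    qed
    moreover have "U_shift n j (Rhat n j i i j)
        = (U_frac n (poly_shift_by j 1 (swap_num j i)) (poly_shift_by j 1 (swap_den j i)) :: 'k loc_elem)"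
      using False ij by (simp add: Rhat_swap U_shift_eq U_map_shift_frac)
    ultimately show ?thesis using False by simp
  qed
qed

lemma x_swap:
  assumes "i \<in> {1..n}" "j \<in> {1..n}" "a \<in> {1..N}" "b \<in> {1..N}" "i \<noteq> j"
  shows "fx i a * fx j b \<doteq> u 1 (hdiff i j) * fx i b * fx j a
    + u (swap_num i j) (swap_den i j) * fx j b * fx i a"
  using ideal_cong_trans[OF x_x[OF assms(1-4)] sum_xx[where c = fu and y = fx, OF u_zero assms(1,2)]] assms(5)
  by simp

lemma x_same:
  assumes "i \<in> {1..n}" "a \<in> {1..N}" "b \<in> {1..N}"
  shows "fx i a * fx i b \<doteq> fx i b * fx i a"
proof -
  have "fx i a * fx i b \<doteq> u 1 1 * fx i b * fx i a"
    using ideal_cong_trans[OF x_x[OF assms(1,1,2,3)] sum_xx[where c = fu and y = fx, OF u_zero assms(1,1)]]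
    by simp
  also have "\<dots> \<doteq> 1 * fx i b * fx i a" by (intro cong_right u_one)
  finally show ?thesis by simp
qed

lemma d_swap:
  assumes "i \<in> {1..n}" "j \<in> {1..n}" "a \<in> {1..N}" "b \<in> {1..N}" "i \<noteq> j"
  shows "fd i a * fd j b \<doteq> u 1 (hdiff j i) * fd i b * fd j a
    + u (swap_num i j) (swap_den i j) * fd j b * fd i a"
  using ideal_cong_trans[OF d_d[OF assms(1-4)] sum_dd[where c = fu and y = fd, OF u_zero assms(1,2)]] assms(5)
  by simp

lemma d_same:
  assumes "i \<in> {1..n}" "a \<in> {1..N}" "b \<in> {1..N}"
  shows "fd i a * fd i b \<doteq> fd i b * fd i a"
proof -
  have "fd i a * fd i b \<doteq> u 1 1 * fd i b * fd i a"
    using ideal_cong_trans[OF d_d[OF assms(1,1,2,3)] sum_dd[where c = fu and y = fd, OF u_zero assms(1,1)]]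
    by simp
  also have "\<dots> \<doteq> 1 * fd i b * fd i a" by (intro cong_right u_one)
  finally show ?thesis by simp
qed

lemma x_d_swap:
  assumes "i \<in> {1..n}" "j \<in> {1..n}" "a \<in> {1..N}" "b \<in> {1..N}" "i \<noteq> j"
  shows "fx i a * fd j b
    \<doteq> u (poly_shift_by j 1 (swap_num j i)) (poly_shift_by j 1 (swap_den j i)) * fd j b * fx i a"
  using ideal_cong_trans[OF x_d[OF assms(1-4)] ideal_cong_diff[OF
        sum_dx[where c = fu and y = fx and z = fd, OF u_zero assms(1,2)] ideal_cong_refl]] assms(5)
  by simp

lemma x_d_same:
  assumes "i \<in> {1..n}" "a \<in> {1..N}" "b \<in> {1..N}"
  shows "fx i a * fd i b
    \<doteq> (\<Sum>k\<in>{1..n}. u 1 (hdiff k i + 1) * fd k b * fx k a) - (if a = b then 1 else 0)"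
  using ideal_cong_trans[OF x_d[OF assms(1,1,2,3)] ideal_cong_diff[OF
        sum_dx[where c = fu and y = fx and z = fd, OF u_zero assms(1,1)] ideal_cong_refl]]
  by simp


section \<open>The action of permutations on generators\<close>

text \<open>The factor makes \<open>x\<^sup>j \<psi>\<^sub>j\<close> go to \<open>x\<^bsup>\<sigma>j\<^esup> \<psi>\<^bsub>\<sigma>j\<^esub>\<close>, so that \<open>y\<^sup>j\<close> goes to \<open>y\<^bsup>\<sigma>j\<^esup>\<close>.\<close>

definition twist_x :: "(nat \<Rightarrow> nat) \<Rightarrow> nat \<Rightarrow> nat \<Rightarrow> 'k::comm_ring_1 diff_pre" where
  "twist_x \<sigma> j a = fx (\<sigma> j) a * u (gauge (\<sigma> j)) (poly_perm \<sigma> (gauge j))"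

definition twist_d :: "(nat \<Rightarrow> nat) \<Rightarrow> nat \<Rightarrow> nat \<Rightarrow> 'k::comm_ring_1 diff_pre" where
  "twist_d \<sigma> j a = u (poly_perm \<sigma> (gauge j)) (gauge (\<sigma> j)) * fd (\<sigma> j) a"

definition twist_u :: "(nat \<Rightarrow> nat) \<Rightarrow> 'k::comm_ring_1 loc_elem \<Rightarrow> 'k diff_pre" where
  "twist_u \<sigma> a = fu (U_map n (poly_perm \<sigma>) a)"

definition twist :: "(nat \<Rightarrow> nat) \<Rightarrow> 'k::comm_ring_1 diff_pre \<Rightarrow> 'k diff_pre" where
  "twist \<sigma> = free_ext (\<lambda>g. case g of GenU a \<Rightarrow> twist_u \<sigma> a | GenX j a \<Rightarrow> twist_x \<sigma> j a | GenD j a \<Rightarrow> twist_d \<sigma> j a)"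

lemma twist_hom: "unital_ring_hom (twist \<sigma> :: 'k::comm_ring_1 diff_pre \<Rightarrow> 'k diff_pre)"
  unfolding twist_def by (rule unital_ring_hom_free_ext)

lemma twist_gens [simp]:
  "twist \<sigma> (fu a) = twist_u \<sigma> a" "twist \<sigma> (fx j b) = twist_x \<sigma> j b" "twist \<sigma> (fd j b) = twist_d \<sigma> j b"
  "twist \<sigma> (free_const c) = free_const c"
  by (simp_all add: twist_def)

context
  fixes \<sigma> :: "nat \<Rightarrow> nat"
  assumes \<sigma>: "\<sigma> permutes {1..n}"
begin

interpretation twist: unital_ring_hom "twist \<sigma>" by (rule twist_hom)

lemma \<sigma>_bounds [simp]:
  "1 \<le> i \<Longrightarrow> i \<le> n \<Longrightarrow> 1 \<le> \<sigma> i" "1 \<le> i \<Longrightarrow> i \<le> n \<Longrightarrow> \<sigma> i \<le> n"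
  "\<sigma> i = \<sigma> j \<longleftrightarrow> i = j"
  using permutes_bounds[OF \<sigma>] permutes_inject[OF \<sigma>] by simp_all

lemma \<sigma>_bound_Suc [simp]: "Suc 0 \<le> i \<Longrightarrow> i \<le> n \<Longrightarrow> Suc 0 \<le> \<sigma> i"
  using \<sigma>_bounds(1) by simp

lemma perm_closed [simp]:
  "p \<in> U_h n \<Longrightarrow> poly_perm \<sigma> p \<in> U_h n" "s \<in> denoms n \<Longrightarrow> poly_perm \<sigma> s \<in> denoms n"
  using \<sigma> by simp_all

lemma twist_u_frac: "p \<in> U_h n \<Longrightarrow> s \<in> denoms n \<Longrightarrow> twist_u \<sigma> (U_frac n p s) = u (poly_perm \<sigma> p) (poly_perm \<sigma> s)"
  by (simp add: twist_u_def U_map_perm_frac[OF \<sigma>])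

lemma twist_u_zero: "twist_u \<sigma> (U_frac n 0 1) \<doteq> 0"
  using u_zero by (simp add: twist_u_frac perm.hom_simps)

lemma twist_u_one: "twist_u \<sigma> (U_frac n 1 1) \<doteq> 1"
  using u_one by (simp add: twist_u_frac perm.hom_simps)

lemma perm_shift: "poly_perm \<sigma> (poly_shift_by k z p) = poly_shift_by (\<sigma> k) z (poly_perm \<sigma> p)"
  by (rule poly_perm_shift[OF permutes_inj[OF \<sigma>]])

lemma perm_gauge2:
  "poly_perm \<sigma> (gauge2 i j) = poly_shift_by (\<sigma> j) 1 (poly_perm \<sigma> (gauge i)) * poly_perm \<sigma> (gauge j)"
  by (simp add: gauge2_def perm.hom_simps perm_shift)

lemma twist_x_twist_x:
  assumes "i \<in> {1..n}" "j \<in> {1..n}" "a \<in> {1..N}" "b \<in> {1..N}"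
  shows "twist_x \<sigma> i a * twist_x \<sigma> j b \<doteq> fx (\<sigma> i) a * fx (\<sigma> j) b * u (gauge2 (\<sigma> i) (\<sigma> j)) (poly_perm \<sigma> (gauge2 i j))"
proof -
  let ?s = "poly_shift_by (\<sigma> j) 1"
  have "twist_x \<sigma> i a * twist_x \<sigma> j b = fx (\<sigma> i) a * (u (gauge (\<sigma> i)) (poly_perm \<sigma> (gauge i)) * fx (\<sigma> j) b)
      * u (gauge (\<sigma> j)) (poly_perm \<sigma> (gauge j))"
    by (simp add: twist_x_def mult.assoc)
  also have "\<dots> \<doteq> fx (\<sigma> i) a * (fx (\<sigma> j) b * u (?s (gauge (\<sigma> i))) (?s (poly_perm \<sigma> (gauge i))))
      * u (gauge (\<sigma> j)) (poly_perm \<sigma> (gauge j))"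
    using assms by (intro cong_right cong_left u_x) simp_all
  also have "\<dots> = fx (\<sigma> i) a * fx (\<sigma> j) b
      * (u (?s (gauge (\<sigma> i))) (?s (poly_perm \<sigma> (gauge i))) * u (gauge (\<sigma> j)) (poly_perm \<sigma> (gauge j)))"
    by (simp add: mult.assoc)
  also have "\<dots> \<doteq> fx (\<sigma> i) a * fx (\<sigma> j) b * u (gauge2 (\<sigma> i) (\<sigma> j)) (poly_perm \<sigma> (gauge2 i j))"
    unfolding perm_gauge2 unfolding gauge2_def using assms by (intro cong_left u_mult) simp_all
  finally show ?thesis .
qed

lemma twist_d_twist_d:
  assumes "i \<in> {1..n}" "j \<in> {1..n}" "a \<in> {1..N}" "b \<in> {1..N}"
  shows "twist_d \<sigma> i a * twist_d \<sigma> j b \<doteq> u (poly_perm \<sigma> (gauge2 j i)) (gauge2 (\<sigma> j) (\<sigma> i)) * fd (\<sigma> i) a * fd (\<sigma> j) b"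
proof -
  let ?s = "poly_shift_by (\<sigma> i) 1"
  have "twist_d \<sigma> i a * twist_d \<sigma> j b = u (poly_perm \<sigma> (gauge i)) (gauge (\<sigma> i))
      * (fd (\<sigma> i) a * u (poly_perm \<sigma> (gauge j)) (gauge (\<sigma> j))) * fd (\<sigma> j) b"
    by (simp add: twist_d_def mult.assoc)
  also have "\<dots> \<doteq> u (poly_perm \<sigma> (gauge i)) (gauge (\<sigma> i))
      * (u (?s (poly_perm \<sigma> (gauge j))) (?s (gauge (\<sigma> j))) * fd (\<sigma> i) a) * fd (\<sigma> j) b"
    using assms by (intro cong_right cong_left d_u) simp_all
  also have "\<dots> = u (poly_perm \<sigma> (gauge i)) (gauge (\<sigma> i)) * u (?s (poly_perm \<sigma> (gauge j))) (?s (gauge (\<sigma> j)))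
      * fd (\<sigma> i) a * fd (\<sigma> j) b"
    by (simp add: mult.assoc)
  also have "\<dots> \<doteq> u (poly_perm \<sigma> (gauge2 j i)) (gauge2 (\<sigma> j) (\<sigma> i)) * fd (\<sigma> i) a * fd (\<sigma> j) b"
    unfolding perm_gauge2 unfolding gauge2_def
    using assms u_mult[of "poly_perm \<sigma> (gauge i)" "gauge (\<sigma> i)" "?s (poly_perm \<sigma> (gauge j))" "?s (gauge (\<sigma> j))"]
    by (intro cong_right) (simp add: mult.commute)
  finally show ?thesis .
qed

text \<open>The form in which the key identity enters all three relations with \<open>i \<noteq> j\<close>. They need it with its
  factors distributed differently over the two fractions, so only the cross products are prescribed.\<close>

lemma swap_frac_eq:
  fixes p q s t :: "'k::comm_ring_1 mpoly"
  assumes ij: "i \<in> {1..n}" "j \<in> {1..n}" "i \<noteq> j"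
    and mem: "p \<in> U_h n" "q \<in> U_h n" "s \<in> denoms n" "t \<in> denoms n"
    and p: "p * t = swap_num (\<sigma> i) (\<sigma> j) * gauge2 (\<sigma> i) (\<sigma> j) * poly_perm \<sigma> (swap_den i j) * poly_perm \<sigma> (gauge2 j i)"
    and q: "q * s = poly_perm \<sigma> (swap_num i j) * poly_perm \<sigma> (gauge2 i j) * swap_den (\<sigma> i) (\<sigma> j) * gauge2 (\<sigma> j) (\<sigma> i)"
  shows "U_frac n p s = U_frac n q t"
proof -
  obtain v :: "'k mpoly" where "v \<in> denoms n" "v * (p * t) = v * (q * s)"
    unfolding p q using swap_gauge_perm[OF \<sigma> ij] by blast
  then show ?thesis by (intro U.loc_frac_eqI mem)
qed

text \<open>The entries depend on \<open>h\<^sub>i - h\<^sub>j\<close> only. With \<open>z = 1\<close> this lets them commute with \<open>x\<^sup>i x\<^sup>j\<close>.\<close>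

lemma shift_swap:
  "poly_shift_by i z (poly_shift_by j z (swap_num i j)) = swap_num i j"
  "poly_shift_by i z (poly_shift_by j z (swap_den i j)) = swap_den i j"
  by (simp_all add: swap_num_def swap_den_def shift.hom_simps)

text \<open>Both sides are multiples of \<open>x\<^bsup>\<sigma>i\<^esup> x\<^bsup>\<sigma>j\<^esup>\<close> and \<open>x\<^bsup>\<sigma>j\<^esup> x\<^bsup>\<sigma>i\<^esup>\<close>. The first term of the relation keeps the order of
  the indices, hence carries the same weight \<open>C\<close> as the left-hand side; in the second term the weight
  changes from \<open>C\<close> to \<open>C'\<close>, which compensates the change of the coefficient.\<close>

lemma twist_x_swap:
  assumes ij: "i \<in> {1..n}" "j \<in> {1..n}" and ab: "a \<in> {1..N}" "b \<in> {1..N}" and ne: "i \<noteq> j"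
  shows "twist_x \<sigma> i a * twist_x \<sigma> j b \<doteq> twist_u \<sigma> (U_frac n 1 (hdiff i j)) * twist_x \<sigma> i b * twist_x \<sigma> j a
    + twist_u \<sigma> (U_frac n (swap_num i j) (swap_den i j)) * twist_x \<sigma> j b * twist_x \<sigma> i a"
    (is "?lhs \<doteq> ?r1 + ?r2")
proof -
  define i' j' where "i' = \<sigma> i" and "j' = \<sigma> j"
  have ij': "i' \<in> {1..n}" "j' \<in> {1..n}" "i' \<noteq> j'"
    using ij ne by (simp_all add: i'_def j'_def)
  define C C' :: "'a diff_pre" where "C = u (gauge2 i' j') (poly_perm \<sigma> (gauge2 i j))"
    and "C' = u (gauge2 j' i') (poly_perm \<sigma> (gauge2 j i))"
  have C: "twist_x \<sigma> i a * twist_x \<sigma> j b \<doteq> fx i' a * fx j' b * C" if "a \<in> {1..N}" "b \<in> {1..N}" for a b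
    using twist_x_twist_x[OF ij that] by (simp add: C_def i'_def j'_def)
  have C': "twist_x \<sigma> j b * twist_x \<sigma> i a \<doteq> fx j' b * fx i' a * C'"
    using twist_x_twist_x[OF ij(2,1) ab(2,1)] by (simp add: C'_def i'_def j'_def)
  have 1: "u 1 (hdiff i' j') * fx i' b * fx j' a * C \<doteq> ?r1"
  proof -
    have "?r1 = u 1 (hdiff i' j') * (twist_x \<sigma> i b * twist_x \<sigma> j a)"
      using ij ne by (simp add: twist_u_frac perm.hom_simps i'_def j'_def mult.assoc)
    also have "\<dots> \<doteq> u 1 (hdiff i' j') * (fx i' b * fx j' a * C)" by (intro cong_left C ab)
    finally show ?thesis by (simp add: mult.assoc ideal_cong_sym)
  qed
  let ?n = "swap_num i' j'" and ?d = "swap_den i' j'"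
  let ?n' = "poly_perm \<sigma> (swap_num i j)" and ?d' = "poly_perm \<sigma> (swap_den i j)"
  have inv: "poly_shift_by i' 1 (poly_shift_by j' 1 ?n') = ?n'" "poly_shift_by i' 1 (poly_shift_by j' 1 ?d') = ?d'"
    by (simp_all add: shift_swap i'_def j'_def flip: perm_shift)
  have "u ?n ?d * fx j' b * fx i' a * C \<doteq> fx j' b * fx i' a * u ?n ?d * C"
    using u_x_x[OF ij'(2,1) ab(2,1), of ?n ?d] ij' by (intro cong_right) (simp add: shift_swap)
  also have "\<dots> = fx j' b * fx i' a * (u ?n ?d * C)" by (simp add: mult.assoc)
  also have "\<dots> \<doteq> fx j' b * fx i' a * u (?n * gauge2 i' j') (?d * poly_perm \<sigma> (gauge2 i j))"
    unfolding C_def using ij' ij by (intro cong_left u_mult) simp_all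
  also have "U_frac n (?n * gauge2 i' j') (?d * poly_perm \<sigma> (gauge2 i j))
      = U_frac n (?n' * gauge2 j' i') (?d' * poly_perm \<sigma> (gauge2 j i))"
    by (rule swap_frac_eq[OF ij ne]) (use ij ij' in \<open>simp_all add: mult_ac flip: i'_def j'_def\<close>)
  also have "fx j' b * fx i' a * u (?n' * gauge2 j' i') (?d' * poly_perm \<sigma> (gauge2 j i))
      \<doteq> fx j' b * fx i' a * (u ?n' ?d' * C')"
    unfolding C'_def using ij' ij by (intro cong_left ideal_cong_sym[OF u_mult]) simp_all
  also have "\<dots> = fx j' b * fx i' a * u ?n' ?d' * C'" by (simp add: mult.assoc)
  also have "\<dots> \<doteq> u ?n' ?d' * fx j' b * fx i' a * C'"
    using ideal_cong_sym[OF u_x_x[OF ij'(2,1) ab(2,1), of ?n' ?d']] ij by (intro cong_right) (simp add: inv)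
  also have "\<dots> = u ?n' ?d' * (fx j' b * fx i' a * C')" by (simp add: mult.assoc)
  also have "\<dots> \<doteq> u ?n' ?d' * (twist_x \<sigma> j b * twist_x \<sigma> i a)" by (intro cong_left ideal_cong_sym[OF C'])
  also have "\<dots> = ?r2" using ij by (simp add: twist_u_frac mult.assoc)
  finally have 2: "u ?n ?d * fx j' b * fx i' a * C \<doteq> ?r2" .
  have "?lhs \<doteq> fx i' a * fx j' b * C" by (rule C[OF ab])
  also have "\<dots> \<doteq> (u 1 (hdiff i' j') * fx i' b * fx j' a + u ?n ?d * fx j' b * fx i' a) * C"
    by (intro cong_right x_swap ij' ab)
  also have "\<dots> = u 1 (hdiff i' j') * fx i' b * fx j' a * C + u ?n ?d * fx j' b * fx i' a * C"
    by (rule distrib_right)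
  also have "\<dots> \<doteq> ?r1 + ?r2" by (rule ideal_cong_add[OF 1 2])
  finally show ?thesis .
qed

lemma twist_x_same:
  assumes "i \<in> {1..n}" "a \<in> {1..N}" "b \<in> {1..N}"
  shows "twist_x \<sigma> i a * twist_x \<sigma> i b \<doteq> twist_x \<sigma> i b * twist_x \<sigma> i a"
proof -
  let ?C = "u (gauge2 (\<sigma> i) (\<sigma> i)) (poly_perm \<sigma> (gauge2 i i))"
  have "twist_x \<sigma> i a * twist_x \<sigma> i b \<doteq> fx (\<sigma> i) a * fx (\<sigma> i) b * ?C" by (rule twist_x_twist_x[OF assms(1,1,2,3)])
  also have "\<dots> \<doteq> fx (\<sigma> i) b * fx (\<sigma> i) a * ?C" using assms by (intro cong_right x_same) simp_all
  also have "\<dots> \<doteq> twist_x \<sigma> i b * twist_x \<sigma> i a" by (rule ideal_cong_sym[OF twist_x_twist_x[OF assms(1,1,3,2)]])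
  finally show ?thesis .
qed

lemma twist_d_same:
  assumes "i \<in> {1..n}" "a \<in> {1..N}" "b \<in> {1..N}"
  shows "twist_d \<sigma> i a * twist_d \<sigma> i b \<doteq> twist_d \<sigma> i b * twist_d \<sigma> i a"
proof -
  let ?C = "u (poly_perm \<sigma> (gauge2 i i)) (gauge2 (\<sigma> i) (\<sigma> i))"
  have "twist_d \<sigma> i a * twist_d \<sigma> i b \<doteq> ?C * fd (\<sigma> i) a * fd (\<sigma> i) b" by (rule twist_d_twist_d[OF assms(1,1,2,3)])
  also have "\<dots> = ?C * (fd (\<sigma> i) a * fd (\<sigma> i) b)" by (rule mult.assoc)
  also have "\<dots> \<doteq> ?C * (fd (\<sigma> i) b * fd (\<sigma> i) a)" using assms by (intro cong_left d_same) simp_all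
  also have "\<dots> = ?C * fd (\<sigma> i) b * fd (\<sigma> i) a" by (simp add: mult.assoc)
  also have "\<dots> \<doteq> twist_d \<sigma> i b * twist_d \<sigma> i a" by (rule ideal_cong_sym[OF twist_d_twist_d[OF assms(1,1,3,2)]])
  finally show ?thesis .
qed

text \<open>The same argument with the weights inverted and on the left, where they meet the coefficients
  without having to be moved.\<close>

lemma twist_d_swap:
  assumes ij: "i \<in> {1..n}" "j \<in> {1..n}" and ab: "a \<in> {1..N}" "b \<in> {1..N}" and ne: "i \<noteq> j"
  shows "twist_d \<sigma> i a * twist_d \<sigma> j b \<doteq> twist_u \<sigma> (U_frac n 1 (hdiff j i)) * twist_d \<sigma> i b * twist_d \<sigma> j a
    + twist_u \<sigma> (U_frac n (swap_num i j) (swap_den i j)) * twist_d \<sigma> j b * twist_d \<sigma> i a"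
    (is "?lhs \<doteq> ?r1 + ?r2")
proof -
  define i' j' where "i' = \<sigma> i" and "j' = \<sigma> j"
  have ij': "i' \<in> {1..n}" "j' \<in> {1..n}" "i' \<noteq> j'"
    using ij ne by (simp_all add: i'_def j'_def)
  define K K' :: "'a diff_pre" where "K = u (poly_perm \<sigma> (gauge2 j i)) (gauge2 j' i')"
    and "K' = u (poly_perm \<sigma> (gauge2 i j)) (gauge2 i' j')"
  have K: "twist_d \<sigma> i a * twist_d \<sigma> j b \<doteq> K * (fd i' a * fd j' b)" if "a \<in> {1..N}" "b \<in> {1..N}" for a b
    using twist_d_twist_d[OF ij that] by (simp add: K_def i'_def j'_def mult.assoc)
  have K': "twist_d \<sigma> j b * twist_d \<sigma> i a \<doteq> K' * (fd j' b * fd i' a)"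
    using twist_d_twist_d[OF ij(2,1) ab(2,1)] by (simp add: K'_def i'_def j'_def mult.assoc)
  let ?n = "swap_num i' j'" and ?d = "swap_den i' j'"
  let ?n' = "poly_perm \<sigma> (swap_num i j)" and ?d' = "poly_perm \<sigma> (swap_den i j)"
  have 1: "K * (u 1 (hdiff j' i') * fd i' b * fd j' a) \<doteq> ?r1"
  proof -
    have "K * (u 1 (hdiff j' i') * fd i' b * fd j' a) = K * u 1 (hdiff j' i') * (fd i' b * fd j' a)"
      by (simp add: mult.assoc)
    also have "\<dots> \<doteq> u 1 (hdiff j' i') * K * (fd i' b * fd j' a)"
      unfolding K_def using ij ij' by (intro cong_right u_commute) simp_all
    also have "\<dots> = u 1 (hdiff j' i') * (K * (fd i' b * fd j' a))" by (simp add: mult.assoc)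
    also have "\<dots> \<doteq> u 1 (hdiff j' i') * (twist_d \<sigma> i b * twist_d \<sigma> j a)"
      by (intro cong_left ideal_cong_sym[OF K] ab)
    also have "\<dots> = ?r1"
      using ij ne by (simp add: twist_u_frac perm.hom_simps i'_def j'_def mult.assoc)
    finally show ?thesis .
  qed
  have 2: "K * (u ?n ?d * fd j' b * fd i' a) \<doteq> ?r2"
  proof -
    have "K * (u ?n ?d * fd j' b * fd i' a) = K * u ?n ?d * (fd j' b * fd i' a)"
      by (simp add: mult.assoc)
    also have "\<dots> \<doteq> u (poly_perm \<sigma> (gauge2 j i) * ?n) (gauge2 j' i' * ?d) * (fd j' b * fd i' a)"
      unfolding K_def using ij ij' by (intro cong_right u_mult) simp_all
    also have "U_frac n (poly_perm \<sigma> (gauge2 j i) * ?n) (gauge2 j' i' * ?d)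
        = U_frac n (?n' * poly_perm \<sigma> (gauge2 i j)) (?d' * gauge2 i' j')"
      by (rule swap_frac_eq[OF ij ne]) (use ij ij' in \<open>simp_all add: mult_ac flip: i'_def j'_def\<close>)
    also have "u (?n' * poly_perm \<sigma> (gauge2 i j)) (?d' * gauge2 i' j') * (fd j' b * fd i' a)
        \<doteq> u ?n' ?d' * K' * (fd j' b * fd i' a)"
      unfolding K'_def using ij ij' by (intro cong_right ideal_cong_sym[OF u_mult]) simp_all
    also have "\<dots> = u ?n' ?d' * (K' * (fd j' b * fd i' a))" by (rule mult.assoc)
    also have "\<dots> \<doteq> u ?n' ?d' * (twist_d \<sigma> j b * twist_d \<sigma> i a)" by (intro cong_left ideal_cong_sym[OF K'])
    also have "\<dots> = ?r2" using ij by (simp add: twist_u_frac mult.assoc)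
    finally show ?thesis .
  qed
  have "?lhs \<doteq> K * (fd i' a * fd j' b)" by (rule K[OF ab])
  also have "\<dots> \<doteq> K * (u 1 (hdiff j' i') * fd i' b * fd j' a + u ?n ?d * fd j' b * fd i' a)"
    by (intro cong_left d_swap ij' ab)
  also have "\<dots> = K * (u 1 (hdiff j' i') * fd i' b * fd j' a) + K * (u ?n ?d * fd j' b * fd i' a)"
    by (rule distrib_left)
  also have "\<dots> \<doteq> ?r1 + ?r2" by (rule ideal_cong_add[OF 1 2])
  finally show ?thesis .
qed

lemma twist_d_twist_x:
  assumes "i \<in> {1..n}" "j \<in> {1..n}" "a \<in> {1..N}" "b \<in> {1..N}"
  shows "twist_d \<sigma> j b * twist_x \<sigma> i a \<doteq>
    u (poly_perm \<sigma> (gauge j) * poly_shift_by (\<sigma> j) 1 (poly_shift_by (\<sigma> i) (-1) (gauge (\<sigma> i))))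
      (gauge (\<sigma> j) * poly_shift_by (\<sigma> j) 1 (poly_shift_by (\<sigma> i) (-1) (poly_perm \<sigma> (gauge i))))
    * fd (\<sigma> j) b * fx (\<sigma> i) a"
proof -
  let ?s = "\<lambda>p. poly_shift_by (\<sigma> j) 1 (poly_shift_by (\<sigma> i) (-1) p)"
  have "twist_d \<sigma> j b * twist_x \<sigma> i a = u (poly_perm \<sigma> (gauge j)) (gauge (\<sigma> j))
      * (fd (\<sigma> j) b * fx (\<sigma> i) a * u (gauge (\<sigma> i)) (poly_perm \<sigma> (gauge i)))"
    by (simp add: twist_d_def twist_x_def mult.assoc)
  also have "\<dots> \<doteq> u (poly_perm \<sigma> (gauge j)) (gauge (\<sigma> j))
      * (u (?s (gauge (\<sigma> i))) (?s (poly_perm \<sigma> (gauge i))) * fd (\<sigma> j) b * fx (\<sigma> i) a)"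
    using assms by (intro cong_left d_x_u) simp_all
  also have "\<dots> = u (poly_perm \<sigma> (gauge j)) (gauge (\<sigma> j))
      * u (?s (gauge (\<sigma> i))) (?s (poly_perm \<sigma> (gauge i))) * fd (\<sigma> j) b * fx (\<sigma> i) a"
    by (simp add: mult.assoc)
  also have "\<dots> \<doteq> u (poly_perm \<sigma> (gauge j) * ?s (gauge (\<sigma> i)))
      (gauge (\<sigma> j) * ?s (poly_perm \<sigma> (gauge i))) * fd (\<sigma> j) b * fx (\<sigma> i) a"
    using assms by (intro cong_right u_mult) simp_all
  finally show ?thesis .
qed

lemma twist_x_twist_d:
  assumes "i \<in> {1..n}" "j \<in> {1..n}" "a \<in> {1..N}" "b \<in> {1..N}"
  shows "twist_x \<sigma> i a * twist_d \<sigma> j b \<doteq>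
    fx (\<sigma> i) a * u (gauge (\<sigma> i) * poly_perm \<sigma> (gauge j)) (poly_perm \<sigma> (gauge i) * gauge (\<sigma> j)) * fd (\<sigma> j) b"
proof -
  have "twist_x \<sigma> i a * twist_d \<sigma> j b = fx (\<sigma> i) a * (u (gauge (\<sigma> i)) (poly_perm \<sigma> (gauge i))
      * u (poly_perm \<sigma> (gauge j)) (gauge (\<sigma> j))) * fd (\<sigma> j) b"
    by (simp add: twist_d_def twist_x_def mult.assoc)
  also have "\<dots> \<doteq> fx (\<sigma> i) a * u (gauge (\<sigma> i) * poly_perm \<sigma> (gauge j)) (poly_perm \<sigma> (gauge i) * gauge (\<sigma> j)) * fd (\<sigma> j) b"
    using assms by (intro cong_right cong_left u_mult) simp_all
  finally show ?thesis .
qed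

text \<open>The weight in the middle of \<open>x\<^bsup>\<sigma>i\<^esup> \<partial>\<^bsub>\<sigma>j\<^esub>\<close> has to be moved out to the left before the relation applies, which
  shifts it by \<open>-\<epsilon>\<^bsub>\<sigma>i\<^esub>\<close>. The resulting equality of fractions is the image under this shift of an equality
  between products of gauge factors.\<close>

lemma twist_x_twist_d_swap:
  assumes ij: "i \<in> {1..n}" "j \<in> {1..n}" and ab: "a \<in> {1..N}" "b \<in> {1..N}" and ne: "i \<noteq> j"
  shows "twist_x \<sigma> i a * twist_d \<sigma> j b
    \<doteq> twist_u \<sigma> (U_frac n (poly_shift_by j 1 (swap_num j i)) (poly_shift_by j 1 (swap_den j i))) * twist_d \<sigma> j b * twist_x \<sigma> i a"
    (is "?lhs \<doteq> ?rhs")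
proof -
  define i' j' where "i' = \<sigma> i" and "j' = \<sigma> j"
  have ij': "i' \<in> {1..n}" "j' \<in> {1..n}" "i' \<noteq> j'" "j' \<noteq> i'"
    using ij ne by (simp_all add: i'_def j'_def)
  define gi gj where "gi = poly_perm \<sigma> (gauge i :: 'a mpoly)" and "gj = poly_perm \<sigma> (gauge j :: 'a mpoly)"
  let ?n = "swap_num j' i' :: 'a mpoly" and ?d = "swap_den j' i' :: 'a mpoly"
  let ?n' = "poly_perm \<sigma> (swap_num j i) :: 'a mpoly" and ?d' = "poly_perm \<sigma> (swap_den j i) :: 'a mpoly"
  let ?m = "poly_shift_by i' (-1) :: 'a mpoly \<Rightarrow> 'a mpoly" and ?p = "poly_shift_by j' 1 :: 'a mpoly \<Rightarrow> 'a mpoly"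
    and ?q = "poly_shift_by i' 1 :: 'a mpoly \<Rightarrow> 'a mpoly"
  have mem: "gi \<in> denoms n" "gj \<in> denoms n" "gi \<in> U_h n" "gj \<in> U_h n"
    "?n \<in> U_h n" "?d \<in> denoms n" "?n' \<in> U_h n" "?d' \<in> denoms n"
    "gauge i' \<in> (denoms n :: 'a mpoly set)" "gauge j' \<in> (denoms n :: 'a mpoly set)"
    "gauge i' \<in> (U_h n :: 'a mpoly set)" "gauge j' \<in> (U_h n :: 'a mpoly set)"
    using ij ij' by (simp_all add: gi_def gj_def)
  \<comment> \<open>The required equality of coefficients, shifted by \<open>\<epsilon>\<^bsub>\<sigma>i\<^esub>\<close>: it is the key identity for \<open>j, i\<close>.\<close>
  have eq: "U_frac n (?n * (gauge i' * gj)) (?d * (gi * gauge j'))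
      = U_frac n (?n' * (?q gj * ?p (gauge i'))) (?d' * (?q (gauge j') * ?p gi))"
  proof (rule swap_frac_eq[OF ij(2,1) ne[symmetric]])
    show "?n * (gauge i' * gj) * (?d' * (?q (gauge j') * ?p gi)) = swap_num (\<sigma> j) (\<sigma> i) * gauge2 (\<sigma> j) (\<sigma> i)
        * poly_perm \<sigma> (swap_den j i) * poly_perm \<sigma> (gauge2 i j)"
      unfolding perm_gauge2 i'_def j'_def gi_def gj_def unfolding gauge2_def by (simp add: mult_ac)
    show "?n' * (?q gj * ?p (gauge i')) * (?d * (gi * gauge j')) = poly_perm \<sigma> (swap_num j i)
        * poly_perm \<sigma> (gauge2 j i) * swap_den (\<sigma> j) (\<sigma> i) * gauge2 (\<sigma> i) (\<sigma> j)"
      unfolding perm_gauge2 i'_def j'_def gi_def gj_def unfolding gauge2_def by (simp add: mult_ac)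
  qed (simp_all add: mem)
  have inv: "?m (?q p) = p" for p :: "'a mpoly" by (rule poly_shift_by_inverse) simp
  have "?p ?n = ?m (?q (?p ?n))" "?p ?d = ?m (?q (?p ?d))" by (simp_all only: inv)
  moreover have "?q (?p ?n) = ?n" "?q (?p ?d) = ?d"
    by (simp_all add: shift_swap poly_shift_by_commute[of i' 1 j'])
  ultimately have shift_n: "?p ?n = ?m ?n" "?p ?d = ?m ?d" by simp_all
  \<comment> \<open>As the entries depend on a difference only, the opposite shift of the other variable has the same effect.\<close>
  have shift_n': "?m ?n' = ?p ?n'" "?m ?d' = ?p ?d'"
  proof -
    have "?q (?p ?n') = ?n'" "?q (?p ?d') = ?d'"
      by (simp_all add: shift_swap poly_shift_by_commute[of i 1 j] i'_def j'_def flip: perm_shift)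
    then show "?m ?n' = ?p ?n'" "?m ?d' = ?p ?d'" by (metis inv)+
  qed
  have "U_map n ?m (U_frac n (?n * (gauge i' * gj)) (?d * (gi * gauge j')))
      = U_map n ?m (U_frac n (?n' * (?q gj * ?p (gauge i'))) (?d' * (?q (gauge j') * ?p gi)))"
    by (simp only: eq)
  then have eq': "U_frac n (?m (gauge i' * gj) * ?p ?n) (?m (gi * gauge j') * ?p ?d)
      = U_frac n (?p ?n' * (gj * ?p (?m (gauge i')))) (?p ?d' * (gauge j' * ?p (?m gi)))"
    by (simp add: mem U_map_shift_frac shift.hom_mult shift_n shift_n' inv mult_ac
        poly_shift_by_commute[of i' "-1" j'])
  have "?lhs \<doteq> fx i' a * u (gauge i' * gj) (gi * gauge j') * fd j' b"
    using twist_x_twist_d[OF ij ab] by (simp add: i'_def j'_def gi_def gj_def)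
  also have "\<dots> \<doteq> u (?m (gauge i' * gj)) (?m (gi * gauge j')) * fx i' a * fd j' b"
    using mem by (intro cong_right x_u ij' ab) simp_all
  also have "\<dots> = u (?m (gauge i' * gj)) (?m (gi * gauge j')) * (fx i' a * fd j' b)" by (rule mult.assoc)
  also have "\<dots> \<doteq> u (?m (gauge i' * gj)) (?m (gi * gauge j')) * (u (?p ?n) (?p ?d) * fd j' b * fx i' a)"
    by (intro cong_left x_d_swap ij' ab)
  also have "\<dots> = u (?m (gauge i' * gj)) (?m (gi * gauge j')) * u (?p ?n) (?p ?d) * fd j' b * fx i' a"
    by (simp add: mult.assoc)
  also have "\<dots> \<doteq> u (?m (gauge i' * gj) * ?p ?n) (?m (gi * gauge j') * ?p ?d) * fd j' b * fx i' a"
    using mem by (intro cong_right u_mult) simp_all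
  also have "U_frac n (?m (gauge i' * gj) * ?p ?n) (?m (gi * gauge j') * ?p ?d)
      = U_frac n (?p ?n' * (gj * ?p (?m (gauge i')))) (?p ?d' * (gauge j' * ?p (?m gi)))" by (rule eq')
  also have "u (?p ?n' * (gj * ?p (?m (gauge i')))) (?p ?d' * (gauge j' * ?p (?m gi))) * fd j' b * fx i' a
      \<doteq> u (?p ?n') (?p ?d') * u (gj * ?p (?m (gauge i'))) (gauge j' * ?p (?m gi)) * fd j' b * fx i' a"
    using mem by (intro cong_right ideal_cong_sym[OF u_mult]) simp_all
  also have "\<dots> = u (?p ?n') (?p ?d') * (u (gj * ?p (?m (gauge i'))) (gauge j' * ?p (?m gi)) * fd j' b * fx i' a)"
    by (simp add: mult.assoc)
  also have "\<dots> \<doteq> u (?p ?n') (?p ?d') * (twist_d \<sigma> j b * twist_x \<sigma> i a)"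
    using ideal_cong_sym[OF twist_d_twist_x[OF ij ab]] by (intro cong_left) (simp add: i'_def j'_def gi_def gj_def)
  also have "\<dots> = ?rhs"
    using ij by (simp add: twist_u_frac perm_shift j'_def mult.assoc)
  finally show ?thesis .
qed

text \<open>The weights cancel: in the middle of \<open>x\<^bsup>\<sigma>i\<^esup> \<partial>\<^bsub>\<sigma>i\<^esub>\<close>, where they meet, and around each \<open>\<partial>\<^bsub>\<sigma>k\<^esub> x\<^bsup>\<sigma>k\<^esup>\<close>,
  since this commutes with all coefficients. What remains is the relation for \<open>\<sigma> i\<close> with
  its sum reindexed by \<open>\<sigma>\<close>.\<close>

lemma twist_x_twist_d_same:
  assumes i: "i \<in> {1..n}" and ab: "a \<in> {1..N}" "b \<in> {1..N}"
  shows "twist_x \<sigma> i a * twist_d \<sigma> i b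
    \<doteq> (\<Sum>k\<in>{1..n}. twist_u \<sigma> (U_frac n 1 (hdiff k i + 1)) * twist_d \<sigma> k b * twist_x \<sigma> k a) - (if a = b then 1 else 0)"
proof -
  have unit: "u p p \<doteq> 1" if "p \<in> denoms n" for p by (rule u_self[OF that])
  have dx: "twist_d \<sigma> k b * twist_x \<sigma> k a \<doteq> fd (\<sigma> k) b * fx (\<sigma> k) a" if k: "k \<in> {1..n}" for k
  proof -
    have "twist_d \<sigma> k b * twist_x \<sigma> k a \<doteq> u (gauge (\<sigma> k) * poly_perm \<sigma> (gauge k)) (gauge (\<sigma> k) * poly_perm \<sigma> (gauge k))
        * fd (\<sigma> k) b * fx (\<sigma> k) a"
      using twist_d_twist_x[OF k k ab] by (simp add: poly_shift_by_inverse mult.commute)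
    also have "\<dots> \<doteq> 1 * fd (\<sigma> k) b * fx (\<sigma> k) a" using k by (intro cong_right unit) simp
    finally show ?thesis by simp
  qed
  have "twist_x \<sigma> i a * twist_d \<sigma> i b
      \<doteq> fx (\<sigma> i) a * u (gauge (\<sigma> i) * poly_perm \<sigma> (gauge i)) (gauge (\<sigma> i) * poly_perm \<sigma> (gauge i)) * fd (\<sigma> i) b"
    using twist_x_twist_d[OF i i ab] by (simp add: mult.commute)
  also have "\<dots> \<doteq> fx (\<sigma> i) a * 1 * fd (\<sigma> i) b" using i by (intro cong_right cong_left unit) simp
  also have "\<dots> = fx (\<sigma> i) a * fd (\<sigma> i) b" by simp
  also have "\<dots> \<doteq> (\<Sum>k\<in>{1..n}. u 1 (hdiff k (\<sigma> i) + 1) * fd k b * fx k a) - (if a = b then 1 else 0)"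
    using i by (intro x_d_same ab) simp
  also have "(\<Sum>k\<in>{1..n}. u 1 (hdiff k (\<sigma> i) + 1) * fd k b * fx k a)
      = (\<Sum>k\<in>{1..n}. u 1 (hdiff (\<sigma> k) (\<sigma> i) + 1) * fd (\<sigma> k) b * fx (\<sigma> k) a :: 'a diff_pre)"
    by (rule sum.permute[OF \<sigma>, unfolded comp_def])
  also have "\<dots> - (if a = b then 1 else 0)
      \<doteq> (\<Sum>k\<in>{1..n}. twist_u \<sigma> (U_frac n 1 (hdiff k i + 1)) * twist_d \<sigma> k b * twist_x \<sigma> k a) - (if a = b then 1 else 0)"
  proof (intro ideal_cong_diff ideal_cong_sum ideal_cong_refl)
    fix k assume k: "k \<in> {1..n}"
    have den: "hdiff k i + 1 \<in> (denoms n :: 'a mpoly set)" using k i by (cases "k = i") simp_all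
    have "u 1 (hdiff (\<sigma> k) (\<sigma> i) + 1) * fd (\<sigma> k) b * fx (\<sigma> k) a
        = (u 1 (hdiff (\<sigma> k) (\<sigma> i) + 1) * (fd (\<sigma> k) b * fx (\<sigma> k) a) :: 'a diff_pre)" by (rule mult.assoc)
    also have "\<dots> \<doteq> u 1 (hdiff (\<sigma> k) (\<sigma> i) + 1) * (twist_d \<sigma> k b * twist_x \<sigma> k a)"
      by (intro cong_left ideal_cong_sym[OF dx] k)
    also have "\<dots> = twist_u \<sigma> (U_frac n 1 (hdiff k i + 1)) * twist_d \<sigma> k b * twist_x \<sigma> k a"
      using den by (simp add: twist_u_frac perm.hom_simps mult.assoc)
    finally show "u 1 (hdiff (\<sigma> k) (\<sigma> i) + 1) * fd (\<sigma> k) b * fx (\<sigma> k) a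
        \<doteq> (twist_u \<sigma> (U_frac n 1 (hdiff k i + 1)) * twist_d \<sigma> k b * twist_x \<sigma> k a :: 'a diff_pre)" .
  qed
  finally show ?thesis .
qed

end

end

section \<open>Permutations act on \<open>Diff\<^sub>h(n,N)\<close>\<close>

context diff_presentation
begin

abbreviation free :: "'k::comm_ring_1 diff_pre set" where
  "free \<equiv> carrier (free_algebra (diff_gens n N))"

lemma fu_closed [simp]: "a \<in> carrier (U_loc n) \<Longrightarrow> fu a \<in> free"
  and fx_closed [simp]: "1 \<le> j \<Longrightarrow> j \<le> n \<Longrightarrow> 1 \<le> b \<Longrightarrow> b \<le> N \<Longrightarrow> fx j b \<in> free"
  and fd_closed [simp]: "1 \<le> j \<Longrightarrow> j \<le> n \<Longrightarrow> 1 \<le> b \<Longrightarrow> b \<le> N \<Longrightarrow> fd j b \<in> free"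
  by (auto intro!: free_gen_closed simp: diff_gens_def)

lemma Rhat_closed [simp]:
  assumes "1 \<le> i" "i \<le> n" "1 \<le> j" "j \<le> n"
  shows "Rhat n i j k l \<in> carrier (U_loc n)"
  using assms by (simp add: Rhat_def)

lemma U_shift_closed [simp]:
  assumes "a \<in> carrier (U_loc n)"
  shows "U_shift n k a \<in> carrier (U_loc n)"
proof -
  obtain p s where "a = U_frac n p s" "p \<in> U_h n" "s \<in> denoms n"
    using assms by (auto simp: carrier_U_loc)
  then show ?thesis by (simp add: U_shift_eq U_map_shift_frac)
qed

lemma U_loc_closed:
  assumes "a \<in> carrier (U_loc n)" "b \<in> carrier (U_loc n)"
  shows "a \<oplus>\<^bsub>U_loc n\<^esub> b \<in> carrier (U_loc n)" "a \<otimes>\<^bsub>U_loc n\<^esub> b \<in> carrier (U_loc n)"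
proof -
  obtain p s q t where "a = U_frac n p s" "p \<in> U_h n" "s \<in> denoms n" "b = U_frac n q t" "q \<in> U_h n" "t \<in> denoms n"
    using assms by (auto simp: carrier_U_loc)
  then show "a \<oplus>\<^bsub>U_loc n\<^esub> b \<in> carrier (U_loc n)" "a \<otimes>\<^bsub>U_loc n\<^esub> b \<in> carrier (U_loc n)"
    by (simp_all add: U_frac_add U_frac_mult denoms_subset_U_h)
qed

lemma diff_rels_cases:
  fixes r :: "'k::comm_ring_1 diff_pre"
  assumes "r \<in> diff_rels n N"
  obtains
    (add) a b where "r = fu (a \<oplus>\<^bsub>U_loc n\<^esub> b) - (fu a + fu b)" "a \<in> carrier (U_loc n)" "b \<in> carrier (U_loc n)"
  | (mult) a b where "r = fu (a \<otimes>\<^bsub>U_loc n\<^esub> b) - fu a * fu b" "a \<in> carrier (U_loc n)" "b \<in> carrier (U_loc n)"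
  | (const) c where "r = u (polyconst c) 1 - free_const c"
  | (hx) i j a where "r = fh n i * fx j a - fx j a * (fh n i + (if i = j then 1 else 0))"
      "i \<in> {1..n}" "j \<in> {1..n}" "a \<in> {1..N}"
  | (hd) i j a where "r = fh n i * fd j a - fd j a * (fh n i - (if i = j then 1 else 0))"
      "i \<in> {1..n}" "j \<in> {1..n}" "a \<in> {1..N}"
  | (xx) i j a b where "r = fx i a * fx j b - (\<Sum>k\<in>{1..n}. \<Sum>l\<in>{1..n}. fu (Rhat n i j k l) * fx k b * fx l a)"
      "i \<in> {1..n}" "j \<in> {1..n}" "a \<in> {1..N}" "b \<in> {1..N}"
  | (dd) i j a b where "r = fd i a * fd j b - (\<Sum>k\<in>{1..n}. \<Sum>l\<in>{1..n}. fu (Rhat n l k j i) * fd k b * fd l a)"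
      "i \<in> {1..n}" "j \<in> {1..n}" "a \<in> {1..N}" "b \<in> {1..N}"
  | (xd) i j a b where "r = fx i a * fd j b
        - ((\<Sum>k\<in>{1..n}. \<Sum>l\<in>{1..n}. fu (U_shift n k (Rhat n k i l j)) * fd k b * fx l a)
           - (if a = b \<and> i = j then 1 else 0))"
      "i \<in> {1..n}" "j \<in> {1..n}" "a \<in> {1..N}" "b \<in> {1..N}"
  using assms unfolding diff_rels_def Un_iff mem_Collect_eq by (elim disjE exE conjE) (fast+)

lemma relations_closed: "(diff_rels n N :: 'k::comm_ring_1 diff_pre set) \<subseteq> free"
proof
  fix r :: "'k diff_pre" assume "r \<in> diff_rels n N"
  then show "r \<in> free"
  proof (cases rule: diff_rels_cases)
    case add
    then show ?thesis by (simp add: U_loc_closed)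
  next
    case mult
    then show ?thesis by (simp add: U_loc_closed)
  next
    case const
    then show ?thesis by simp
  next
    case hx
    then show ?thesis unfolding hx(1) by (intro free_diff_closed free_mult_closed free_add_closed) simp_all
  next
    case hd
    then show ?thesis unfolding hd(1) by (intro free_diff_closed free_mult_closed) simp_all
  next
    case xx
    then show ?thesis unfolding xx(1)
      by (intro free_diff_closed free_mult_closed free_sum_closed) simp_all
  next
    case dd
    then show ?thesis unfolding dd(1)
      by (intro free_diff_closed free_mult_closed free_sum_closed) simp_all
  next
    case xd
    then show ?thesis unfolding xd(1)
      by (intro free_diff_closed free_mult_closed free_sum_closed) simp_all
  qed
qed

lemma presented: "presented_algebra (diff_gens n N) (diff_rels n N :: 'k::comm_ring_1 diff_pre set)"
  by standard (rule relations_closed)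

lemma twist_u_closed:
  assumes \<sigma>: "\<sigma> permutes {1..n}" and a: "a \<in> carrier (U_loc n)"
  shows "twist_u \<sigma> a \<in> free"
proof -
  obtain p s where "a = U_frac n p s" "p \<in> U_h n" "s \<in> denoms n"
    using a by (auto simp: carrier_U_loc)
  then show ?thesis using \<sigma> by (simp add: twist_u_frac[OF \<sigma>])
qed

lemma diff_gens_cases:
  assumes "g \<in> diff_gens n N"
  obtains (U) p s where "g = GenU (U_frac n p s)" "p \<in> U_h n" "s \<in> denoms n"
  | (X) j a where "g = GenX j a" "j \<in> {1..n}" "a \<in> {1..N}"
  | (D) j a where "g = GenD j a" "j \<in> {1..n}" "a \<in> {1..N}"
  using assms unfolding diff_gens_def carrier_U_loc by blast

lemma twist_closed:
  assumes \<sigma>: "\<sigma> permutes {1..n}" and f: "f \<in> free"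
  shows "twist \<sigma> f \<in> free"
  unfolding twist_def
proof (rule free_ext_closed[OF f])
  fix g :: "'a loc_elem gen" assume "g \<in> diff_gens n N"
  then show "(case g of GenU a \<Rightarrow> twist_u \<sigma> a | GenX j a \<Rightarrow> twist_x \<sigma> j a | GenD j a \<Rightarrow> twist_d \<sigma> j a) \<in> free"
    using permutes_bounds[OF \<sigma>]
    by (cases rule: diff_gens_cases) (simp_all add: twist_u_closed[OF \<sigma>] twist_x_def twist_d_def U_h_perm[OF \<sigma>] denoms_perm[OF \<sigma>])
qed

lemma twist_u_add:
  assumes \<sigma>: "\<sigma> permutes {1..n}" and ab: "a \<in> carrier (U_loc n)" "b \<in> carrier (U_loc n)"
  shows "twist_u \<sigma> (a \<oplus>\<^bsub>U_loc n\<^esub> b) \<doteq> twist_u \<sigma> a + twist_u \<sigma> b"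
proof -
  obtain p s q t where a: "a = U_frac n p s" "p \<in> U_h n" "s \<in> denoms n"
    and b: "b = U_frac n q t" "q \<in> U_h n" "t \<in> denoms n"
    using ab by (auto simp: carrier_U_loc)
  have "twist_u \<sigma> (a \<oplus>\<^bsub>U_loc n\<^esub> b) = u (poly_perm \<sigma> (p * t + q * s)) (poly_perm \<sigma> (s * t))"
    using a b by (simp add: U_frac_add twist_u_frac[OF \<sigma>] denoms_subset_U_h)
  moreover have "u (poly_perm \<sigma> p) (poly_perm \<sigma> s) + u (poly_perm \<sigma> q) (poly_perm \<sigma> t)
      \<doteq> u (poly_perm \<sigma> (p * t + q * s)) (poly_perm \<sigma> (s * t))"
    unfolding perm.hom_add perm.hom_mult using a b \<sigma> by (intro u_add) simp_all
  ultimately show ?thesis using a b by (simp add: twist_u_frac[OF \<sigma>] ideal_cong_sym)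
qed

lemma twist_u_mult:
  assumes \<sigma>: "\<sigma> permutes {1..n}" and ab: "a \<in> carrier (U_loc n)" "b \<in> carrier (U_loc n)"
  shows "twist_u \<sigma> (a \<otimes>\<^bsub>U_loc n\<^esub> b) \<doteq> twist_u \<sigma> a * twist_u \<sigma> b"
proof -
  obtain p s q t where a: "a = U_frac n p s" "p \<in> U_h n" "s \<in> denoms n"
    and b: "b = U_frac n q t" "q \<in> U_h n" "t \<in> denoms n"
    using ab by (auto simp: carrier_U_loc)
  have "twist_u \<sigma> (a \<otimes>\<^bsub>U_loc n\<^esub> b) = u (poly_perm \<sigma> (p * q)) (poly_perm \<sigma> (s * t))"
    using a b by (simp add: U_frac_mult twist_u_frac[OF \<sigma>])
  moreover have "u (poly_perm \<sigma> p) (poly_perm \<sigma> s) * u (poly_perm \<sigma> q) (poly_perm \<sigma> t)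
      \<doteq> u (poly_perm \<sigma> (p * q)) (poly_perm \<sigma> (s * t))"
    unfolding perm.hom_mult using a b \<sigma> by (intro u_mult) simp_all
  ultimately show ?thesis using a b by (simp add: twist_u_frac[OF \<sigma>] ideal_cong_sym)
qed

text \<open>Used with \<open>z\<close> the Kronecker delta in the relation between \<open>h\<^sub>i\<close> and \<open>x\<^sup>j\<close>.\<close>

lemma u_past_weight:
  assumes "p \<in> U_h n" "s \<in> denoms n" "i \<in> {1..n}"
  shows "(fh n i + of_int z) * u p s \<doteq> u p s * (fh n i + of_int z)"
proof -
  have "fh n i * u p s + of_int z * u p s \<doteq> u p s * fh n i + of_int z * u p s"
    using assms by (intro ideal_cong_add u_commute ideal_cong_refl) simp_all
  moreover have "of_int z * u p s = u p s * of_int z" by (rule mult_of_int_commute)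
  ultimately show ?thesis by (simp add: distrib_left distrib_right)
qed

lemma h_twist_x:
  assumes \<sigma>: "\<sigma> permutes {1..n}" and ij: "i \<in> {1..n}" "j \<in> {1..n}" "a \<in> {1..N}"
  shows "fh n (\<sigma> i) * twist_x \<sigma> j a \<doteq> twist_x \<sigma> j a * (fh n (\<sigma> i) + (if i = j then 1 else 0))"
proof -
  define C :: "'a diff_pre" where "C = u (gauge (\<sigma> j)) (poly_perm \<sigma> (gauge j))"
  define z :: int where "z = (if i = j then 1 else 0)"
  have in': "\<sigma> i \<in> {1..n}" "\<sigma> j \<in> {1..n}" using permutes_bounds[OF \<sigma>] ij by auto
  have z: "(if \<sigma> i = \<sigma> j then 1 else 0) = (of_int z :: 'a diff_pre)"
    by (simp add: z_def permutes_inject[OF \<sigma>])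
  have hx: "fh n (\<sigma> i) * fx (\<sigma> j) a \<doteq> (fx (\<sigma> j) a * (fh n (\<sigma> i) + of_int z) :: 'a diff_pre)"
    unfolding z[symmetric] by (rule h_x[OF in' ij(3)])
  have "fh n (\<sigma> i) * twist_x \<sigma> j a = fh n (\<sigma> i) * fx (\<sigma> j) a * C" by (simp add: twist_x_def C_def mult.assoc)
  also have "\<dots> \<doteq> fx (\<sigma> j) a * (fh n (\<sigma> i) + of_int z) * C"
    by (intro cong_right hx)
  also have "\<dots> = fx (\<sigma> j) a * ((fh n (\<sigma> i) + of_int z) * C)" by (rule mult.assoc)
  also have "\<dots> \<doteq> fx (\<sigma> j) a * (C * (fh n (\<sigma> i) + of_int z))"
    unfolding C_def using in' ij \<sigma> by (intro cong_left u_past_weight) simp_all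
  also have "\<dots> = twist_x \<sigma> j a * (fh n (\<sigma> i) + of_int z)" by (simp add: twist_x_def C_def mult.assoc)
  also have "of_int z = (if i = j then 1 else 0)" by (simp add: z_def)
  finally show ?thesis .
qed

lemma h_twist_d:
  assumes \<sigma>: "\<sigma> permutes {1..n}" and ij: "i \<in> {1..n}" "j \<in> {1..n}" "a \<in> {1..N}"
  shows "fh n (\<sigma> i) * twist_d \<sigma> j a \<doteq> twist_d \<sigma> j a * (fh n (\<sigma> i) - (if i = j then 1 else 0))"
proof -
  define K :: "'a diff_pre" where "K = u (poly_perm \<sigma> (gauge j)) (gauge (\<sigma> j))"
  have in': "\<sigma> i \<in> {1..n}" "\<sigma> j \<in> {1..n}" using permutes_bounds[OF \<sigma>] ij by auto
  have "fh n (\<sigma> i) * twist_d \<sigma> j a = fh n (\<sigma> i) * K * fd (\<sigma> j) a" by (simp add: twist_d_def K_def mult.assoc)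
  also have "\<dots> \<doteq> K * fh n (\<sigma> i) * fd (\<sigma> j) a"
    unfolding K_def using in' ij \<sigma> by (intro cong_right u_commute) simp_all
  also have "\<dots> = K * (fh n (\<sigma> i) * fd (\<sigma> j) a)" by (rule mult.assoc)
  also have "\<dots> \<doteq> K * (fd (\<sigma> j) a * (fh n (\<sigma> i) - (if \<sigma> i = \<sigma> j then 1 else 0)))"
    by (intro cong_left h_d in' ij)
  also have "\<dots> = twist_d \<sigma> j a * (fh n (\<sigma> i) - (if i = j then 1 else 0))"
    by (simp add: twist_d_def K_def mult.assoc permutes_inject[OF \<sigma>])
  finally show ?thesis .
qed

lemma twist_relation:
  fixes r :: "'k::comm_ring_1 diff_pre"
  assumes \<sigma>: "\<sigma> permutes {1..n}" and r: "r \<in> diff_rels n N"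
  shows "twist \<sigma> r \<in> ideal_span (diff_rels n N)"
proof -
  interpret twist: unital_ring_hom "twist \<sigma> :: 'k diff_pre \<Rightarrow> 'k diff_pre" by (rule twist_hom)
  have twist_if: "twist \<sigma> (if P then 1 else 0) = (if P then 1 else 0 :: 'k diff_pre)" for P
    by (simp add: twist.hom_one twist.hom_zero)
  note hom = twist.hom_add twist.hom_diff twist.hom_mult twist.hom_sum twist_if twist_gens
  have fh: "twist_u \<sigma> (U_frac n (polyvar i) 1) = (fh n (\<sigma> i) :: 'k diff_pre)" if "i \<in> {1..n}" for i
    using that by (simp add: twist_u_frac[OF \<sigma>] perm.hom_one)
  from r show ?thesis
  proof (cases rule: diff_rels_cases)
    case (add a b)
    show ?thesis
      unfolding add(1) hom using twist_u_add[OF \<sigma> add(2,3)] by (simp only: ideal_cong_def)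
  next
    case (mult a b)
    show ?thesis
      unfolding mult(1) hom using twist_u_mult[OF \<sigma> mult(2,3)] by (simp only: ideal_cong_def)
  next
    case (const c)
    have "twist_u \<sigma> (U_frac n (polyconst c) 1) \<doteq> free_const c"
      using u_const[of c] by (simp add: twist_u_frac[OF \<sigma>] perm.hom_one)
    then show ?thesis unfolding const(1) hom by (simp only: ideal_cong_def)
  next
    case (hx i j a)
    show ?thesis
      unfolding hx(1) hom fh[OF hx(2)] using h_twist_x[OF \<sigma> hx(2-4)] by (simp only: ideal_cong_def)
  next
    case (hd i j a)
    show ?thesis
      unfolding hd(1) hom fh[OF hd(2)] using h_twist_d[OF \<sigma> hd(2-4)] by (simp only: ideal_cong_def)
  next
    case (xx i j a b)
    note expand = ideal_cong_sym[OF sum_xx[where c = "twist_u \<sigma>" and y = "twist_x \<sigma>" and a = a and b = b,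
          OF twist_u_zero[OF \<sigma>] xx(2,3)]]
    have "twist_x \<sigma> i a * twist_x \<sigma> j b \<doteq> (\<Sum>k\<in>{1..n}. \<Sum>l\<in>{1..n}. twist_u \<sigma> (Rhat n i j k l) * twist_x \<sigma> k b * twist_x \<sigma> l a)"
    proof (rule ideal_cong_trans[OF _ expand], cases "i = j")
      case True
      have "twist_x \<sigma> i a * twist_x \<sigma> i b \<doteq> 1 * twist_x \<sigma> i b * twist_x \<sigma> i a"
        using twist_x_same[OF \<sigma> xx(2,4,5)] by simp
      also have "\<dots> \<doteq> twist_u \<sigma> (U_frac n 1 1) * twist_x \<sigma> i b * twist_x \<sigma> i a"
        by (intro cong_right ideal_cong_sym[OF twist_u_one[OF \<sigma>]])
      finally show "twist_x \<sigma> i a * twist_x \<sigma> j b \<doteq> (if i = j then twist_u \<sigma> (U_frac n 1 1) * twist_x \<sigma> i b * twist_x \<sigma> i a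
       else twist_u \<sigma> (U_frac n 1 (hdiff i j)) * twist_x \<sigma> i b * twist_x \<sigma> j a
         + twist_u \<sigma> (U_frac n (swap_num i j) (swap_den i j)) * twist_x \<sigma> j b * twist_x \<sigma> i a)"
        unfolding True[symmetric] by simp
    qed (simp add: twist_x_swap[OF \<sigma> xx(2-5)])
    then show ?thesis unfolding xx(1) hom by (simp only: ideal_cong_def)
  next
    case (dd i j a b)
    note expand = ideal_cong_sym[OF sum_dd[where c = "twist_u \<sigma>" and y = "twist_d \<sigma>" and a = a and b = b,
          OF twist_u_zero[OF \<sigma>] dd(2,3)]]
    have "twist_d \<sigma> i a * twist_d \<sigma> j b \<doteq> (\<Sum>k\<in>{1..n}. \<Sum>l\<in>{1..n}. twist_u \<sigma> (Rhat n l k j i) * twist_d \<sigma> k b * twist_d \<sigma> l a)"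
    proof (rule ideal_cong_trans[OF _ expand], cases "i = j")
      case True
      have "twist_d \<sigma> i a * twist_d \<sigma> i b \<doteq> 1 * twist_d \<sigma> i b * twist_d \<sigma> i a"
        using twist_d_same[OF \<sigma> dd(2,4,5)] by simp
      also have "\<dots> \<doteq> twist_u \<sigma> (U_frac n 1 1) * twist_d \<sigma> i b * twist_d \<sigma> i a"
        by (intro cong_right ideal_cong_sym[OF twist_u_one[OF \<sigma>]])
      finally show "twist_d \<sigma> i a * twist_d \<sigma> j b \<doteq> (if i = j then twist_u \<sigma> (U_frac n 1 1) * twist_d \<sigma> i b * twist_d \<sigma> i a
       else twist_u \<sigma> (U_frac n 1 (hdiff j i)) * twist_d \<sigma> i b * twist_d \<sigma> j a
         + twist_u \<sigma> (U_frac n (swap_num i j) (swap_den i j)) * twist_d \<sigma> j b * twist_d \<sigma> i a)"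
        unfolding True[symmetric] by simp
    qed (simp add: twist_d_swap[OF \<sigma> dd(2-5)])
    then show ?thesis unfolding dd(1) hom by (simp only: ideal_cong_def)
  next
    case (xd i j a b)
    note expand = ideal_cong_sym[OF sum_dx[where c = "twist_u \<sigma>" and y = "twist_x \<sigma>" and z = "twist_d \<sigma>" and a = a and b = b,
          OF twist_u_zero[OF \<sigma>] xd(2,3)]]
    have "twist_x \<sigma> i a * twist_d \<sigma> j b \<doteq> (\<Sum>k\<in>{1..n}. \<Sum>l\<in>{1..n}.
        twist_u \<sigma> (U_shift n k (Rhat n k i l j)) * twist_d \<sigma> k b * twist_x \<sigma> l a) - (if a = b \<and> i = j then 1 else 0)"
    proof (rule ideal_cong_trans[OF _ ideal_cong_diff[OF expand ideal_cong_refl]], cases "i = j")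
      case True
      show "twist_x \<sigma> i a * twist_d \<sigma> j b \<doteq>
        (if i = j then \<Sum>k\<in>{1..n}. twist_u \<sigma> (U_frac n 1 (hdiff k i + 1)) * twist_d \<sigma> k b * twist_x \<sigma> k a
         else twist_u \<sigma> (U_frac n (poly_shift_by j 1 (swap_num j i)) (poly_shift_by j 1 (swap_den j i))) * twist_d \<sigma> j b * twist_x \<sigma> i a)
        - (if a = b \<and> i = j then 1 else 0)"
        unfolding True[symmetric] using twist_x_twist_d_same[OF \<sigma> xd(2,4,5)] by simp
    qed (simp add: twist_x_twist_d_swap[OF \<sigma> xd(2-5)])
    then show ?thesis unfolding xd(1) hom by (simp only: ideal_cong_def)
  qed
qed

lemma twist_respects:
  assumes "\<sigma> permutes {1..n}"
  shows "presented_algebra.respects_relations (diff_gens n N) (diff_rels n N :: 'k::comm_ring_1 diff_pre set) (twist \<sigma>)"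
  unfolding presented_algebra.respects_relations_def[OF presented]
  using twist_hom twist_closed[OF assms] twist_relation[OF assms] by blast

text \<open>The coefficient of \<open>x\<^sup>j\<close> under \<open>\<sigma>\<close> is \<open>\<psi>\<^bsub>\<sigma>j\<^esub> / \<sigma>(\<psi>\<^sub>j)\<close>, so the composite has
  \<open>\<psi>\<^bsub>\<sigma>\<tau>j\<^esub> / \<sigma>(\<psi>\<^bsub>\<tau>j\<^esub>) \<cdot> \<sigma>(\<psi>\<^bsub>\<tau>j\<^esub>) / \<sigma>\<tau>(\<psi>\<^sub>j)\<close>, and the middle factors cancel. They do so only modulo the
  relations, because a product of coefficients is a word of length two in the free algebra.\<close>

lemma twist_comp:
  fixes f :: "'k::comm_ring_1 diff_pre"
  assumes \<sigma>: "\<sigma> permutes {1..n}" and \<tau>: "\<tau> permutes {1..n}" and f: "f \<in> free"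
  shows "twist \<sigma> (twist \<tau> f) \<doteq> twist (\<sigma> \<circ> \<tau>) f"
proof -
  define \<rho> where "\<rho> = \<sigma> \<circ> \<tau>"
  have \<rho>: "\<rho> permutes {1..n}" unfolding \<rho>_def by (rule permutes_compose[OF \<tau> \<sigma>])
  have comp: "poly_perm \<sigma> (poly_perm \<tau> p) = poly_perm \<rho> p" for p :: "'k mpoly"
    unfolding \<rho>_def by (rule poly_perm_comp)
  have \<rho>_apply: "\<rho> j = \<sigma> (\<tau> j)" for j by (simp add: \<rho>_def)
  interpret s: unital_ring_hom "twist \<sigma> :: 'k diff_pre \<Rightarrow> 'k diff_pre" by (rule twist_hom)
  interpret t: unital_ring_hom "twist \<tau> :: 'k diff_pre \<Rightarrow> 'k diff_pre" by (rule twist_hom)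
  interpret st: unital_ring_hom "twist \<rho> :: 'k diff_pre \<Rightarrow> 'k diff_pre" by (rule twist_hom)
  show ?thesis
    unfolding \<rho>_def[symmetric] using f
  proof (induction f rule: free_algebra_induct)
    case (const c)
    show ?case by simp
  next
    case (add f g)
    then show ?case unfolding s.hom_add t.hom_add st.hom_add by (rule ideal_cong_add)
  next
    case (mult f g)
    then show ?case unfolding s.hom_mult t.hom_mult st.hom_mult by (rule ideal_cong_mult)
  next
    case (gen g)
    have cancel: "u p q * u q r \<doteq> u p r"
      if "p \<in> denoms n" "q \<in> denoms n" "r \<in> denoms n" for p q r :: "'k mpoly"
    proof -
      have U: "p \<in> U_h n" "q \<in> U_h n" "r \<in> U_h n" using that by (simp_all add: denoms_subset_U_h)
      have "u p q * u q r \<doteq> u (p * q) (q * r)" using that U by (intro u_mult) simp_all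
      also have "U_frac n (p * q) (q * r) = U_frac n p r" using that U by (intro U_frac_eqI') simp_all
      finally show ?thesis .
    qed
    from gen show ?case
    proof (cases rule: diff_gens_cases)
      case (U p s)
      then show ?thesis
        using \<tau> \<rho> by (simp add: twist_u_frac[OF \<tau>] twist_u_frac[OF \<sigma>] twist_u_frac[OF \<rho>] comp)
    next
      case (X j a)
      have in': "1 \<le> \<tau> j" "\<tau> j \<le> n" "1 \<le> \<sigma> (\<tau> j)" "\<sigma> (\<tau> j) \<le> n"
        using permutes_bounds[OF \<tau>] permutes_bounds[OF \<sigma>] X by auto
      have "twist \<sigma> (twist \<tau> (free_gen g)) = fx (\<sigma> (\<tau> j)) a * (u (gauge (\<sigma> (\<tau> j))) (poly_perm \<sigma> (gauge (\<tau> j)))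
          * u (poly_perm \<sigma> (gauge (\<tau> j))) (poly_perm \<rho> (gauge j)))"
        using X in' \<tau> by (simp add: twist_x_def s.hom_mult twist_u_frac[OF \<sigma>] comp mult.assoc)
      also have "\<dots> \<doteq> fx (\<sigma> (\<tau> j)) a * u (gauge (\<sigma> (\<tau> j))) (poly_perm \<rho> (gauge j))"
        using X in' \<sigma> \<rho> by (intro cong_left cancel) simp_all
      also have "\<dots> = twist \<rho> (free_gen g)" using X by (simp add: twist_x_def \<rho>_apply[of j])
      finally show ?thesis .
    next
      case (D j a)
      have in': "1 \<le> \<tau> j" "\<tau> j \<le> n" "1 \<le> \<sigma> (\<tau> j)" "\<sigma> (\<tau> j) \<le> n"
        using permutes_bounds[OF \<tau>] permutes_bounds[OF \<sigma>] D by auto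
      have "twist \<sigma> (twist \<tau> (free_gen g)) = (u (poly_perm \<rho> (gauge j)) (poly_perm \<sigma> (gauge (\<tau> j)))
          * u (poly_perm \<sigma> (gauge (\<tau> j))) (gauge (\<sigma> (\<tau> j)))) * fd (\<sigma> (\<tau> j)) a"
        using D in' \<tau> by (simp add: twist_d_def s.hom_mult twist_u_frac[OF \<sigma>] comp mult.assoc)
      also have "\<dots> \<doteq> u (poly_perm \<rho> (gauge j)) (gauge (\<sigma> (\<tau> j))) * fd (\<sigma> (\<tau> j)) a"
        using D in' \<sigma> \<rho> by (intro cong_right cancel) simp_all
      also have "\<dots> = twist \<rho> (free_gen g)" using D by (simp add: twist_d_def \<rho>_apply[of j])
      finally show ?thesis .
    qed
  qed
qed

lemma twist_id:
  fixes f :: "'k::comm_ring_1 diff_pre"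
  assumes f: "f \<in> free"
  shows "twist id f \<doteq> f"
proof -
  define \<iota> :: "nat \<Rightarrow> nat" where "\<iota> = id"
  interpret i: unital_ring_hom "twist \<iota> :: 'k diff_pre \<Rightarrow> 'k diff_pre" by (rule twist_hom)
  have \<iota>: "\<iota> permutes {1..n}" unfolding \<iota>_def by (rule permutes_id)
  have \<iota>_perm: "poly_perm \<iota> p = p" for p :: "'k mpoly" unfolding \<iota>_def by (rule poly_perm_id)
  have \<iota>_apply: "\<iota> j = j" for j by (simp add: \<iota>_def)
  show ?thesis
    unfolding \<iota>_def[symmetric] using f
  proof (induction f rule: free_algebra_induct)
    case (const c)
    show ?case by simp
  next
    case (add f g)
    then show ?case unfolding i.hom_add by (rule ideal_cong_add)
  next
    case (mult f g)
    then show ?case unfolding i.hom_mult by (rule ideal_cong_mult)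
  next
    case (gen g)
    from gen show ?case
    proof (cases rule: diff_gens_cases)
      case (U p s)
      then show ?thesis by (simp add: twist_u_frac[OF \<iota>] \<iota>_perm)
    next
      case (X j a)
      then show ?thesis using cong_left[OF u_self[of "gauge j"], of "fx j a"] by (simp add: twist_x_def \<iota>_perm \<iota>_apply[of j])
    next
      case (D j a)
      then show ?thesis using cong_right[OF u_self[of "gauge j"], of "fd j a"] by (simp add: twist_d_def \<iota>_perm \<iota>_apply[of j])
    qed
  qed
qed


definition act :: "(nat \<Rightarrow> nat) \<Rightarrow> 'k::comm_ring_1 diff_elem \<Rightarrow> 'k diff_elem" where
  "act \<sigma> = presented_algebra.descend (diff_gens n N) (diff_rels n N) (twist \<sigma>)"

context
begin

interpretation P: presented_algebra "diff_gens n N" "diff_rels n N :: 'k::comm_ring_1 diff_pre set"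
  by (rule presented)

lemma Diff_eq: "Diff n N = P.Q"
  by (simp add: Diff_def diff_ideal_def)

lemma diff_class_eq: "diff_class n N = P.cls"
  by (simp add: fun_eq_iff diff_class_def diff_ideal_def)

lemma diff_class_eqI:
  fixes f :: "'k::comm_ring_1 diff_pre"
  shows
  "f \<in> free \<Longrightarrow> g \<in> free \<Longrightarrow> f \<doteq> g \<Longrightarrow> diff_class n N f = (diff_class n N g :: 'k diff_elem)"
  unfolding diff_class_eq by (rule P.cls_eqI)

lemma carrier_Diff:
  "carrier (Diff n N) = (diff_class n N ` free :: 'k::comm_ring_1 diff_elem set)"
  unfolding Diff_eq diff_class_eq by (rule P.carrier_Q)

lemma diff_class_mult:
  fixes f :: "'k::comm_ring_1 diff_pre"
  shows
  "f \<in> free \<Longrightarrow> g \<in> free \<Longrightarrow>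
    diff_class n N f \<otimes>\<^bsub>Diff n N\<^esub> diff_class n N g = (diff_class n N (f * g) :: 'k diff_elem)"
  unfolding Diff_eq diff_class_eq by (rule P.cls_mult)

lemma diff_class_uminus:
  fixes f :: "'k::comm_ring_1 diff_pre"
  shows
  "f \<in> free \<Longrightarrow> \<ominus>\<^bsub>Diff n N\<^esub> diff_class n N f = (diff_class n N (- f) :: 'k diff_elem)"
  unfolding Diff_eq diff_class_eq by (rule P.cls_uminus)

lemma act_class:
  fixes f :: "'k::comm_ring_1 diff_pre"
  shows
  "\<sigma> permutes {1..n} \<Longrightarrow> f \<in> free \<Longrightarrow> act \<sigma> (diff_class n N f) = (diff_class n N (twist \<sigma> f) :: 'k diff_elem)"
  unfolding act_def diff_class_eq by (rule P.descend_cls[OF twist_respects])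

lemma ring_Diff: "ring (Diff n N :: 'k::comm_ring_1 diff_elem ring)"
  unfolding Diff_eq by (rule P.Q.ring_axioms)

lemma act_hom:
  "\<sigma> permutes {1..n} \<Longrightarrow> act \<sigma> \<in> ring_hom (Diff n N) (Diff n N :: 'k::comm_ring_1 diff_elem ring)"
  unfolding act_def Diff_eq by (rule P.descend_hom[OF twist_respects])

end

lemma act_comp:
  assumes \<sigma>: "\<sigma> permutes {1..n}" and \<tau>: "\<tau> permutes {1..n}" and y: "y \<in> carrier (Diff n N)"
  shows "act \<sigma> (act \<tau> y) = act (\<sigma> \<circ> \<tau>) y"
proof -
  obtain f where f: "f \<in> free" "y = diff_class n N f" using y by (auto simp: carrier_Diff)
  note \<sigma>\<tau> = permutes_compose[OF \<tau> \<sigma>]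
  have "act \<sigma> (act \<tau> y) = diff_class n N (twist \<sigma> (twist \<tau> f))"
    unfolding f(2) act_class[OF \<tau> f(1)] act_class[OF \<sigma> twist_closed[OF \<tau> f(1)]] ..
  also have "\<dots> = diff_class n N (twist (\<sigma> \<circ> \<tau>) f)"
    by (intro diff_class_eqI twist_comp twist_closed \<sigma> \<tau> \<sigma>\<tau> f(1))
  also have "\<dots> = act (\<sigma> \<circ> \<tau>) y" unfolding f(2) act_class[OF \<sigma>\<tau> f(1)] ..
  finally show ?thesis .
qed

lemma act_id:
  assumes y: "y \<in> carrier (Diff n N)"
  shows "act id y = y"
proof -
  obtain f where f: "f \<in> free" "y = diff_class n N f" using y by (auto simp: carrier_Diff)
  then show ?thesis
    by (simp add: act_class permutes_id diff_class_eqI[OF _ _ twist_id] twist_closed)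
qed

lemma act_closed: "\<sigma> permutes {1..n} \<Longrightarrow> y \<in> carrier (Diff n N) \<Longrightarrow> act \<sigma> y \<in> carrier (Diff n N)"
  using ring_hom_closed[OF act_hom] .

lemma act_bij:
  assumes \<sigma>: "\<sigma> permutes {1..n}"
  shows "bij_betw (act \<sigma>) (carrier (Diff n N)) (carrier (Diff n N :: 'k::comm_ring_1 diff_elem ring))"
proof -
  define \<tau> where "\<tau> = inv_into UNIV \<sigma>"
  have \<tau>: "\<tau> permutes {1..n}" unfolding \<tau>_def by (rule permutes_inv[OF \<sigma>])
  have "\<tau> \<circ> \<sigma> = id" "\<sigma> \<circ> \<tau> = id" unfolding \<tau>_def by (rule permutes_inv_o[OF \<sigma>])+
  then have "act \<tau> (act \<sigma> y) = y" "act \<sigma> (act \<tau> y) = y"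
    if "y \<in> carrier (Diff n N)" for y :: "'k diff_elem"
    by (simp_all only: act_comp[OF \<tau> \<sigma> that] act_comp[OF \<sigma> \<tau> that] act_id[OF that])
  note inverse = this
  show ?thesis
  proof (rule bij_betw_byWitness[where f' = "act \<tau>"])
    show "\<forall>y\<in>carrier (Diff n N). act \<tau> (act \<sigma> y) = (y :: 'k diff_elem)"
      "\<forall>y\<in>carrier (Diff n N). act \<sigma> (act \<tau> y) = (y :: 'k diff_elem)"
      using inverse by blast+
    show "act \<sigma> ` carrier (Diff n N) \<subseteq> (carrier (Diff n N) :: 'k diff_elem set)"
      "act \<tau> ` carrier (Diff n N) \<subseteq> (carrier (Diff n N) :: 'k diff_elem set)"
      using act_closed[OF \<sigma>] act_closed[OF \<tau>] by blast+
  qed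
qed

lemma diff_const_closed: "diff_const n N c \<in> carrier (Diff n N)"
  by (simp add: diff_const_def carrier_Diff)

lemma act_const: "\<sigma> permutes {1..n} \<Longrightarrow> act \<sigma> (diff_const n N c) = diff_const n N c"
  by (simp add: diff_const_def act_class)

lemma act_aut: "\<sigma> permutes {1..n} \<Longrightarrow> act \<sigma> \<in> Diff_aut n N"
  by (simp add: Diff_aut_def ring_iso_def act_hom act_bij act_const)


lemma restrict_act_aut:
  assumes \<sigma>: "\<sigma> permutes {1..n}"
  shows "restrict (act \<sigma>) (carrier (Diff n N)) \<in> Diff_aut n N"
proof -
  let ?r = "restrict (act \<sigma>) (carrier (Diff n N)) :: 'a diff_elem \<Rightarrow> 'a diff_elem"
  have "?r \<in> ring_iso (Diff n N) (Diff n N)"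
    by (rule ring.ring_iso_restrict[OF ring_Diff, of "act \<sigma>"])
      (simp_all add: ring_iso_def act_hom[OF \<sigma>] act_bij[OF \<sigma>])
  then show ?thesis by (simp add: Diff_aut_def diff_const_closed act_const[OF \<sigma>])
qed

subsection \<open>The simple transpositions\<close>

context
  fixes i :: nat and t :: "nat \<Rightarrow> nat"
  assumes i: "1 \<le> i" "i < n" and t: "t = Transposition.transpose i (i + 1)"
begin

lemma t_permutes: "t permutes {1..n}"
  unfolding t by (rule permutes_swap_id) (use i in auto)

lemma act_h:
  assumes "j \<in> {1..n}"
  shows "act t (diff_u n N (U_frac n (polyvar j) 1)) = diff_u n N (U_frac n (polyvar (t j)) 1)"
  using assms by (simp add: diff_u_def act_class[OF t_permutes] twist_u_frac[OF t_permutes] perm.hom_one)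

lemma transpose_simps: "t i = i + 1" "t (i + 1) = i" "j \<noteq> i \<Longrightarrow> j \<noteq> i + 1 \<Longrightarrow> t j = j"
  by (simp_all add: t transpose_def)

lemma t_t: "poly_perm t (poly_perm t p) = p"
  by (simp add: t poly_perm_comp poly_perm_id)

lemma perm_gauge_suc: "poly_perm t (gauge (i + 1)) = gauge i * hdiff i (i + 1)"
proof -
  have "poly_perm t (gauge (i + 1)) = poly_perm t (poly_perm t (gauge i) * hdiff (i + 1) i)"
    by (simp only: gauge_suc[OF i(1), folded t])
  also have "\<dots> = gauge i * hdiff i (i + 1)"
    by (simp add: perm.hom_simps t_t transpose_simps[simplified])
  finally show ?thesis .
qed

text \<open>The general formula for the action of a permutation specializes to the coefficients in the formulas
  for \<open>s\<^sub>i\<close>.\<close>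

lemma coefficients:
  "U_frac n (gauge (i + 1)) (poly_perm t (gauge i)) = U_frac n (- hdiff i (i + 1)) 1"
  "U_frac n (poly_perm t (gauge i)) (gauge (i + 1)) = U_frac n (- 1) (hdiff i (i + 1))"
  "U_frac n (gauge i) (poly_perm t (gauge (i + 1))) = U_frac n 1 (hdiff i (i + 1))"
  "U_frac n (poly_perm t (gauge (i + 1))) (gauge i) = U_frac n (hdiff i (i + 1)) 1"
proof -
  have g: "gauge i \<in> denoms n" "gauge (i + 1) \<in> denoms n" and h: "hdiff i (i + 1) \<in> denoms n"
    using i by simp_all
  note pg = denoms_perm[OF t_permutes g(1)] denoms_perm[OF t_permutes g(2)]
  note U = denoms_subset_U_h
  show "U_frac n (gauge (i + 1)) (poly_perm t (gauge i)) = U_frac n (- hdiff i (i + 1)) 1"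
    by (rule U_frac_eqI'[OF U[OF g(2)] U_h_uminus[OF U[OF h]] pg(1) denoms_one])
      (simp only: gauge_suc[OF i(1), folded t], simp add: algebra_simps)
  show "U_frac n (poly_perm t (gauge i)) (gauge (i + 1)) = U_frac n (- 1) (hdiff i (i + 1))"
    by (rule U_frac_eqI'[OF U[OF pg(1)] U_h_uminus[OF U_h_one] g(2) h])
      (simp only: gauge_suc[OF i(1), folded t], simp add: algebra_simps)
  show "U_frac n (gauge i) (poly_perm t (gauge (i + 1))) = U_frac n 1 (hdiff i (i + 1))"
    by (rule U_frac_eqI'[OF U[OF g(1)] U_h_one pg(2) h]) (subst perm_gauge_suc, simp)
  show "U_frac n (poly_perm t (gauge (i + 1))) (gauge i) = U_frac n (hdiff i (i + 1)) 1"
    by (rule U_frac_eqI'[OF U[OF pg(2)] U[OF h] g(1) denoms_one])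
      (subst perm_gauge_suc, simp)
qed

lemma act_x:
  assumes a: "a \<in> {1..N}"
  shows "act t (diff_x n N i a) = \<ominus>\<^bsub>Diff n N\<^esub> (diff_x n N (i + 1) a \<otimes>\<^bsub>Diff n N\<^esub> diff_u n N (U_frac n (hdiff i (i + 1)) 1))"
    and "act t (diff_x n N (i + 1) a) = diff_x n N i a \<otimes>\<^bsub>Diff n N\<^esub> diff_u n N (U_frac n 1 (hdiff i (i + 1)))"
    and "j \<in> {1..n} - {i, i + 1} \<Longrightarrow> act t (diff_x n N j a) = diff_x n N j a"
proof -
  have cl: "fx i a \<in> free" "fx (i + 1) a \<in> free" "u (hdiff i (i + 1)) 1 \<in> free" "u 1 (hdiff i (i + 1)) \<in> free"
    "u (- hdiff i (i + 1)) 1 \<in> free"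
    using i a by simp_all
  have "act t (diff_x n N i a) = diff_class n N (fx (i + 1) a * u (- hdiff i (i + 1)) 1)"
    unfolding diff_x_def act_class[OF t_permutes cl(1)] by (simp only: twist_gens twist_x_def transpose_simps coefficients)
  also have "\<dots> = diff_class n N (- (fx (i + 1) a * u (hdiff i (i + 1)) 1))"
  proof (rule diff_class_eqI)
    have "fx (i + 1) a * u (- hdiff i (i + 1)) 1 \<doteq> fx (i + 1) a * (- u (hdiff i (i + 1)) 1)"
      using i by (intro cong_left u_uminus) simp_all
    then show "fx (i + 1) a * u (- hdiff i (i + 1)) 1 \<doteq> - (fx (i + 1) a * u (hdiff i (i + 1)) 1)" by simp
  qed (intro free_mult_closed free_uminus_closed cl)+
  also have "\<dots> = \<ominus>\<^bsub>Diff n N\<^esub> (diff_x n N (i + 1) a \<otimes>\<^bsub>Diff n N\<^esub> diff_u n N (U_frac n (hdiff i (i + 1)) 1))"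
    unfolding diff_x_def diff_u_def
    by (simp only: diff_class_mult[OF cl(2,3)] diff_class_uminus[OF free_mult_closed[OF cl(2,3)]])
  finally show "act t (diff_x n N i a) = \<ominus>\<^bsub>Diff n N\<^esub> (diff_x n N (i + 1) a \<otimes>\<^bsub>Diff n N\<^esub> diff_u n N (U_frac n (hdiff i (i + 1)) 1))" .
  show "act t (diff_x n N (i + 1) a) = diff_x n N i a \<otimes>\<^bsub>Diff n N\<^esub> diff_u n N (U_frac n 1 (hdiff i (i + 1)))"
    unfolding diff_x_def diff_u_def act_class[OF t_permutes cl(2)] diff_class_mult[OF cl(1,4)]
    by (simp only: twist_gens twist_x_def transpose_simps coefficients)
  assume j: "j \<in> {1..n} - {i, i + 1}"
  have "act t (diff_x n N j a) = diff_class n N (fx j a * u (gauge j) (gauge j))"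
    using i j a unfolding diff_x_def
    by (simp add: act_class[OF t_permutes] twist_x_def gauge_transpose_other[where i = i, folded t] transpose_simps)
  also have "\<dots> = diff_class n N (fx j a)"
    using i j a cong_left[OF u_self[of "gauge j"], of "fx j a"] by (intro diff_class_eqI) simp_all
  finally show "act t (diff_x n N j a) = diff_x n N j a" by (simp add: diff_x_def)
qed

lemma act_d:
  assumes a: "a \<in> {1..N}"
  shows "act t (diff_d n N i a) = \<ominus>\<^bsub>Diff n N\<^esub> (diff_u n N (U_frac n 1 (hdiff i (i + 1))) \<otimes>\<^bsub>Diff n N\<^esub> diff_d n N (i + 1) a)"
    and "act t (diff_d n N (i + 1) a) = diff_u n N (U_frac n (hdiff i (i + 1)) 1) \<otimes>\<^bsub>Diff n N\<^esub> diff_d n N i a"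
    and "j \<in> {1..n} - {i, i + 1} \<Longrightarrow> act t (diff_d n N j a) = diff_d n N j a"
proof -
  have cl: "fd i a \<in> free" "fd (i + 1) a \<in> free" "u (hdiff i (i + 1)) 1 \<in> free" "u 1 (hdiff i (i + 1)) \<in> free"
    "u (- 1) (hdiff i (i + 1)) \<in> free"
    using i a by simp_all
  have "act t (diff_d n N i a) = diff_class n N (u (- 1) (hdiff i (i + 1)) * fd (i + 1) a)"
    unfolding diff_d_def act_class[OF t_permutes cl(1)] by (simp only: twist_gens twist_d_def transpose_simps coefficients)
  also have "\<dots> = diff_class n N (- (u 1 (hdiff i (i + 1)) * fd (i + 1) a))"
  proof (rule diff_class_eqI)
    have "u (- 1) (hdiff i (i + 1)) * fd (i + 1) a \<doteq> (- u 1 (hdiff i (i + 1))) * fd (i + 1) a"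
      using i by (intro cong_right u_uminus) simp_all
    then show "u (- 1) (hdiff i (i + 1)) * fd (i + 1) a \<doteq> - (u 1 (hdiff i (i + 1)) * fd (i + 1) a)" by simp
  qed (intro free_mult_closed free_uminus_closed cl)+
  also have "\<dots> = \<ominus>\<^bsub>Diff n N\<^esub> (diff_u n N (U_frac n 1 (hdiff i (i + 1))) \<otimes>\<^bsub>Diff n N\<^esub> diff_d n N (i + 1) a)"
    unfolding diff_d_def diff_u_def
    by (simp only: diff_class_mult[OF cl(4,2)] diff_class_uminus[OF free_mult_closed[OF cl(4,2)]])
  finally show "act t (diff_d n N i a) = \<ominus>\<^bsub>Diff n N\<^esub> (diff_u n N (U_frac n 1 (hdiff i (i + 1))) \<otimes>\<^bsub>Diff n N\<^esub> diff_d n N (i + 1) a)" .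
  show "act t (diff_d n N (i + 1) a) = diff_u n N (U_frac n (hdiff i (i + 1)) 1) \<otimes>\<^bsub>Diff n N\<^esub> diff_d n N i a"
    unfolding diff_d_def diff_u_def act_class[OF t_permutes cl(2)] diff_class_mult[OF cl(3,1)]
    by (simp only: twist_gens twist_d_def transpose_simps coefficients)
  assume j: "j \<in> {1..n} - {i, i + 1}"
  have "act t (diff_d n N j a) = diff_class n N (u (gauge j) (gauge j) * fd j a)"
    using i j a unfolding diff_d_def
    by (simp add: act_class[OF t_permutes] twist_d_def gauge_transpose_other[where i = i, folded t] transpose_simps)
  also have "\<dots> = diff_class n N (fd j a)"
    using i j a cong_right[OF u_self[of "gauge j"], of "fd j a"] by (intro diff_class_eqI) simp_all
  finally show "act t (diff_d n N j a) = diff_d n N j a" by (simp add: diff_d_def)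
qed

end

lemma act_group_action:
  "group_action (sym_group n) (carrier (Diff n N)) (\<lambda>\<sigma>. restrict (act \<sigma>) (carrier (Diff n N :: 'k::comm_ring_1 diff_elem ring)))"
proof -
  let ?E = "carrier (Diff n N :: 'k diff_elem ring)"
  let ?\<phi> = "\<lambda>\<sigma>. restrict (act \<sigma>) ?E"
  have Bij: "?\<phi> \<sigma> \<in> Bij ?E" if "\<sigma> permutes {1..n}" for \<sigma>
    using act_bij[OF that] by (simp add: Bij_def bij_betw_restrict_eq)
  have "?\<phi> \<in> hom (sym_group n) (BijGroup ?E)"
  proof (rule homI)
    fix \<sigma> assume "\<sigma> \<in> carrier (sym_group n)"
    then show "?\<phi> \<sigma> \<in> carrier (BijGroup ?E)"
      using Bij by (simp add: BijGroup_def sym_group_carrier)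
  next
    fix \<sigma> \<tau> assume "\<sigma> \<in> carrier (sym_group n)" "\<tau> \<in> carrier (sym_group n)"
    then have \<sigma>: "\<sigma> permutes {1..n}" and \<tau>: "\<tau> permutes {1..n}" by (simp_all add: sym_group_carrier)
    show "?\<phi> (\<sigma> \<otimes>\<^bsub>sym_group n\<^esub> \<tau>) = ?\<phi> \<sigma> \<otimes>\<^bsub>BijGroup ?E\<^esub> ?\<phi> \<tau>"
      using Bij[OF \<sigma>] Bij[OF \<tau>] act_closed[OF \<tau>]
      by (auto simp: sym_group_mult BijGroup_def compose_def restrict_def fun_eq_iff act_comp[OF \<sigma> \<tau>])
  qed
  then show ?thesis
    by (intro group_action.intro group_hom.intro group_hom_axioms.intro sym_group_is_group group_BijGroup)
qed

end

section \<open>The action of the symmetric group\<close>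

theorem lemma9:
  fixes n N :: nat
    and D :: "'k::{comm_ring_1, ring_char_0} diff_elem ring" (structure)
    and x d :: "nat \<Rightarrow> nat \<Rightarrow> 'k diff_elem"
    and h :: "nat \<Rightarrow> 'k diff_elem"
    and hh hh_inv :: "nat \<Rightarrow> 'k diff_elem"
  assumes "n \<ge> 1" and "N \<ge> 1"
    and "D = Diff n N"
    and "x = diff_x n N" and "d = diff_d n N"
    and "h = (\<lambda>j. diff_u n N (U_frac n (polyvar j) 1))"
    and "hh = (\<lambda>i. diff_u n N (U_frac n (polyvar i - polyvar (i + 1)) 1))"
    and "hh_inv = (\<lambda>i. diff_u n N (U_frac n 1 (polyvar i - polyvar (i + 1))))"
  shows "\<exists>s :: nat \<Rightarrow> 'k diff_elem \<Rightarrow> 'k diff_elem.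
    (\<forall>i\<in>{1..<n}. s i \<in> Diff_aut n N \<and>
       (\<forall>a\<in>{1..N}.
          s i (x i a) = \<ominus> (x (i + 1) a \<otimes> hh i) \<and>
          s i (x (i + 1) a) = x i a \<otimes> hh_inv i \<and>
          (\<forall>j\<in>{1..n} - {i, i + 1}. s i (x j a) = x j a) \<and>
          s i (d i a) = \<ominus> (hh_inv i \<otimes> d (i + 1) a) \<and>
          s i (d (i + 1) a) = hh i \<otimes> d i a \<and>
          (\<forall>j\<in>{1..n} - {i, i + 1}. s i (d j a) = d j a)) \<and>
       (\<forall>j\<in>{1..n}. s i (h j) = h (Transposition.transpose i (i + 1) j))) \<and>
    (\<forall>i\<in>{1..<n}. i + 1 < n \<longrightarrow>
       (\<forall>y\<in>carrier D. s i (s (i + 1) (s i y)) = s (i + 1) (s i (s (i + 1) y)))) \<and>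
    (\<forall>i\<in>{1..<n}. \<forall>j\<in>{1..<n}. i + 1 < j \<or> j + 1 < i \<longrightarrow>
       (\<forall>y\<in>carrier D. s i (s j y) = s j (s i y))) \<and>
    (\<exists>\<phi>. group_action (sym_group n) (carrier D) \<phi> \<and>
       (\<forall>\<sigma>\<in>carrier (sym_group n). \<phi> \<sigma> \<in> Diff_aut n N) \<and>
       (\<forall>i\<in>{1..<n}. \<forall>y\<in>carrier D. \<phi> (Transposition.transpose i (i + 1)) y = s i y))"
proof -
  note D = assms(3)
  let ?t = "\<lambda>i. Transposition.transpose i (i + 1) :: nat \<Rightarrow> nat"
  define s :: "nat \<Rightarrow> 'k diff_elem \<Rightarrow> 'k diff_elem" where "s = (\<lambda>i. diff_presentation.act n N (?t i))"
  define \<phi> :: "(nat \<Rightarrow> nat) \<Rightarrow> 'k diff_elem \<Rightarrow> 'k diff_elem"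
    where "\<phi> = (\<lambda>\<sigma>. restrict (diff_presentation.act n N \<sigma>) (carrier D))"
  have perm: "?t i permutes {1..n}" if "i \<in> {1..<n}" for i
    using that by (intro diff_presentation.t_permutes[of i n]) simp_all
  have comp: "s i (s j y) = diff_presentation.act n N (?t i \<circ> ?t j) y"
    if "i \<in> {1..<n}" "j \<in> {1..<n}" "y \<in> carrier D" for i j y
    unfolding s_def using diff_presentation.act_comp[OF perm[OF that(1)] perm[OF that(2)]] that(3) by (simp only: D)
  have closed: "s i y \<in> carrier D" if "i \<in> {1..<n}" "y \<in> carrier D" for i y
    using diff_presentation.act_closed[OF perm[OF that(1)]] that(2) by (simp only: D s_def)
  have generators: "s i \<in> Diff_aut n N \<and>
       (\<forall>a\<in>{1..N}.
          s i (x i a) = \<ominus> (x (i + 1) a \<otimes> hh i) \<and>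
          s i (x (i + 1) a) = x i a \<otimes> hh_inv i \<and>
          (\<forall>j\<in>{1..n} - {i, i + 1}. s i (x j a) = x j a) \<and>
          s i (d i a) = \<ominus> (hh_inv i \<otimes> d (i + 1) a) \<and>
          s i (d (i + 1) a) = hh i \<otimes> d i a \<and>
          (\<forall>j\<in>{1..n} - {i, i + 1}. s i (d j a) = d j a)) \<and>
       (\<forall>j\<in>{1..n}. s i (h j) = h (?t i j))" if i: "i \<in> {1..<n}" for i
  proof -
    have i': "1 \<le> i" "i < n" using i by simp_all
    note x = diff_presentation.act_x[OF i' refl] and d = diff_presentation.act_d[OF i' refl] and h = diff_presentation.act_h[OF i' refl]
    show ?thesis
      unfolding assms(3-8) s_def
      by (intro conjI ballI x d h diff_presentation.act_aut[OF perm[OF i]])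
  qed
  have braid: "s i (s (i + 1) (s i y)) = s (i + 1) (s i (s (i + 1) y))"
    if "i \<in> {1..<n}" "i + 1 < n" "y \<in> carrier D" for i y
  proof -
    have j: "i + 1 \<in> {1..<n}" using that by simp
    note pi = perm[OF that(1)] and pj = perm[OF j]
    have "s i (s (i + 1) (s i y)) = diff_presentation.act n N (?t i \<circ> (?t (i + 1) \<circ> ?t i)) y"
      unfolding comp[OF j that(1,3)] unfolding s_def
      using diff_presentation.act_comp[OF pi permutes_compose[OF pi pj]] that(3) by (simp only: D)
    moreover have "s (i + 1) (s i (s (i + 1) y)) = diff_presentation.act n N (?t (i + 1) \<circ> (?t i \<circ> ?t (i + 1))) y"
      unfolding comp[OF that(1) j that(3)] unfolding s_def
      using diff_presentation.act_comp[OF pj permutes_compose[OF pj pi]] that(3) by (simp only: D)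
    moreover have "?t i \<circ> (?t (i + 1) \<circ> ?t i) = ?t (i + 1) \<circ> (?t i \<circ> ?t (i + 1))"
      by (auto simp: fun_eq_iff transpose_def)
    ultimately show ?thesis by simp
  qed
  have commute: "s i (s j y) = s j (s i y)"
    if "i \<in> {1..<n}" "j \<in> {1..<n}" "i + 1 < j \<or> j + 1 < i" "y \<in> carrier D" for i j y
  proof -
    have "?t i \<circ> ?t j = ?t j \<circ> ?t i" using that(3) by (auto simp: fun_eq_iff transpose_def)
    then show ?thesis using comp[OF that(1,2,4)] comp[OF that(2,1,4)] by simp
  qed
  have "group_action (sym_group n) (carrier D) \<phi>"
    unfolding \<phi>_def D by (rule diff_presentation.act_group_action)
  moreover have "\<phi> \<sigma> \<in> Diff_aut n N" if "\<sigma> \<in> carrier (sym_group n)" for \<sigma>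
    using that unfolding \<phi>_def D by (intro diff_presentation.restrict_act_aut) (simp add: sym_group_carrier)
  moreover have "\<phi> (?t i) y = s i y" if "y \<in> carrier D" for i y
    using that by (simp add: \<phi>_def s_def)
  ultimately show ?thesis
    using generators braid commute by (intro exI[of _ s] conjI exI[of _ \<phi>] ballI impI) blast+
qed

end
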